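(* Consider an energy harvesting sensor with average harvested energy $\bar H<E_s$ that employs the modified CUSUM test $$\bar W_k=\max\{0,\,\bar W_{k-1}+\xi_kZ_k\},\quad \bar W_0=0,\qquad Z_k=\log\frac{f_1(X_k)}{f_0(X_k)},\quad \xi_k=1_{(B_k>E_s)},$$ and let $\hat\tau_\infty(h)=\inf\{n\ge1:\bar W_n\ge h\}$ be the first passage time to a false alarm. Suppose $\{\xi_k\}$ is an irreducible aperiodic Markov chain on $\{0,1\}$ with $\xi_0=1$, with $\tilde\alpha=P(\xi_{k+1}=0\mid\xi_k=0)>0$ and $\tilde\beta=P(\xi_{k+1}=1\mid\xi_k=1)>0$, and with stationary probability $\pi_1$ of state $1$. Suppose also that under $P_\infty$ the variable $Z_1$ is non-arithmetic and takes both positive and negative values with positive probability, and that $I_0$ and $\mathcal I_{KL}$ are positive and finite. Then for every $x>0$ $$\lim_{h\to\infty}P_\infty\big(e^{-h}\hat\tau_\infty(h)>x\big)=e^{-\beta_{MRW}x},\qquad \beta_{MRW}=-\frac{\pi_1I_0\,c(\infty)}{E_\infty[\tilde S_{K_1}]},\qquad c(\infty)=\frac{(1-E_\infty[e^{S_{T_-}}])^2}{\mathcal I_{KL}\,E_\infty[T_-]},$$ and $$E_\infty[\hat\tau_\infty(h)]=\frac{e^h}{\beta_{MRW}}(1+o(1))\quad\text{as }h\to\infty.$$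
   Context: $f_0,f_1$ are probability densities (pre- and post-change), with $f_1$ absolutely continuous with respect to $f_0$; $P_\infty,E_\infty$ denote probability and expectation when the change never happens, i.e. all samples $X_1,X_2,\dots$ are i.i.d. with density $f_0$. $\mathcal I_{KL}=\int\log\frac{f_1(x)}{f_0(x)}f_1(x)\,dx$ and $I_0=-\int\log\frac{f_1(x)}{f_0(x)}f_0(x)\,dx$, so $E_\infty[Z_1]=-I_0$. Battery: $B_{k+1}=B_k+H_k-1_{(B_k>E_s)}E_s$, where $E_s>0$ is the energy needed to sense and process one sample and $\{H_k\}$ are nonnegative, i.i.d. with an absolutely continuous distribution of finite mean $\bar H$, independent of $\{X_k\}$. In the paper's setting $\xi_k$ is treated as a two-state Markov chain with transition matrix having rows $(\tilde\alpha,1-\tilde\alpha)$ (from state 0) and $(1-\tilde\beta,\tilde\beta)$ (from state 1), independent of $\{X_k\}$, so $\pi_1=\frac{1-\tilde\alpha}{(1-\tilde\alpha)+(1-\tilde\beta)}$. The Markov random walk is $\tilde S_n=\sum_{k=1}^n\xi_kZ_k$, $\tilde S_0=0$, and $K_1=\inf\{k\ge1:\tilde S_k<0\}$ is its first negative ladder epoch. The ordinary random walk is $S_n=\sum_{k=1}^nZ_k$, $S_0=0$, and $T_-=\inf\{n\ge1:S_n\le0\}$ is its first descending ladder epoch, with ladder height $S_{T_-}$.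
   Formalization: It is additionally assumed that under P_∞ almost surely S_n ≠ 0 for all n ≥ 1; otherwise the printed formula, mixing the strict epoch K_1 with the weak epoch T_-, is off by the factor 1 − P_∞(S_{T_-} = 0). *)

theory Defs
  imports "HOL-Probability.Probability"
begin

definition llr :: "(real \<Rightarrow> real) \<Rightarrow> (real \<Rightarrow> real) \<Rightarrow> real \<Rightarrow> real" where
  "llr f0 f1 x = ln (f1 x / f0 x)"

(* The integral of log (f1 / f0) against the density g is finite.  The real logarithm has ln 0 = 0
   and x / 0 = 0, so the points where log (f1 / f0) is -infinity or +infinity must be excluded
   explicitly; integrability alone would silently count them as 0. *)
definition finite_llr_integral ::
  "(real \<Rightarrow> real) \<Rightarrow> (real \<Rightarrow> real) \<Rightarrow> (real \<Rightarrow> real) \<Rightarrow> bool" where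
  "finite_llr_integral f0 f1 g \<longleftrightarrow>
     (AE x in density lborel (\<lambda>x. ennreal (g x)). 0 < f0 x \<and> 0 < f1 x) \<and>
     integrable lborel (\<lambda>x. llr f0 f1 x * g x)"

definition prob_density :: "(real \<Rightarrow> real) \<Rightarrow> bool" where
  "prob_density f \<longleftrightarrow> f \<in> borel_measurable borel \<and> (\<forall>x. 0 \<le> f x) \<and>
     prob_space (density lborel (\<lambda>x. ennreal (f x)))"

definition non_arithmetic :: "'a measure \<Rightarrow> ('a \<Rightarrow> real) \<Rightarrow> bool" where
  "non_arithmetic M Y \<longleftrightarrow> \<not> (\<exists>d. AE \<omega> in M. \<exists>m::int. Y \<omega> = d * of_int m)"


definition stochastic_matrix :: "'s set \<Rightarrow> ('s \<Rightarrow> 's \<Rightarrow> real) \<Rightarrow> bool" where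
  "stochastic_matrix S P \<longleftrightarrow> (\<forall>i\<in>S. (\<forall>j\<in>S. 0 \<le> P i j) \<and> (\<Sum>j\<in>S. P i j) = 1)"

primrec n_step :: "'s set \<Rightarrow> ('s \<Rightarrow> 's \<Rightarrow> real) \<Rightarrow> nat \<Rightarrow> 's \<Rightarrow> 's \<Rightarrow> real" where
  "n_step S P 0 i j = (if i = j then 1 else 0)"
| "n_step S P (Suc n) i j = (\<Sum>k\<in>S. P i k * n_step S P n k j)"

definition irreducible_matrix :: "'s set \<Rightarrow> ('s \<Rightarrow> 's \<Rightarrow> real) \<Rightarrow> bool" where
  "irreducible_matrix S P \<longleftrightarrow> (\<forall>i\<in>S. \<forall>j\<in>S. \<exists>n. 0 < n_step S P n i j)"

definition aperiodic_matrix :: "'s set \<Rightarrow> ('s \<Rightarrow> 's \<Rightarrow> real) \<Rightarrow> bool" where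
  "aperiodic_matrix S P \<longleftrightarrow> (\<forall>i\<in>S. Gcd {n. 1 \<le> n \<and> 0 < n_step S P n i i} = 1)"

definition stationary_distribution :: "'s set \<Rightarrow> ('s \<Rightarrow> 's \<Rightarrow> real) \<Rightarrow> ('s \<Rightarrow> real) \<Rightarrow> bool" where
  "stationary_distribution S P p \<longleftrightarrow>
     (\<forall>i\<in>S. 0 \<le> p i) \<and> (\<Sum>i\<in>S. p i) = 1 \<and> (\<forall>j\<in>S. (\<Sum>i\<in>S. p i * P i j) = p j)"

definition markov_chain ::
  "'a measure \<Rightarrow> 's set \<Rightarrow> ('s \<Rightarrow> 's \<Rightarrow> real) \<Rightarrow> (nat \<Rightarrow> 'a \<Rightarrow> 's) \<Rightarrow> bool" where
  "markov_chain M S P \<xi> \<longleftrightarrow>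
     stochastic_matrix S P \<and>
     (\<forall>n. \<xi> n \<in> measurable M (count_space UNIV) \<and> (\<forall>\<omega>\<in>space M. \<xi> n \<omega> \<in> S)) \<and>
     (\<forall>n h. \<forall>j\<in>S. 0 < \<P>(\<omega> in M. \<forall>k\<le>n. \<xi> k \<omega> = h k) \<longrightarrow>
        \<P>(\<omega> in M. \<xi> (Suc n) \<omega> = j \<bar> \<forall>k\<le>n. \<xi> k \<omega> = h k) = P (h n) j)"

(* The chain with this matrix models the sensing indicators (battery above the sensing threshold) as
   an abstract process.  The indicators of the exact battery recursion with i.i.d. harvests without
   an atom at 0 have no geometric sojourn in 0, so they are Markov only as a model. *)
definition two_state_matrix :: "real \<Rightarrow> real \<Rightarrow> nat \<Rightarrow> nat \<Rightarrow> real" where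
  "two_state_matrix \<alpha> \<beta> i j =
     (if i = 0 then (if j = 0 then \<alpha> else 1 - \<alpha>) else (if j = 0 then 1 - \<beta> else \<beta>))"


definition partial_sums :: "(nat \<Rightarrow> 'a \<Rightarrow> real) \<Rightarrow> nat \<Rightarrow> 'a \<Rightarrow> real" where
  "partial_sums Y n \<omega> = (\<Sum>k=1..n. Y k \<omega>)"

primrec cusum :: "(nat \<Rightarrow> 'a \<Rightarrow> real) \<Rightarrow> nat \<Rightarrow> 'a \<Rightarrow> real" where
  "cusum Y 0 \<omega> = 0"
| "cusum Y (Suc k) \<omega> = max 0 (cusum Y k \<omega> + Y (Suc k) \<omega>)"

(* The entry set distinguishes strict from weak ladder epochs: {..<0} as against {..0}.  The two agree
   almost surely for a random walk that almost surely never returns to 0; a non-arithmetic step law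
   with atoms does not guarantee this.
   Extended naturals, because the infimum of the empty set must be infinity; on nat it would be 0. *)
definition first_entry :: "(nat \<Rightarrow> 'a \<Rightarrow> real) \<Rightarrow> real set \<Rightarrow> 'a \<Rightarrow> enat" where
  "first_entry W A \<omega> = Inf {enat n |n. 1 \<le> n \<and> W n \<omega> \<in> A}"

(* The value on {T = infinity} is an arbitrary convention, used only where T is almost surely
   finite. *)
definition value_at :: "(nat \<Rightarrow> 'a \<Rightarrow> real) \<Rightarrow> ('a \<Rightarrow> enat) \<Rightarrow> 'a \<Rightarrow> real" where
  "value_at W T \<omega> = (case T \<omega> of enat n \<Rightarrow> W n \<omega> | \<infinity> \<Rightarrow> 0)"

definition mean_time :: "'a measure \<Rightarrow> ('a \<Rightarrow> enat) \<Rightarrow> ennreal" where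
  "mean_time M T = (\<integral>\<^sup>+\<omega>. ennreal_of_enat (T \<omega>) \<partial>M)"

end

theory Submission
  imports Defs
begin

text \<open>Sampled only at the active epochs of \<open>\<xi>\<close>, the statistic is the ordinary CUSUM statistic, a
  process that regenerates at the weak descending ladder epochs of the random walk with steps
  \<open>Z\<close>. A cycle crosses \<open>h\<close> with a small probability \<open>p h\<close>, and the renewal equation of the
  survival probabilities turns this into an exponential limit on the time scale \<open>1 / p h\<close>,
  through characteristic functions. The law of large numbers for \<open>\<xi>\<close> rescales time by
  \<open>\<pi>\<^sub>1\<close>.

  To find \<open>p h\<close>, let \<open>psi h\<close> be the probability that the walk ever reaches \<open>h\<close>. Under the
  exponentially tilted step law \<open>exp h * psi h\<close> is a bounded solution of a renewal equation with
  positive drift \<open>I_KL\<close>, so it converges to its conserved flux divided by \<open>I_KL\<close>. Time reversal at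
  the maximum of the walk expresses the flux by the ladder height, and optional stopping at the end
  of a cycle yields \<open>p h\<close> from \<open>psi\<close>. Wald's identity evaluates the mean of the ladder height of
  the thinned walk.\<close>

section \<open>Limits of bounded solutions of renewal equations\<close>

text \<open>The likelihood ratio \<open>exp Z\<close> has mean one before the change, so tilting by
  \<open>exp\<close> is a change of measure; it yields the post-change law. The resulting renewal
  equation has steps of both signs and holds on the positive half-line only, and its solution may
  jump, since the step law may have atoms. Hence the upper and lower limits are compared:
  monotonicity of \<open>psi\<close> gives a one-sided modulus that replaces continuity.

  The constant: let \<open>T\<close> be the weak ladder epoch and \<open>q = 1 - E exp S_T\<close>.
  The walk never rises above 0 with probability \<open>1 / E T\<close>, so the flux is
  \<open>q / E T\<close>. Removing from \<open>psi\<close> the paths that cross \<open>h\<close>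
  only after a first descent to 0 or below gives \<open>p h\<close> a second factor
  \<open>q\<close>, and division by the limiting mean cycle length \<open>E T\<close> gives a second
  \<open>1 / E T\<close>. In \<open>\<beta>_MRW\<close> that second \<open>1 / E T\<close> is hidden
  in the mean ladder height \<open>- I_0 * E T\<close>, and \<open>I_0\<close> cancels. Since the
  rate mixes a strict epoch of the thinned walk with a weak one of the ordinary walk, the assumption
  of no return to 0 is what identifies them.\<close>

lemma closed_subsemigroup_real:
  fixes A :: "real set"
  assumes cl: "closed A" and zero: "0 \<in> A" and add: "\<And>a b. a \<in> A \<Longrightarrow> b \<in> A \<Longrightarrow> a + b \<in> A"
    and p: "p \<in> A" "0 < p" and n: "n \<in> A" "n < 0"
  shows "A = UNIV \<or> (\<exists>d. \<forall>a\<in>A. \<exists>m::int. a = d * of_int m)"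
proof -
  have mult: "of_nat k * a \<in> A" if "a \<in> A" for k :: nat and a
    by (induction k) (use that zero add in \<open>auto simp: distrib_right\<close>)
  \<comment> \<open>If this infimum is 0, arbitrarily small positive elements combined with
    multiples of \<open>n\<close> make \<open>A\<close> dense; if it is positive, it generates a
    lattice containing \<open>A\<close>.\<close>
  define d where "d = Inf (A \<inter> {0<..})"
  have ne: "A \<inter> {0<..} \<noteq> {}" and bdd: "bdd_below (A \<inter> {0<..})"
    using p by (auto intro!: bdd_belowI[of _ 0])
  have d0: "0 \<le> d" unfolding d_def using ne by (intro cInf_greatest) auto
  have d_le: "d \<le> a" if "a \<in> A" "0 < a" for a
    unfolding d_def using that bdd by (intro cInf_lower) auto
  show ?thesis
  proof (cases "d = 0")
    case True
    have "t \<in> A" for t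
    proof -
      have "t \<in> closure A"
        unfolding closure_approachable
      proof (intro allI impI)
        fix e :: real assume "0 < e"
        then have "Inf (A \<inter> {0<..}) < e" using True d_def by simp
        then obtain x where x: "x \<in> A" "0 < x" "x < e"
          using cInf_lessD[OF ne] by auto
        \<comment> \<open>Copies of \<open>n\<close> lead below \<open>t\<close>; from there, steps
          of size \<open>x < e\<close> cannot jump over the \<open>e\<close>-neighbourhood of
          \<open>t\<close>.\<close>
        obtain N :: nat where N: "- t / (- n) < of_nat N" using reals_Archimedean2 by blast
        then have Nt: "of_nat N * n < t" using n by (simp add: field_simps)
        define k where "k = nat \<lfloor>(t - of_nat N * n) / x\<rfloor>"
        have k: "of_nat k \<le> (t - of_nat N * n) / x" "(t - of_nat N * n) / x < of_nat k + 1"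
          using x Nt unfolding k_def by (auto simp: of_nat_nat)
        have "of_nat N * n + of_nat k * x \<in> A" using mult x n add by auto
        moreover have "dist (of_nat N * n + of_nat k * x) t < e"
          using k x by (auto simp: dist_real_def field_simps abs_if)
        ultimately show "\<exists>y\<in>A. dist y t < e" by blast
      qed
      then show ?thesis using cl by simp
    qed
    then show ?thesis by auto
  next
    case False
    then have dpos: "0 < d" using d0 by simp
    have dA: "d \<in> A"
      using closure_contains_Inf[OF ne bdd] closure_mono[of "A \<inter> {0<..}" A] cl
      unfolding d_def by auto
    have small: "r = 0" if "r \<in> A" "0 \<le> r" "r < d" for r
      using d_le[of r] that by force
    have fl: "0 \<le> a - of_int \<lfloor>a / d\<rfloor> * d" "a - of_int \<lfloor>a / d\<rfloor> * d < d" for a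
      using floor_divide_lower[OF dpos, of a] floor_divide_upper[OF dpos, of a]
      by (simp_all add: distrib_right)
    \<comment> \<open>A semigroup has no subtraction, so \<open>- d\<close> has to be built. The
      remainder of \<open>n\<close> modulo \<open>d\<close> is an element of \<open>A\<close> in
      \<open>[0, d)\<close>, hence 0; adding one copy of \<open>d\<close> fewer than would bring
      \<open>n\<close> to 0 leaves \<open>- d\<close>.\<close>
    have md: "- d \<in> A"
    proof -
      have neg: "\<lfloor>n / d\<rfloor> < 0" using n dpos by (simp add: divide_neg_pos)
      have "n - of_int \<lfloor>n / d\<rfloor> * d = n + of_nat (nat (- \<lfloor>n / d\<rfloor>)) * d" using neg by simp
      then have "n - of_int \<lfloor>n / d\<rfloor> * d \<in> A" using n dA mult add by metis
      then have "n = of_int \<lfloor>n / d\<rfloor> * d" using small fl[of n] by force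
      moreover have "real (nat (- \<lfloor>n / d\<rfloor> - 1)) = - of_int \<lfloor>n / d\<rfloor> - 1" using neg by simp
      ultimately have "- d = n + of_nat (nat (- \<lfloor>n / d\<rfloor> - 1)) * d"
        by (simp add: left_diff_distrib)
      then show ?thesis using n dA mult add by metis
    qed
    have "\<exists>m::int. a = d * of_int m" if "a \<in> A" for a
    proof -
      have "a - of_int \<lfloor>a / d\<rfloor> * d \<in> A"
      proof (cases "\<lfloor>a / d\<rfloor> \<le> 0")
        case True
        then have "a - of_int \<lfloor>a / d\<rfloor> * d = a + of_nat (nat (- \<lfloor>a / d\<rfloor>)) * d" by simp
        then show ?thesis using that dA mult add by metis
      next
        case False
        then have "a - of_int \<lfloor>a / d\<rfloor> * d = a + of_nat (nat (\<lfloor>a / d\<rfloor>)) * (- d)" by simp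
        then show ?thesis using that md mult add by metis
      qed
      then have "a - of_int \<lfloor>a / d\<rfloor> * d = 0" using small fl[of a] by blast
      then have "a = d * of_int \<lfloor>a / d\<rfloor>" by (simp add: algebra_simps)
      then show ?thesis by blast
    qed
    then show ?thesis by blast
  qed
qed

text \<open>Every point outside the support lies in a null interval with rational endpoints, and
  there are only countably many of these.\<close>

lemma AE_in_support_real:
  fixes M :: "real measure"
  assumes "prob_space M" and sets: "sets M = sets borel"
  shows "AE z in M. \<forall>e>0. 0 < measure M {z - e<..<z + e}"
proof -
  interpret prob_space M by fact
  let ?Q = "{(p, q). p \<in> \<rat> \<and> q \<in> \<rat> \<and> emeasure M {p<..<q::real} = 0}"
  define N where "N = (\<Union>(p, q)\<in>?Q. {p<..<q})"
  have cQ: "countable ?Q"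
    by (rule countable_subset[of _ "\<rat> \<times> \<rat>"]) (auto intro: countable_rat)
  have "N \<in> null_sets M"
    unfolding N_def
    by (intro null_sets_UN' cQ) (auto simp: null_sets_def sets)
  then have "AE z in M. z \<notin> N" by (rule AE_not_in)
  then show ?thesis
  proof eventually_elim
    fix z assume z: "z \<notin> N"
    show "\<forall>e>0. 0 < measure M {z - e<..<z + e}"
    proof (intro allI impI, rule ccontr)
      fix e :: real assume e: "0 < e" and "\<not> 0 < measure M {z - e<..<z + e}"
      then have 0: "measure M {z - e<..<z + e} = 0" by (simp add: zero_less_measure_iff)
      obtain p where p: "p \<in> \<rat>" "z - e < p" "p < z" using e Rats_dense_in_real[of "z - e" z] by auto
      obtain q where q: "q \<in> \<rat>" "z < q" "q < z + e" using e Rats_dense_in_real[of z "z + e"] by auto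
      have "measure M {p<..<q} \<le> measure M {z - e<..<z + e}"
        using p q by (intro finite_measure_mono) (auto simp: sets)
      then have "emeasure M {p<..<q} = 0" using 0 by (simp add: emeasure_eq_measure measure_le_0_iff)
      then have "z \<in> N" unfolding N_def using p q by auto
      then show False using z by simp
    qed
  qed
qed

text \<open>The infimum of the eventual upper bounds is the limit superior at infinity; it is kept
  as the two epsilon conditions that \<open>renewal_solution\<close> takes as \<open>L_upper\<close>
  and \<open>L_freq\<close>.\<close>

lemma ex_real_limsup:
  fixes G :: "real \<Rightarrow> real"
  assumes "\<And>x. \<bar>G x\<bar> \<le> B"
  shows "\<exists>L. (\<forall>e>0. \<exists>H. \<forall>y\<ge>H. G y \<le> L + e) \<and> (\<forall>e>0. \<forall>H. \<exists>y\<ge>H. L - e \<le> G y)"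
proof -
  let ?C = "{c. \<exists>H. \<forall>y\<ge>H. G y \<le> c}"
  have "B \<in> ?C" using assms abs_le_iff by blast
  then have ne: "?C \<noteq> {}" by blast
  have bdd: "bdd_below ?C"
  proof (rule bdd_belowI[of _ "- B"])
    fix c assume "c \<in> ?C"
    then obtain H where "G H \<le> c" by auto
    then show "- B \<le> c" using assms[of H] by (simp add: abs_le_iff)
  qed
  have 1: "\<exists>H. \<forall>y\<ge>H. G y \<le> Inf ?C + e" if "0 < e" for e
  proof -
    obtain c where "c \<in> ?C" "c < Inf ?C + e" using cInf_lessD[OF ne, of "Inf ?C + e"] \<open>0 < e\<close> by auto
    then show ?thesis by force
  qed
  have 2: "\<exists>y\<ge>H. Inf ?C - e \<le> G y" if e: "0 < e" for e H
    proof (rule ccontr)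
      assume "\<not> ?thesis"
      then have "\<forall>y\<ge>H. G y \<le> Inf ?C - e" by (meson linorder_not_le less_imp_le)
      then have "Inf ?C - e \<in> ?C" by blast
      then have "Inf ?C \<le> Inf ?C - e" using bdd by (rule cInf_lower)
      then show False using e by simp
    qed
  show ?thesis using 1 2 by blast
qed

lemma integrable_indicator_Icc: "integrable lborel (indicator {a..b::real} :: real \<Rightarrow> real)"
  by (simp add: integrable_indicator_iff emeasure_lborel_Icc_eq)

lemma integrable_lborel_pair_bounded:
  fixes f :: "real \<times> 'a \<Rightarrow> real" and a b B :: real
  assumes N: "prob_space N" and f: "f \<in> borel_measurable (lborel \<Otimes>\<^sub>M N)"
    and B: "\<And>x y. \<bar>f (x, y)\<bar> \<le> B * indicator {a..b} x"
  shows "integrable (lborel \<Otimes>\<^sub>M N) f"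
proof (rule Bochner_Integration.integrable_bound[OF _ f])
  interpret N: prob_space N by fact
  interpret pair_sigma_finite lborel N ..
  show "integrable (lborel \<Otimes>\<^sub>M N) (\<lambda>w. B * indicator ({a..b} \<times> space N) w)"
  proof (intro integrable_mult_right integrable_real_indicator)
    show "{a..b} \<times> space N \<in> sets (lborel \<Otimes>\<^sub>M N)" by (intro pair_measureI) auto
    show "emeasure (lborel \<Otimes>\<^sub>M N) ({a..b} \<times> space N) < \<infinity>"
      by (subst N.emeasure_pair_measure_Times) (auto simp: emeasure_lborel_Icc_eq N.emeasure_space_1)
  qed
  show "AE w in lborel \<Otimes>\<^sub>M N. norm (f w) \<le> norm (B * indicator ({a..b} \<times> space N) w)"
  proof (rule AE_I2)
    fix w :: "real \<times> 'a" assume "w \<in> space (lborel \<Otimes>\<^sub>M N)"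
    then obtain x y where w: "w = (x, y)" "y \<in> space N" by (auto simp: space_pair_measure)
    show "norm (f w) \<le> norm (B * indicator ({a..b} \<times> space N) w)"
      using B[of x y] w by (simp add: indicator_def split: if_splits)
  qed
qed

section \<open>Two-sided renewal equation on the positive half-line\<close>

locale renewal_law = prob_space \<nu> for \<nu> :: "real measure" +
  assumes sets_nu [measurable_cong]: "sets \<nu> = sets borel"
    and nu_int: "integrable \<nu> (\<lambda>z. z)"
    and nu_nonarith: "\<nexists>d. AE z in \<nu>. \<exists>m::int. z = d * of_int m"
    and nu_pos: "0 < measure \<nu> {0<..}"
    and nu_neg: "0 < measure \<nu> {..<0}"

text \<open>Only the upper limit \<open>L\<close> is treated here. The lower limit is obtained by a
  second instance with the negated solution, which is why \<open>G\<close> is bounded in absolute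
  value and carries no sign.\<close>

locale renewal_solution = renewal_law +
  fixes G :: "real \<Rightarrow> real" and L :: real
  assumes G_meas [measurable]: "G \<in> borel_measurable borel"
    and G_bound: "\<And>x. \<bar>G x\<bar> \<le> 1"
    and G_eq: "\<And>h. 0 < h \<Longrightarrow> G h = (\<integral>z. G (h - z) \<partial>\<nu>)"
    and L_upper: "\<And>e. 0 < e \<Longrightarrow> \<exists>H. \<forall>y\<ge>H. G y \<le> L + e"
    and L_freq: "\<And>e H. 0 < e \<Longrightarrow> \<exists>y\<ge>H. L - e \<le> G y"
begin

lemma space_nu: "space \<nu> = UNIV"
  using sets_eq_imp_space_eq[OF sets_nu] by simp

lemma L_bound: "\<bar>L\<bar> \<le> 1"
proof -
  have "L \<le> 1 + e" if e: "0 < e" for e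
  proof -
    obtain y where "L - e \<le> G y" using L_freq[OF e] by blast
    then show ?thesis using G_bound[of y] by (simp add: abs_le_iff)
  qed
  moreover have "- L \<le> 1 + e" if e: "0 < e" for e
  proof -
    obtain H where "G H \<le> L + e" using L_upper[OF e] by blast
    then show ?thesis using G_bound[of H] by (simp add: abs_le_iff)
  qed
  ultimately show ?thesis by (meson abs_leI field_le_epsilon)
qed

text \<open>Almost-maximality far out propagates by the displacement \<open>s\<close>. Only some
  point within \<open>\<delta>\<close> of \<open>s\<close> is demanded, since \<open>G\<close> need
  not be continuous; the same slack makes the set of these \<open>s\<close> closed.\<close>

definition near :: "real \<Rightarrow> bool" where
  "near s \<longleftrightarrow> (\<forall>\<delta>>0. \<forall>e>0. \<exists>e'>0. \<exists>H. \<forall>y\<ge>H. L - e' \<le> G y \<longrightarrow>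
     (\<exists>x. \<bar>x - s\<bar> < \<delta> \<and> L - e \<le> G (y - x)))"

lemma nearE:
  assumes "near s" "0 < \<delta>" "0 < e"
  obtains e' H where "0 < e'"
    and "\<And>y. H \<le> y \<Longrightarrow> L - e' \<le> G y \<Longrightarrow> \<exists>x. \<bar>x - s\<bar> < \<delta> \<and> L - e \<le> G (y - x)"
  using assms unfolding near_def by blast

lemma near_0: "near 0"
  unfolding near_def
proof (intro allI impI)
  fix \<delta> e :: real assume "0 < \<delta>" "0 < e"
  then show "\<exists>e'>0. \<exists>H. \<forall>y\<ge>H. L - e' \<le> G y \<longrightarrow> (\<exists>x. \<bar>x - 0\<bar> < \<delta> \<and> L - e \<le> G (y - x))"
    by (intro exI[of _ e] conjI exI[of _ 0] allI impI) auto
qed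

lemma near_add:
  assumes a: "near a" and b: "near b"
  shows "near (a + b)"
  unfolding near_def
proof (intro allI impI)
  fix \<delta> e :: real assume \<delta>: "0 < \<delta>" and e: "0 < e"
  have \<delta>2: "0 < \<delta> / 2" using \<delta> by simp
  obtain e1 H1 where 1: "0 < e1" "\<And>y. H1 \<le> y \<Longrightarrow> L - e1 \<le> G y \<Longrightarrow> \<exists>x. \<bar>x - b\<bar> < \<delta> / 2 \<and> L - e \<le> G (y - x)"
    using nearE[OF b \<delta>2 e] by metis
  obtain e2 H2 where 2: "0 < e2" "\<And>y. H2 \<le> y \<Longrightarrow> L - e2 \<le> G y \<Longrightarrow> \<exists>x. \<bar>x - a\<bar> < \<delta> / 2 \<and> L - e1 \<le> G (y - x)"
    using nearE[OF a \<delta>2 \<open>0 < e1\<close>] by metis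
  \<comment> \<open>The threshold grows by \<open>\<bar>a\<bar> + \<delta>\<close> so that the
    intermediate point \<open>y - x\<close> still lies beyond \<open>H1\<close>.\<close>
  have "\<forall>y\<ge>max H2 (H1 + \<bar>a\<bar> + \<delta>). L - e2 \<le> G y \<longrightarrow> (\<exists>x. \<bar>x - (a + b)\<bar> < \<delta> \<and> L - e \<le> G (y - x))"
  proof (intro allI impI)
    fix y assume y: "max H2 (H1 + \<bar>a\<bar> + \<delta>) \<le> y" "L - e2 \<le> G y"
    then obtain x where x: "\<bar>x - a\<bar> < \<delta> / 2" "L - e1 \<le> G (y - x)" using 2(2)[of y] by auto
    then have "H1 \<le> y - x" using y \<delta> by (auto simp: abs_if split: if_splits)
    then obtain x' where x': "\<bar>x' - b\<bar> < \<delta> / 2" "L - e \<le> G (y - x - x')" using 1(2) x by blast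
    then show "\<exists>x. \<bar>x - (a + b)\<bar> < \<delta> \<and> L - e \<le> G (y - x)"
      using x by (intro exI[of _ "x + x'"]) (auto simp: algebra_simps abs_if split: if_splits)
  qed
  then show "\<exists>e'>0. \<exists>H. \<forall>y\<ge>H. L - e' \<le> G y \<longrightarrow> (\<exists>x. \<bar>x - (a + b)\<bar> < \<delta> \<and> L - e \<le> G (y - x))"
    using 2(1) by blast
qed

lemma near_closed: "closed {s. near s}"
proof -
  have "near s" if s: "s \<in> closure {s. near s}" for s
    unfolding near_def
  proof (intro allI impI)
    fix \<delta> e :: real assume \<delta>: "0 < \<delta>" and e: "0 < e"
    obtain s' where s': "near s'" "dist s' s < \<delta> / 2"
      using s \<delta> unfolding closure_approachable by (auto dest!: spec[of _ "\<delta> / 2"])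
    have \<delta>2: "0 < \<delta> / 2" using \<delta> by simp
    obtain e1 H1 where 1: "0 < e1" "\<And>y. H1 \<le> y \<Longrightarrow> L - e1 \<le> G y \<Longrightarrow> \<exists>x. \<bar>x - s'\<bar> < \<delta> / 2 \<and> L - e \<le> G (y - x)"
      using nearE[OF s'(1) \<delta>2 e] by metis
    have "\<forall>y\<ge>H1. L - e1 \<le> G y \<longrightarrow> (\<exists>x. \<bar>x - s\<bar> < \<delta> \<and> L - e \<le> G (y - x))"
    proof (intro allI impI)
      fix y assume "H1 \<le> y" "L - e1 \<le> G y"
      then obtain x where x: "\<bar>x - s'\<bar> < \<delta> / 2" "L - e \<le> G (y - x)" using 1 by blast
      moreover have "\<bar>x - s\<bar> \<le> \<bar>x - s'\<bar> + dist s' s" by (simp add: dist_real_def)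
      ultimately show "\<exists>x. \<bar>x - s\<bar> < \<delta> \<and> L - e \<le> G (y - x)" using s'(2) by (intro exI[of _ x]) auto
    qed
    then show "\<exists>e'>0. \<exists>H. \<forall>y\<ge>H. L - e' \<le> G y \<longrightarrow> (\<exists>x. \<bar>x - s\<bar> < \<delta> \<and> L - e \<le> G (y - x))"
      using 1(1) by blast
  qed
  then have "closure {s. near s} \<subseteq> {s. near s}" by blast
  then show ?thesis by (simp only: closure_subset_eq)
qed

text \<open>\<open>G y\<close> is an average of the values \<open>G (y - z)\<close>, nearly all of
  which are at most slightly above \<open>L\<close>. An average close to \<open>L\<close> then
  leaves no room for values below \<open>L - e\<close> on a whole interval of positive mass.\<close>

lemma near_support:
  assumes z0: "\<forall>e>0. 0 < measure \<nu> {z0 - e<..<z0 + e}"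
  shows "near z0"
  unfolding near_def
proof (intro allI impI)
  fix \<delta> e :: real assume \<delta>: "0 < \<delta>" and e: "0 < e"
  define I where "I = {z0 - \<delta><..<z0 + \<delta>}"
  define m where "m = measure \<nu> I"
  have m: "0 < m" using z0 \<delta> unfolding m_def I_def by blast
  \<comment> \<open>The loss \<open>e * m = 8 * c\<close> on the interval outweighs the excess
    \<open>2 * c\<close> over \<open>L\<close>, the contribution \<open>2 * c\<close> of the tail
    and the deficit \<open>c\<close> of \<open>G y\<close>. Only steps above \<open>n\<close> form
    the tail, as negative steps move \<open>y - z\<close> further out.\<close>
  define c where "c = e * m / 8"
  have c: "0 < c" using e m by (simp add: c_def)
  have "(\<lambda>n. measure \<nu> {real n<..}) \<longlonglongrightarrow> measure \<nu> (\<Inter>n. {real n<..})"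
    by (intro finite_Lim_measure_decseq) (auto simp: decseq_def sets_nu)
  moreover have "(\<Inter>n. {real n<..}) = {}"
    using reals_Archimedean2 less_asym by fastforce
  ultimately have "(\<lambda>n. measure \<nu> {real n<..}) \<longlonglongrightarrow> 0" by simp
  then have "\<forall>\<^sub>F n in sequentially. measure \<nu> {real n<..} < c"
    using c by (rule order_tendstoD)
  then obtain n where n: "measure \<nu> {real n<..} < c" by (auto simp: eventually_sequentially)
  obtain H2 where H2: "\<And>y. H2 \<le> y \<Longrightarrow> G y \<le> L + 2 * c" using L_upper[of "2 * c"] c by auto
  have "\<forall>y\<ge>\<bar>H2\<bar> + real n + 1. L - c \<le> G y \<longrightarrow> (\<exists>x. \<bar>x - z0\<bar> < \<delta> \<and> L - e \<le> G (y - x))"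
  proof (intro allI impI)
    fix y assume y: "\<bar>H2\<bar> + real n + 1 \<le> y" and Gy: "L - c \<le> G y"
    show "\<exists>x. \<bar>x - z0\<bar> < \<delta> \<and> L - e \<le> G (y - x)"
    proof (rule ccontr)
      assume neg: "\<nexists>x. \<bar>x - z0\<bar> < \<delta> \<and> L - e \<le> G (y - x)"
      have pt: "G (y - z) \<le> L + 2 * c - e * indicator I z + 2 * indicator {real n<..} z" for z
      proof (cases "z \<in> I")
        case True
        then have "\<bar>z - z0\<bar> < \<delta>" unfolding I_def by auto
        then have "G (y - z) < L - e" using neg by force
        then show ?thesis using c True by (auto simp: indicator_def)
      next
        case False
        show ?thesis
        proof (cases "z \<le> real n")
          case True
          then show ?thesis using H2[of "y - z"] y False by (auto simp: indicator_def)
        next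
          case False
          then show ?thesis using G_bound[of "y - z"] L_bound c \<open>z \<notin> I\<close>
            by (auto simp: indicator_def abs_if split: if_splits)
        qed
      qed
      have "G y = (\<integral>z. G (y - z) \<partial>\<nu>)" using y by (intro G_eq) auto
      also have "\<dots> \<le> (\<integral>z. L + 2 * c - e * indicator I z + 2 * indicator {real n<..} z \<partial>\<nu>)"
      proof (rule integral_mono[OF _ _ pt])
        show "integrable \<nu> (\<lambda>z. G (y - z))"
          by (rule integrable_const_bound[where B=1]) (auto simp: G_bound)
      qed (auto simp: I_def sets_nu less_top[symmetric])
      also have "\<dots> = L + 2 * c - e * m + 2 * measure \<nu> {real n<..}"
        by (subst Bochner_Integration.integral_add Bochner_Integration.integral_diff, (simp add: I_def sets_nu less_top[symmetric])+)+
           (use prob_space in \<open>simp add: m_def I_def sets_nu space_nu\<close>)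
      also have "\<dots> < L - c" using n c c_def by (simp add: field_simps)
      finally show False using Gy by simp
    qed
  qed
  then show "\<exists>e'>0. \<exists>H. \<forall>y\<ge>H. L - e' \<le> G y \<longrightarrow> (\<exists>x. \<bar>x - z0\<bar> < \<delta> \<and> L - e \<le> G (y - x))"
    using c by blast
qed

text \<open>The set of all such \<open>s\<close> is a closed semigroup that contains almost every
  step, hence points of both signs. Non-arithmeticity excludes the lattice alternative.\<close>

lemma near_all: "near s"
proof -
  have AEn: "AE z in \<nu>. near z"
    using AE_in_support_real[OF prob_space_axioms sets_nu] by eventually_elim (rule near_support)
  have ex: "\<exists>z\<in>B. near z" if "0 < measure \<nu> B" "B \<in> sets borel" for B
  proof (rule ccontr)
    assume "\<not> ?thesis"
    then have "AE z in \<nu>. z \<notin> B" using AEn by auto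
    then have "measure \<nu> B = 0"
      using that by (subst (asm) AE_iff_measurable[where N=B]) (auto simp: sets_nu space_nu measure_def)
    then show False using that by simp
  qed
  obtain p where p: "near p" "0 < p" using ex[OF nu_pos] by auto
  obtain n where n: "near n" "n < 0" using ex[OF nu_neg] by auto
  have "{s. near s} = UNIV \<or> (\<exists>d. \<forall>a\<in>{s. near s}. \<exists>m::int. a = d * of_int m)"
    by (rule closed_subsemigroup_real[OF near_closed _ _ _ p(2) _ n(2)]) (use p n near_0 near_add in auto)
  moreover have "\<not> (\<exists>d. \<forall>a\<in>{s. near s}. \<exists>m::int. a = d * of_int m)"
    using nu_nonarith AEn by (metis (mono_tags, lifting) eventually_mono mem_Collect_eq)
  ultimately show ?thesis by blast
qed

lemma near_finite:
  assumes "finite F" "0 < \<delta>" "0 < e"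
  shows "\<exists>e'>0. \<exists>H. \<forall>y\<ge>H. L - e' \<le> G y \<longrightarrow> (\<forall>s\<in>F. \<exists>x. \<bar>x - s\<bar> < \<delta> \<and> L - e \<le> G (y - x))"
  using assms(1)
proof induction
  case empty
  show ?case by (intro exI[of _ 1]) auto
next
  case (insert s F)
  obtain e1 H1 where 1: "0 < e1" "\<forall>y\<ge>H1. L - e1 \<le> G y \<longrightarrow> (\<forall>s\<in>F. \<exists>x. \<bar>x - s\<bar> < \<delta> \<and> L - e \<le> G (y - x))"
    using insert.IH by blast
  obtain e2 H2 where 2: "0 < e2" "\<forall>y\<ge>H2. L - e2 \<le> G y \<longrightarrow> (\<exists>x. \<bar>x - s\<bar> < \<delta> \<and> L - e \<le> G (y - x))"
    using nearE[OF near_all assms(2,3), of s] by metis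
  show ?case using 1 2
    by (intro exI[of _ "min e1 e2"] conjI exI[of _ "max H1 H2"]) auto
qed

text \<open>\<open>near_all\<close> provides good displacements only approximately. Since
  \<open>G\<close> cannot drop quickly in the direction given by \<open>\<sigma>\<close>, a good
  displacement on the correct side of \<open>x\<close> is good for \<open>x\<close> too, and a
  finite grid makes this uniform on the window.\<close>

lemma window:
  assumes sg: "\<bar>\<sigma>\<bar> = (1::real)"
    and reg: "\<And>e. 0 < e \<Longrightarrow> \<exists>\<delta>>0. \<forall>y u. 0 \<le> u \<and> u \<le> \<delta> \<longrightarrow> G y - e \<le> G (y - \<sigma> * u)"
    and e: "0 < e"
  shows "\<exists>e'>0. \<exists>H. \<forall>y\<ge>H. L - e' \<le> G y \<longrightarrow> (\<forall>x. \<bar>x\<bar> \<le> R \<longrightarrow> L - e \<le> G (y - x))"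
proof -
  obtain \<delta> where \<delta>: "0 < \<delta>" "\<And>y u. 0 \<le> u \<Longrightarrow> u \<le> \<delta> \<Longrightarrow> G y - e / 2 \<le> G (y - \<sigma> * u)"
    using reg[of "e / 2"] e by auto
  define K where "K = \<lceil>(R + \<delta>) / (\<delta> / 4)\<rceil>"
  define F where "F = (\<lambda>k. of_int k * (\<delta> / 4)) ` {- K - 1..K + 1}"
  have F: "finite F" by (simp add: F_def)
  have pos: "0 < \<delta> / 4" "0 < e / 2" using \<delta>(1) e by auto
  obtain e' H where e': "0 < e'" and
    H: "\<And>y s. H \<le> y \<Longrightarrow> L - e' \<le> G y \<Longrightarrow> s \<in> F \<Longrightarrow> \<exists>x. \<bar>x - s\<bar> < \<delta> / 4 \<and> L - e / 2 \<le> G (y - x)"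
    using near_finite[OF F pos] by blast
  have "\<forall>y\<ge>H. L - e' \<le> G y \<longrightarrow> (\<forall>x. \<bar>x\<bar> \<le> R \<longrightarrow> L - e \<le> G (y - x))"
  proof (intro allI impI)
    fix y x assume y: "H \<le> y" "L - e' \<le> G y" and x: "\<bar>x\<bar> \<le> R"
    \<comment> \<open>The grid point lies within \<open>\<delta> / 4\<close> below
      \<open>x - \<sigma> * \<delta> / 2\<close>. The offset guarantees that any \<open>x'\<close>
      within \<open>\<delta> / 4\<close> of it satisfies \<open>0 \<le> \<sigma> * (x - x')\<close>
      and \<open>\<sigma> * (x - x') \<le> \<delta>\<close>.\<close>
    define k where "k = \<lfloor>(x - \<sigma> * \<delta> / 2) / (\<delta> / 4)\<rfloor>"
    define s where "s = of_int k * (\<delta> / 4)"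
    have s: "s \<le> x - \<sigma> * \<delta> / 2" "x - \<sigma> * \<delta> / 2 < s + \<delta> / 4"
      using floor_divide_lower[OF pos(1), of "x - \<sigma> * \<delta> / 2"] floor_divide_upper[OF pos(1), of "x - \<sigma> * \<delta> / 2"]
      unfolding s_def k_def by (auto simp only: distrib_right mult_1)
    have s1: "\<sigma> = 1 \<or> \<sigma> = -1" using sg by (auto simp: abs_if split: if_splits)
    have "\<bar>s\<bar> \<le> R + \<delta>" using s x \<delta>(1) s1 by (auto simp: abs_if split: if_splits)
    then have "\<bar>of_int k\<bar> \<le> (R + \<delta>) / (\<delta> / 4)"
      using \<delta>(1) unfolding s_def by (simp add: abs_mult pos_le_divide_eq)
    also have "\<dots> \<le> of_int K" unfolding K_def by (rule le_of_int_ceiling)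
    finally have "\<bar>k\<bar> \<le> K" by (metis of_int_abs of_int_le_iff)
    then have "k \<in> {- K - 1..K + 1}" by auto
    then have "s \<in> F" unfolding F_def s_def by (rule imageI)
    then obtain x' where x': "\<bar>x' - s\<bar> < \<delta> / 4" "L - e / 2 \<le> G (y - x')" using H y by blast
    have "G (y - x') - e / 2 \<le> G (y - x' - \<sigma> * (\<sigma> * (x - x')))"
      using s1 s x'(1) \<delta>(1) by (intro \<delta>(2)) (auto simp: abs_if split: if_splits)
    also have "y - x' - \<sigma> * (\<sigma> * (x - x')) = y - x" using s1 by auto
    finally show "L - e \<le> G (y - x)" using x'(2) by simp
  qed
  then show ?thesis using e' by blast
qed

section \<open>The conserved flux\<close>

definition prim :: "real \<Rightarrow> real" where
  "prim x = (LBINT t=0..ereal x. G t)"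

lemma G_set_integrable: "set_integrable lborel {a..b} G"
  unfolding set_integrable_def
  by (rule Bochner_Integration.integrable_bound[OF integrable_indicator_Icc])
    (auto simp: indicator_def G_bound)

lemma G_interval_integrable: "interval_lebesgue_integrable lborel (ereal a) (ereal b) G"
proof -
  have "set_integrable lborel {a<..<b} G" for a b
    by (rule set_integrable_subset[OF G_set_integrable[of a b]]) auto
  then show ?thesis unfolding interval_lebesgue_integrable_def by (auto simp: einterval_eq)
qed

lemma prim_diff:
  assumes "a \<le> b"
  shows "prim b - prim a = (LINT t:{a..b}|lborel. G t)"
proof -
  have "prim a + (LBINT t=ereal a..ereal b. G t) = prim b"
    unfolding prim_def zero_ereal_def using G_interval_integrable
    by (intro interval_integral_sum) (simp add: min_def max_def)
  moreover have "(LBINT t=ereal a..ereal b. G t) = (LINT t:{a..b}|lborel. G t)"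
    using assms by (rule interval_integral_Icc)
  ultimately show ?thesis by simp
qed

lemma prim_0 [simp]: "prim 0 = 0"
  unfolding prim_def zero_ereal_def by (rule interval_integral_endpoints_same)

lemma prim_approx_le:
  assumes ab: "a \<le> b" and e: "\<And>t. a \<le> t \<Longrightarrow> t \<le> b \<Longrightarrow> \<bar>G t - c\<bar> \<le> e"
  shows "\<bar>prim b - prim a - c * (b - a)\<bar> \<le> e * (b - a)"
proof -
  have c: "integrable lborel (\<lambda>t. indicator {a..b} t * c)" for c :: real
    by (intro integrable_mult_left integrable_indicator_Icc)
  have cI: "(\<integral>t. indicator {a..b} t * c \<partial>lborel) = c * (b - a)" for c :: real
    using ab by (simp add: emeasure_lborel_Icc_eq)
  have G: "integrable lborel (\<lambda>t. indicator {a..b} t * G t)"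
    using G_set_integrable[of a b] by (simp add: set_integrable_def)
  have "prim b - prim a - c * (b - a) = (\<integral>t. indicator {a..b} t * G t - indicator {a..b} t * c \<partial>lborel)"
    unfolding prim_diff[OF ab] cI[symmetric] set_lebesgue_integral_def
    by (simp add: Bochner_Integration.integral_diff[OF G c])
  also have "\<bar>\<dots>\<bar> \<le> (\<integral>t. \<bar>indicator {a..b} t * G t - indicator {a..b} t * c\<bar> \<partial>lborel)"
    by (rule integral_abs_bound)
  also have "\<dots> \<le> (\<integral>t. indicator {a..b} t * e \<partial>lborel)"
    by (intro integral_mono c integrable_abs Bochner_Integration.integrable_diff G)
      (auto intro: e simp: indicator_def)
  also have "\<dots> = e * (b - a)" by (rule cI)
  finally show ?thesis .
qed

lemma prim_approx:
  assumes "\<And>t. min a b \<le> t \<Longrightarrow> t \<le> max a b \<Longrightarrow> \<bar>G t - c\<bar> \<le> e"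
  shows "\<bar>prim b - prim a - c * (b - a)\<bar> \<le> e * \<bar>b - a\<bar>"
proof (cases "a \<le> b")
  case True
  then show ?thesis using prim_approx_le[of a b c e] assms by auto
next
  case False
  then have "\<bar>prim a - prim b - c * (a - b)\<bar> \<le> e * (a - b)" using prim_approx_le[of b a c e] assms by auto
  moreover have "prim b - prim a - c * (b - a) = - (prim a - prim b - c * (a - b))"
    by (simp add: algebra_simps)
  ultimately show ?thesis using False by (simp only: abs_minus_cancel) auto
qed

lemma prim_lipschitz: "\<bar>prim b - prim a\<bar> \<le> \<bar>b - a\<bar>"
  using prim_approx[of a b 0 1] G_bound by simp

lemma prim_measurable [measurable]: "prim \<in> borel_measurable borel"
proof (rule borel_measurable_continuous_onI, rule continuous_onI)
  fix x e :: real assume "0 < e"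
  then show "\<exists>d>0. \<forall>x'\<in>UNIV. dist x' x < d \<longrightarrow> dist (prim x') (prim x) \<le> e"
    by (intro exI[of _ e]) (auto simp: dist_real_def intro: order_trans[OF prim_lipschitz])
qed

lemma flux_integrable: "integrable \<nu> (\<lambda>z. prim h - prim (h - z))"
  by (rule Bochner_Integration.integrable_bound[OF integrable_abs[OF nu_int]])
    (auto intro!: AE_I2 order_trans[OF prim_lipschitz])

text \<open>Formally the derivative of the flux in \<open>h\<close> is \<open>G h\<close> minus the
  average of \<open>G (h - z)\<close>, which is 0. Fubini on \<open>[0, h]\<close> gives the
  integrated form without differentiating; the right-hand side is the flux at 0.\<close>

lemma flux_constant:
  assumes h: "0 \<le> h"
  shows "(\<integral>z. prim h - prim (h - z) \<partial>\<nu>) = (\<integral>z. - prim (- z) \<partial>\<nu>)"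
proof -
  interpret pair_sigma_finite lborel \<nu> ..
  let ?f = "\<lambda>x z. indicator {0..h} x * (G x - G (x - z))"
  have int: "integrable (lborel \<Otimes>\<^sub>M \<nu>) (\<lambda>(x, z). ?f x z)"
  proof (rule integrable_lborel_pair_bounded[OF prob_space_axioms, where B=2 and a=0 and b=h])
    show "\<bar>case (x, z) of (x, z) \<Rightarrow> ?f x z\<bar> \<le> 2 * indicator {0..h} x" for x z
    proof (cases "x \<in> {0..h}")
      case True
      have "\<bar>G x - G (x - z)\<bar> \<le> 2" using G_bound[of x] G_bound[of "x - z"] by linarith
      then show ?thesis using True by simp
    qed simp
  qed measurable
  have pt: "prim h - prim (h - z) = - prim (- z) + (\<integral>x. ?f x z \<partial>lborel)" for z
  proof -
    have i1: "integrable lborel (\<lambda>x. indicator {0..h} x * G x)"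
      using G_set_integrable[of 0 h] unfolding set_integrable_def by simp
    have i2: "integrable lborel (\<lambda>x. indicator {0..h} x * G (x - z))"
      by (rule Bochner_Integration.integrable_bound[OF integrable_indicator_Icc[of 0 h]])
        (auto simp: indicator_def G_bound)
    have "prim (h - z) - prim (- z) = (\<integral>t. indicator {- z..h - z} t * G t \<partial>lborel)"
      using h by (subst prim_diff) (auto simp: set_lebesgue_integral_def)
    also have "\<dots> = (\<integral>x. indicator {- z..h - z} (- z + 1 * x) * G (- z + 1 * x) \<partial>lborel)"
      by (subst lborel_integral_real_affine[of 1 _ "- z"]) auto
    also have "\<dots> = (\<integral>x. indicator {0..h} x * G (x - z) \<partial>lborel)"
      by (intro Bochner_Integration.integral_cong) (auto simp: indicator_def)
    finally have 2: "prim (h - z) - prim (- z) = (\<integral>x. indicator {0..h} x * G (x - z) \<partial>lborel)" .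
    have 1: "prim h = (\<integral>x. indicator {0..h} x * G x \<partial>lborel)"
      using prim_diff[OF h] by (simp add: set_lebesgue_integral_def)
    have "(\<integral>x. ?f x z \<partial>lborel) = prim h - (prim (h - z) - prim (- z))"
      unfolding 1 2 by (subst Bochner_Integration.integral_diff[OF i1 i2, symmetric]) (simp add: right_diff_distrib)
    then show ?thesis by simp
  qed
  have "(\<integral>z. (\<integral>x. ?f x z \<partial>lborel) \<partial>\<nu>) = (\<integral>x. (\<integral>z. ?f x z \<partial>\<nu>) \<partial>lborel)"
    by (rule Fubini_integral[OF int])
  also have "\<dots> = (\<integral>x. 0 \<partial>(lborel :: real measure))"
  proof (rule integral_cong_AE)
    \<comment> \<open>The renewal equation is available for positive arguments only, so the endpoint
      0 is discarded as a null set.\<close>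
    have "AE x in lborel. x \<noteq> (0::real)" by (rule AE_lborel_singleton)
    then show "AE x in lborel. (\<integral>z. ?f x z \<partial>\<nu>) = 0"
    proof eventually_elim
      fix x :: real assume x: "x \<noteq> 0"
      have i: "integrable \<nu> (\<lambda>z. G (x - z))"
        by (rule integrable_const_bound[where B=1]) (auto simp: G_bound)
      show "(\<integral>z. ?f x z \<partial>\<nu>) = 0"
      proof (cases "0 < x")
        case True
        then show ?thesis using G_eq[OF True] i prob_space by (simp add: Bochner_Integration.integral_diff)
      next
        case False
        then show ?thesis using x by (simp add: indicator_def)
      qed
    qed
  qed measurable
  finally have 0: "(\<integral>z. (\<integral>x. ?f x z \<partial>lborel) \<partial>\<nu>) = 0" by simp
  have int2: "integrable \<nu> (\<lambda>z. \<integral>x. ?f x z \<partial>lborel)"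
    by (rule integrable_snd[OF int])
  have int1: "integrable \<nu> (\<lambda>z. - prim (- z))" using flux_integrable[of 0] by simp
  show ?thesis unfolding pt using 0 by (subst Bochner_Integration.integral_add[OF int1 int2]) simp
qed

lemma limsup_flux:
  assumes sg: "\<bar>\<sigma>\<bar> = (1::real)"
    and reg: "\<And>e. 0 < e \<Longrightarrow> \<exists>\<delta>>0. \<forall>y u. 0 \<le> u \<and> u \<le> \<delta> \<longrightarrow> G y - e \<le> G (y - \<sigma> * u)"
  shows "L * (\<integral>z. z \<partial>\<nu>) = (\<integral>z. - prim (- z) \<partial>\<nu>)"
proof -
  let ?\<Phi> = "\<integral>z. - prim (- z) \<partial>\<nu>" and ?A = "\<integral>z. \<bar>z\<bar> \<partial>\<nu>"
  \<comment> \<open>Steps longer than \<open>n\<close> leave the window. There \<open>G\<close>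
    differs from \<open>L\<close> by at most 2, so the error is at most
    \<open>2 * \<bar>z\<bar>\<close>, whose tail integral vanishes by integrability.\<close>
  let ?t = "\<lambda>n z. 2 * (\<bar>z\<bar> * indicator {z. real n < \<bar>z\<bar>} z)"
  have lim: "(\<lambda>n. \<integral>z. ?t n z \<partial>\<nu>) \<longlonglongrightarrow> (\<integral>z. 0 \<partial>\<nu>)"
  proof (rule integral_dominated_convergence[where w="\<lambda>z. 2 * \<bar>z\<bar>"])
    show "AE z in \<nu>. (\<lambda>n. ?t n z) \<longlonglongrightarrow> 0"
    proof (intro AE_I2 tendsto_eventually)
      fix z :: real
      obtain N where "\<bar>z\<bar> < real N" using reals_Archimedean2 by blast
      then show "\<forall>\<^sub>F n in sequentially. ?t n z = 0"
        by (intro eventually_sequentiallyI[of N]) (auto simp: indicator_def)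
    qed
    show "integrable \<nu> (\<lambda>z. 2 * \<bar>z\<bar>)" using nu_int by (intro integrable_mult_right integrable_abs)
    show "AE z in \<nu>. norm (?t n z) \<le> 2 * \<bar>z\<bar>" for n by (intro AE_I2) (simp add: indicator_def)
  qed measurable
  have ia: "integrable \<nu> (\<lambda>z. e * \<bar>z\<bar>)" for e :: real
    using nu_int by (intro integrable_mult_right integrable_abs)
  have it: "integrable \<nu> (?t n)" for n
  proof (rule Bochner_Integration.integrable_bound[OF ia[of 2]])
    show "AE z in \<nu>. norm (?t n z) \<le> norm (2 * \<bar>z\<bar>)" by (intro AE_I2) (simp add: indicator_def)
  qed measurable
  have iL: "integrable \<nu> (\<lambda>z. L * z)" using nu_int by (rule integrable_mult_right)
  have bound: "\<bar>?\<Phi> - L * (\<integral>z. z \<partial>\<nu>)\<bar> \<le> e * ?A + (\<integral>z. ?t n z \<partial>\<nu>)" if e: "0 < e" for e n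
  proof -
    obtain e' H where e': "0 < e'" and H: "\<And>y x. H \<le> y \<Longrightarrow> L - e' \<le> G y \<Longrightarrow> \<bar>x\<bar> \<le> real n \<Longrightarrow> L - e \<le> G (y - x)"
      using window[OF sg reg e, of "real n"] by metis
    obtain H' where H': "\<And>y. H' \<le> y \<Longrightarrow> G y \<le> L + e" using L_upper[OF e] by blast
    \<comment> \<open>The lower bound on \<open>G\<close> throughout the window comes from
      \<open>window\<close>; the upper bound is valid beyond \<open>H'\<close> only, hence the extra
      distance \<open>real n\<close>.\<close>
    obtain y where y: "max 0 (max H (H' + real n)) \<le> y" "L - e' \<le> G y" using L_freq[OF e'] by blast
    have pt: "\<bar>prim y - prim (y - z) - L * z\<bar> \<le> e * \<bar>z\<bar> + ?t n z" for z
    proof (cases "\<bar>z\<bar> \<le> real n")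
      case True
      have "\<bar>prim y - prim (y - z) - L * (y - (y - z))\<bar> \<le> e * \<bar>y - (y - z)\<bar>"
      proof (rule prim_approx)
        fix t assume t: "min (y - z) y \<le> t" "t \<le> max (y - z) y"
        have t1: "\<bar>y - t\<bar> \<le> real n" using True t by linarith
        then have "L - e \<le> G t" using H[of y "y - t"] y by simp
        moreover have "G t \<le> L + e" using t1 y by (intro H') linarith
        ultimately show "\<bar>G t - L\<bar> \<le> e" by linarith
      qed
      then show ?thesis by (simp add: indicator_def)
    next
      case False
      have "\<bar>prim y - prim (y - z) - L * (y - (y - z))\<bar> \<le> 2 * \<bar>y - (y - z)\<bar>"
      proof (rule prim_approx)
        fix t show "\<bar>G t - L\<bar> \<le> 2" using G_bound[of t] L_bound by linarith
      qed
      then show ?thesis using False e by (auto simp: indicator_def intro: add_increasing)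
    qed
    have id: "integrable \<nu> (\<lambda>z. prim y - prim (y - z) - L * z)"
      by (rule Bochner_Integration.integrable_diff[OF flux_integrable iL])
    have "?\<Phi> - L * (\<integral>z. z \<partial>\<nu>) = (\<integral>z. prim y - prim (y - z) - L * z \<partial>\<nu>)"
      using y flux_constant[of y] by (simp add: Bochner_Integration.integral_diff[OF flux_integrable iL])
    also have "\<bar>\<dots>\<bar> \<le> (\<integral>z. \<bar>prim y - prim (y - z) - L * z\<bar> \<partial>\<nu>)"
      by (rule integral_abs_bound)
    also have "\<dots> \<le> (\<integral>z. e * \<bar>z\<bar> + ?t n z \<partial>\<nu>)"
      by (rule integral_mono[OF integrable_abs[OF id] Bochner_Integration.integrable_add[OF ia it] pt])
    also have "\<dots> = e * ?A + (\<integral>z. ?t n z \<partial>\<nu>)"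
      by (simp only: Bochner_Integration.integral_add[OF ia it] integral_mult_right_zero)
    finally show ?thesis .
  qed
  have *: "\<bar>?\<Phi> - L * (\<integral>z. z \<partial>\<nu>)\<bar> \<le> e * ?A" if e: "0 < e" for e
  proof (rule LIMSEQ_le_const)
    show "(\<lambda>n. e * ?A + (\<integral>z. ?t n z \<partial>\<nu>)) \<longlonglongrightarrow> e * ?A"
      using tendsto_add[OF tendsto_const lim, of "e * ?A"] by simp
  qed (use bound[OF e] in auto)
  obtain a where a: "a = ?A" and A: "0 \<le> a" by simp
  have "\<bar>?\<Phi> - L * (\<integral>z. z \<partial>\<nu>)\<bar> \<le> 0"
  proof (rule field_le_epsilon)
    fix d :: real assume d: "0 < d"
    have "d / (a + 1) * a \<le> d" using A d by (simp add: field_simps)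
    then show "\<bar>?\<Phi> - L * (\<integral>z. z \<partial>\<nu>)\<bar> \<le> 0 + d" using *[of "d / (a + 1)"] A d
      unfolding a[symmetric] by simp
  qed
  then show ?thesis by simp
qed

end

text \<open>Along a sequence on which the solution approaches its upper or lower limit it is
  asymptotically constant on long windows; there the conserved flux is drift times value, so both
  limits agree.\<close>
lemma (in renewal_law) renewal_limit:
  fixes g :: "real \<Rightarrow> real"
  assumes g [measurable]: "g \<in> borel_measurable borel"
    and g0: "\<And>x. 0 \<le> g x" and g1: "\<And>x. g x \<le> 1"
    and eq: "\<And>h. 0 < h \<Longrightarrow> g h = (\<integral>z. g (h - z) \<partial>\<nu>)"
    and growth: "\<And>x u. 0 \<le> u \<Longrightarrow> g (x + u) \<le> exp u * g x"
    and drift: "0 < (\<integral>z. z \<partial>\<nu>)"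
  shows "(g \<longlongrightarrow> (\<integral>z. - (LBINT t=0..ereal (- z). g t) \<partial>\<nu>) / (\<integral>z. z \<partial>\<nu>)) at_top"
proof -
  let ?C = "(\<integral>z. - (LBINT t=0..ereal (- z). g t) \<partial>\<nu>) / (\<integral>z. z \<partial>\<nu>)"
  have b: "\<bar>g x\<bar> \<le> 1" for x using g0[of x] g1[of x] by simp
  \<comment> \<open>With \<open>g \<le> 1\<close>, growth by at most \<open>exp u\<close> becomes an
    additive one-sided modulus: \<open>g\<close> may jump down but not up.\<close>
  have small: "\<exists>\<delta>>0. exp \<delta> \<le> 1 + e" if "0 < e" for e :: real
    using that by (intro exI[of _ "ln (1 + e)"]) auto
  obtain L where L1: "\<And>e. 0 < e \<Longrightarrow> \<exists>H. \<forall>y\<ge>H. g y \<le> L + e" and L2: "\<And>e H. 0 < e \<Longrightarrow> \<exists>y\<ge>H. L - e \<le> g y"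
    using ex_real_limsup[of g 1] b by blast
  interpret P: renewal_solution \<nu> g L
    by unfold_locales (use b eq L1 L2 in auto)
  have up: "L = ?C"
  proof -
    have "L * (\<integral>z. z \<partial>\<nu>) = (\<integral>z. - P.prim (- z) \<partial>\<nu>)"
    proof (rule P.limsup_flux[of 1])
      fix e :: real assume e: "0 < e"
      obtain \<delta> where \<delta>: "0 < \<delta>" "exp \<delta> \<le> 1 + e" using small[OF e] by blast
      have "g y - e \<le> g (y - u)" if u: "0 \<le> u" "u \<le> \<delta>" for y u
      proof -
        have "g y \<le> exp u * g (y - u)" using growth[OF u(1), of "y - u"] by simp
        also have "\<dots> \<le> (1 + e) * g (y - u)" using u \<delta> g0 by (intro mult_right_mono) (auto intro: order_trans[of _ "exp \<delta>"])
        also have "\<dots> \<le> g (y - u) + e" using mult_left_mono[OF g1[of "y - u"], of e] e by (simp add: distrib_right)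
        finally show ?thesis by simp
      qed
      then show "\<exists>\<delta>>0. \<forall>y u. 0 \<le> u \<and> u \<le> \<delta> \<longrightarrow> g y - e \<le> g (y - 1 * u)" using \<delta>(1) by auto
    qed simp
    then show ?thesis using drift unfolding P.prim_def by (simp add: field_simps)
  qed
  obtain L' where L1': "\<And>e. 0 < e \<Longrightarrow> \<exists>H. \<forall>y\<ge>H. - g y \<le> L' + e" and L2': "\<And>e H. 0 < e \<Longrightarrow> \<exists>y\<ge>H. L' - e \<le> - g y"
    using ex_real_limsup[of "\<lambda>x. - g x" 1, unfolded abs_minus_cancel, OF b] by blast
  \<comment> \<open>For the negated solution the same growth bound controls displacements to the
    right, so \<open>limsup_flux\<close> is used with \<open>\<sigma> = -1\<close>.\<close>
  interpret N: renewal_solution \<nu> "\<lambda>x. - g x" L'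
    by unfold_locales (use b eq L1' L2' in auto)
  have low: "L' = - ?C"
  proof -
    have "L' * (\<integral>z. z \<partial>\<nu>) = (\<integral>z. - N.prim (- z) \<partial>\<nu>)"
    proof (rule N.limsup_flux[of "-1"])
      fix e :: real assume e: "0 < e"
      obtain \<delta> where \<delta>: "0 < \<delta>" "exp \<delta> \<le> 1 + e" using small[OF e] by blast
      have "- g y - e \<le> - g (y - - 1 * u)" if u: "0 \<le> u" "u \<le> \<delta>" for y u
      proof -
        have "g (y + u) \<le> exp u * g y" using growth[OF u(1)] by simp
        also have "\<dots> \<le> (1 + e) * g y" using u \<delta> g0 by (intro mult_right_mono) (auto intro: order_trans[of _ "exp \<delta>"])
        also have "\<dots> \<le> g y + e" using mult_left_mono[OF g1[of y], of e] e by (simp add: distrib_right)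
        finally show ?thesis by simp
      qed
      then show "\<exists>\<delta>>0. \<forall>y u. 0 \<le> u \<and> u \<le> \<delta> \<longrightarrow> - g y - e \<le> - g (y - - 1 * u)"
        using \<delta>(1) by blast
    qed simp
    moreover have "N.prim x = - (LBINT t=0..ereal x. g t)" for x
      unfolding N.prim_def by (rule interval_lebesgue_integral_uminus)
    ultimately show ?thesis using drift by (simp add: field_simps)
  qed
  show ?thesis
  proof (rule tendstoI)
    fix e :: real assume e: "0 < e"
    then have "0 < e / 2" by simp
    obtain H1 where "\<forall>y\<ge>H1. g y \<le> L + e / 2" using L1[OF \<open>0 < e / 2\<close>] by blast
    moreover obtain H2 where "\<forall>y\<ge>H2. - g y \<le> L' + e / 2" using L1'[OF \<open>0 < e / 2\<close>] by blast
    ultimately show "\<forall>\<^sub>F y in at_top. dist (g y) ?C < e"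
      unfolding up low dist_real_def eventually_at_top_linorder
      using e by (intro exI[of _ "max H1 H2"]) (force simp: abs_if)
  qed
qed

section \<open>Random walk, running maximum and ladder epochs\<close>

definition walk :: "(nat \<Rightarrow> real) \<Rightarrow> nat \<Rightarrow> real" where
  "walk y n = sum y {..<n}"

lemma walk_0 [simp]: "walk y 0 = 0"
  by (simp add: walk_def)

lemma walk_Suc: "walk y (Suc n) = walk y n + y n"
  by (simp add: walk_def)

lemma walk_add: "walk y (k + j) = walk y k + walk (\<lambda>i. y (k + i)) j"
  by (induction j) (simp_all add: walk_Suc)

lemma walk_cong: "(\<And>i. i < n \<Longrightarrow> y i = z i) \<Longrightarrow> walk y n = walk z n"
  by (auto simp: walk_def)

text \<open>A pointwise substitute for measurability with respect to the first \<open>k\<close>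
  coordinates; it is the form in which \<open>comb_seq\<close> can exchange the tail of a
  sequence.\<close>

definition depends :: "nat \<Rightarrow> ((nat \<Rightarrow> real) \<Rightarrow> 'b) \<Rightarrow> bool" where
  "depends k F \<longleftrightarrow> (\<forall>y z. (\<forall>i<k. y i = z i) \<longrightarrow> F y = F z)"

lemma dependsI: "(\<And>y z. (\<And>i. i < k \<Longrightarrow> y i = z i) \<Longrightarrow> F y = F z) \<Longrightarrow> depends k F"
  unfolding depends_def by blast

lemma depends_comb_seq: "depends k F \<Longrightarrow> F (comb_seq k y z) = F y"
  by (auto simp: depends_def comb_seq_less)

lemma comb_seq_shift: "(\<lambda>i. comb_seq k y z (k + i)) = z"
  using comb_seq_add[of k y z] by (simp add: add.commute fun_eq_iff)

definition run_max :: "nat \<Rightarrow> (nat \<Rightarrow> real) \<Rightarrow> real" where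
  "run_max n y = Max (walk y ` {..n})"

lemma run_max_ge_iff: "h \<le> run_max n y \<longleftrightarrow> (\<exists>k\<le>n. h \<le> walk y k)"
  unfolding run_max_def by (subst Max_ge_iff) auto

lemma run_max_nonneg: "0 \<le> run_max n y"
  unfolding run_max_ge_iff by (intro exI[of _ 0]) simp

definition pos_upto :: "nat \<Rightarrow> (nat \<Rightarrow> real) \<Rightarrow> bool" where
  "pos_upto k y \<longleftrightarrow> (\<forall>j\<in>{1..k}. 0 < walk y j)"

lemma pos_upto_Suc: "pos_upto (Suc k) y \<longleftrightarrow> pos_upto k y \<and> 0 < walk y (Suc k)"
  by (auto simp: pos_upto_def le_Suc_eq)

lemma pos_upto_depends: "depends k (pos_upto k)"
proof (rule dependsI)
  fix y z :: "nat \<Rightarrow> real" assume *: "\<And>i. i < k \<Longrightarrow> y i = z i"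
  have "walk y j = walk z j" if "j \<le> k" for j using * that by (intro walk_cong) auto
  then show "pos_upto k y = pos_upto k z" by (auto simp: pos_upto_def)
qed

text \<open>Exactly one index is the first one at which the path attains its running maximum.\<close>
lemma first_argmax_sum:
  fixes f :: "real \<Rightarrow> real"
  shows "f (run_max n y) = (\<Sum>k\<le>n. (if \<forall>j<k. walk y j < walk y k then f (walk y k) else 0) *
     (if \<forall>j\<in>{1..n - k}. walk (\<lambda>i. y (k + i)) j \<le> 0 then 1 else 0))"
proof -
  let ?P = "\<lambda>k. k \<le> n \<and> walk y k = run_max n y"
  have "run_max n y \<in> walk y ` {..n}" unfolding run_max_def by (intro Max_in) auto
  then have "\<exists>k. ?P k" by auto
  define k0 where "k0 = (LEAST k. ?P k)"
  have k0: "k0 \<le> n" "walk y k0 = run_max n y" using LeastI_ex[OF \<open>\<exists>k. ?P k\<close>] by (auto simp: k0_def)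
  have le: "walk y k \<le> run_max n y" if "k \<le> n" for k using that run_max_ge_iff by blast
  have lt: "walk y j < walk y k0" if "j < k0" for j
    using le[of j] not_less_Least[of j ?P] that k0 unfolding k0_def[symmetric] by auto
  have shift: "walk (\<lambda>i. y (k + i)) j = walk y (k + j) - walk y k" for k j by (simp add: walk_add)
  have "(if \<forall>j<k. walk y j < walk y k then f (walk y k) else 0) *
     (if \<forall>j\<in>{1..n - k}. walk (\<lambda>i. y (k + i)) j \<le> 0 then 1 else 0) = (if k = k0 then f (run_max n y) else 0)"
    if k: "k \<le> n" for k
  proof (cases k k0 rule: linorder_cases)
    case less
    then have "k0 - k \<in> {1..n - k}" "\<not> walk (\<lambda>i. y (k + i)) (k0 - k) \<le> 0"
      using lt[OF less] k0 by (auto simp: shift)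
    then show ?thesis using less by auto
  next
    case equal
    then show ?thesis using k0 lt le by (auto simp: shift)
  next
    case greater
    then have "\<not> (\<forall>j<k. walk y j < walk y k)" using le[OF k] k0 by (auto simp: not_less)
    then show ?thesis using greater by auto
  qed
  then have "(\<Sum>k\<le>n. (if \<forall>j<k. walk y j < walk y k then f (walk y k) else 0) *
     (if \<forall>j\<in>{1..n - k}. walk (\<lambda>i. y (k + i)) j \<le> 0 then 1 else 0)) = (\<Sum>k\<le>n. if k = k0 then f (run_max n y) else 0)"
    by (intro sum.cong) auto
  also have "\<dots> = f (run_max n y)" using k0 by simp
  finally show ?thesis by simp
qed

text \<open>Being the identity from \<open>k\<close> on keeps the reversal injective on all indices,
  as \<open>integral_reindex\<close> requires.\<close>

definition rev_index :: "nat \<Rightarrow> nat \<Rightarrow> nat" where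
  "rev_index k i = (if i < k then k - 1 - i else i)"

lemma inj_rev_index: "inj (rev_index k)"
  by (rule injI) (auto simp: rev_index_def split: if_splits)

lemma walk_rev:
  assumes "i \<le> k"
  shows "walk (\<lambda>n. y (rev_index k n)) i = walk y k - walk y (k - i)"
  using assms
proof (induction i)
  case (Suc i)
  then have "walk y (k - i) = walk y (k - Suc i) + y (k - Suc i)"
    by (metis Suc_diff_Suc Suc_le_lessD walk_Suc)
  with Suc show ?case by (simp add: walk_Suc rev_index_def)
qed simp

section \<open>The i.i.d. product space\<close>

locale iid_steps = prob_space \<mu> for \<mu> :: "real measure" +
  assumes sets_mu [measurable_cong]: "sets \<mu> = sets borel"
begin

sublocale seq: sequence_space \<mu> ..

abbreviation Q :: "(nat \<Rightarrow> real) measure" where "Q \<equiv> PiM UNIV (\<lambda>_. \<mu>)"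

lemma space_mu [simp]: "space \<mu> = UNIV"
  using sets_eq_imp_space_eq[OF sets_mu] by simp

lemma sets_Q [measurable_cong]: "sets Q = sets (PiM UNIV (\<lambda>_. borel))"
  by (intro sets_PiM_cong) (auto simp: sets_mu)

lemma space_Q [simp]: "space Q = UNIV"
  by (simp add: space_PiM)

lemma walk_measurable [measurable]: "(\<lambda>y. walk y n) \<in> borel_measurable Q"
  unfolding walk_def by measurable

lemma run_max_measurable [measurable]: "run_max n \<in> borel_measurable Q"
proof -
  have "(\<lambda>y. run_max n y) \<in> borel_measurable Q"
    unfolding run_max_def by (rule borel_measurable_Max) auto
  then show ?thesis by simp
qed

lemma pos_upto_measurable [measurable]: "Measurable.pred Q (pos_upto k)"
proof -
  have "Measurable.pred Q (\<lambda>y. \<forall>j\<in>{1..k}. 0 < walk y j)" by measurable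
  then show ?thesis by (simp add: pos_upto_def[abs_def])
qed

lemma shift_measurable [measurable]: "(\<lambda>y i. y (k + i)) \<in> measurable Q Q"
  by (rule measurable_PiM_single') (auto intro!: measurable_component_singleton)

lemma reindex_measurable: "(\<lambda>y i. y (j i)) \<in> measurable Q Q"
  by (rule measurable_PiM_single') (auto intro!: measurable_component_singleton)

text \<open>An i.i.d. sequence read along distinct indices has the same law. The reversal of
  finitely many steps is one such reading.\<close>

lemma integral_reindex:
  fixes F :: "(nat \<Rightarrow> real) \<Rightarrow> real"
  assumes "inj j" and F: "F \<in> borel_measurable Q"
  shows "(\<integral>y. F (\<lambda>i. y (j i)) \<partial>Q) = (\<integral>y. F y \<partial>Q)"
proof -
  have "distr Q Q (\<lambda>y. \<lambda>n\<in>UNIV. y (j n)) = Q"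
    using distr_PiM_reindex[of UNIV "\<lambda>_. \<mu>" j UNIV] assms prob_space_axioms by auto
  then have "distr Q Q (\<lambda>y i. y (j i)) = Q" unfolding restrict_UNIV .
  then have "(\<integral>y. F y \<partial>Q) = (\<integral>y. F y \<partial>distr Q Q (\<lambda>y i. y (j i)))" by simp
  also have "\<dots> = (\<integral>y. F (\<lambda>i. y (j i)) \<partial>Q)"
    by (rule integral_distr[OF reindex_measurable F])
  finally show ?thesis by simp
qed

lemma integral_component:
  fixes f :: "real \<Rightarrow> real"
  assumes [measurable]: "f \<in> borel_measurable borel"
  shows "(\<integral>y. f (y i) \<partial>Q) = (\<integral>z. f z \<partial>\<mu>)"
    and "integrable Q (\<lambda>y. f (y i)) \<longleftrightarrow> integrable \<mu> f"
proof -
  have d: "distr Q \<mu> (\<lambda>y. y i) = \<mu>" using seq.PiM_component[of i] by simp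
  have f: "f \<in> borel_measurable \<mu>" by measurable
  have c: "(\<lambda>y. y i) \<in> measurable Q \<mu>" by measurable
  show "(\<integral>y. f (y i) \<partial>Q) = (\<integral>z. f z \<partial>\<mu>)"
    using integral_distr[OF c f] unfolding d by simp
  show "integrable Q (\<lambda>y. f (y i)) \<longleftrightarrow> integrable \<mu> f"
    using integrable_distr_eq[OF c f] unfolding d by simp
qed

lemma comb_seq_measurable:
  "(\<lambda>w. comb_seq k (fst w) (snd w)) \<in> measurable (Q \<Otimes>\<^sub>M Q) Q"
  using measurable_comb_seq[of k \<mu>] by (simp add: split_beta')

lemma distr_comb_seq: "distr (Q \<Otimes>\<^sub>M Q) Q (\<lambda>w. comb_seq k (fst w) (snd w)) = Q"
  using seq.PiM_comb_seq[of k] by (simp add: split_beta')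

lemma integral_split:
  fixes F :: "(nat \<Rightarrow> real) \<Rightarrow> real"
  assumes "integrable Q F"
  shows "(\<integral>y. F y \<partial>Q) = (\<integral>y. (\<integral>z. F (comb_seq k y z) \<partial>Q) \<partial>Q)"
proof -
  interpret QQ: pair_sigma_finite Q Q ..
  have F: "F \<in> borel_measurable Q" using assms by auto
  have i: "integrable (Q \<Otimes>\<^sub>M Q) (\<lambda>(y, z). F (comb_seq k y z))"
    using integrable_distr_eq[OF comb_seq_measurable[of k] F] assms unfolding distr_comb_seq by (simp add: split_beta')
  have "(\<integral>y. F y \<partial>Q) = (\<integral>w. F (comb_seq k (fst w) (snd w)) \<partial>(Q \<Otimes>\<^sub>M Q))"
    using integral_distr[OF comb_seq_measurable[of k] F] unfolding distr_comb_seq .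
  also have "\<dots> = (\<integral>y. (\<integral>z. F (comb_seq k y z) \<partial>Q) \<partial>Q)"
    using QQ.integral_fst'[OF i] by (simp add: split_beta')
  finally show ?thesis .
qed

text \<open>Replacing the tail after \<open>k\<close> by an independent copy does not change the
  law; \<open>a\<close> ignores the tail and \<open>b\<close> reads nothing else, so the integral
  factors.\<close>

lemma indep_split:
  fixes a b :: "(nat \<Rightarrow> real) \<Rightarrow> real"
  assumes a: "integrable Q a" and b: "integrable Q b" and dep: "depends k a"
  shows "integrable Q (\<lambda>y. a y * b (\<lambda>i. y (k + i)))"
    and "(\<integral>y. a y * b (\<lambda>i. y (k + i)) \<partial>Q) = (\<integral>y. a y \<partial>Q) * (\<integral>y. b y \<partial>Q)"
proof -
  interpret QQ: pair_sigma_finite Q Q ..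
  let ?F = "\<lambda>y. a y * b (\<lambda>i. y (k + i))"
  have [measurable]: "a \<in> borel_measurable Q" "b \<in> borel_measurable Q" using a b by auto
  have F: "?F \<in> borel_measurable Q" by measurable
  have eq: "?F (comb_seq k y z) = a y * b z" for y z
    using depends_comb_seq[OF dep] by (simp add: comb_seq_shift)
  have "integrable (Q \<Otimes>\<^sub>M Q) (\<lambda>w. a (fst w) * b (snd w))"
  proof (rule QQ.Fubini_integrable)
    show "integrable Q (\<lambda>x. \<integral>y. norm (a (fst (x, y)) * b (snd (x, y))) \<partial>Q)"
      using a by (simp add: abs_mult)
    show "AE x in Q. integrable Q (\<lambda>y. a (fst (x, y)) * b (snd (x, y)))"
      using b by simp
  qed measurable
  then have "integrable (Q \<Otimes>\<^sub>M Q) (\<lambda>w. ?F (comb_seq k (fst w) (snd w)))" by (simp only: eq)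
  then show i: "integrable Q ?F"
    using integrable_distr_eq[OF comb_seq_measurable[of k] F] unfolding distr_comb_seq by blast
  show "(\<integral>y. ?F y \<partial>Q) = (\<integral>y. a y \<partial>Q) * (\<integral>y. b y \<partial>Q)"
    by (subst integral_split[OF i, of k]) (simp only: eq, simp)
qed

lemma integrable_Q_bounded:
  fixes F :: "(nat \<Rightarrow> real) \<Rightarrow> real"
  assumes "F \<in> borel_measurable Q" and "\<And>y. \<bar>F y\<bar> \<le> B"
  shows "integrable Q F"
  by (rule seq.P.integrable_const_bound[where B=B]) (use assms in auto)

text \<open>The one-step Markov property: the step \<open>y k\<close> is independent of the past, on
  which \<open>A\<close> and \<open>walk y k\<close> depend, and can be integrated out
  first.\<close>

lemma integral_step:
  fixes F :: "real \<Rightarrow> real \<Rightarrow> real"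
  assumes [measurable]: "case_prod F \<in> borel_measurable (borel \<Otimes>\<^sub>M borel)" and B: "\<And>x z. \<bar>F x z\<bar> \<le> B"
    and [measurable]: "Measurable.pred Q A" and dep: "depends k A"
  shows "(\<integral>y. (if A y then F (walk y k) (y k) else 0) \<partial>Q) =
    (\<integral>y. (if A y then (\<integral>z. F (walk y k) z \<partial>\<mu>) else 0) \<partial>Q)"
proof -
  let ?F = "\<lambda>y. if A y then F (walk y k) (y k) else 0"
  have Fm: "(\<lambda>y. F (walk y k) (y k)) \<in> borel_measurable Q" by measurable
  have F: "?F \<in> borel_measurable Q" using Fm by measurable
  have B0: "0 \<le> B" using B[of 0 0] by simp
  have i: "integrable Q ?F" using F by (rule integrable_Q_bounded[where B=B]) (auto simp: B B0)
  have eq: "?F (comb_seq k y z) = (if A y then F (walk y k) (z 0) else 0)" for y z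
  proof -
    have "walk (comb_seq k y z) k = walk y k" by (rule walk_cong) (simp add: comb_seq_less)
    moreover have "comb_seq k y z k = z 0" using comb_seq_add[of k y z 0] by simp
    ultimately show ?thesis using depends_comb_seq[OF dep, of y z] by simp
  qed
  have Fx: "F x \<in> borel_measurable borel" for x
    using measurable_Pair2[OF assms(1), of x] by simp
  show ?thesis
    by (subst integral_split[OF i, of k]) (simp only: eq, auto intro!: Bochner_Integration.integral_cong simp: integral_component(1)[OF Fx])
qed

text \<open>At the first index of the maximum the past and the future separate. Read backwards, a
  strict record at \<open>k\<close> says that the walk stays positive up to \<open>k\<close>,
  whereas the future is a fresh walk that stays nonpositive.\<close>

lemma expectation_run_max:
  fixes f :: "real \<Rightarrow> real"
  assumes [measurable]: "f \<in> borel_measurable borel" and B: "\<And>x. \<bar>f x\<bar> \<le> B"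
  shows "(\<integral>y. f (run_max n y) \<partial>Q) = (\<Sum>k\<le>n. (\<integral>y. (if pos_upto k y then f (walk y k) else 0) \<partial>Q) *
    (\<integral>y. (if \<forall>j\<in>{1..n - k}. walk y j \<le> 0 then 1 else 0) \<partial>Q))"
proof -
  have B0: "0 \<le> B" using B[of 0] by simp
  let ?a = "\<lambda>k y. if \<forall>j<k. walk y j < walk y k then f (walk y k) else 0"
  let ?b = "\<lambda>m y. if \<forall>j\<in>{1..m}. walk y j \<le> 0 then 1 else 0 :: real"
  have am: "?a k \<in> borel_measurable Q" for k by measurable
  have bm: "?b m \<in> borel_measurable Q" for m by measurable
  have a: "integrable Q (?a k)" for k by (rule integrable_Q_bounded[OF am, where B=B]) (auto simp: B B0)
  have b: "integrable Q (?b m)" for m by (rule integrable_Q_bounded[OF bm, where B=1]) auto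
  have dep: "depends k (?a k)" for k
  proof (rule dependsI)
    fix y z :: "nat \<Rightarrow> real" assume "\<And>i. i < k \<Longrightarrow> y i = z i"
    then have "walk y j = walk z j" if "j \<le> k" for j using that by (intro walk_cong) auto
    then show "?a k y = ?a k z" by auto
  qed
  have rev: "(\<integral>y. ?a k y \<partial>Q) = (\<integral>y. (if pos_upto k y then f (walk y k) else 0) \<partial>Q)" for k
  proof -
    have "?a k (\<lambda>i. y (rev_index k i)) = (if pos_upto k y then f (walk y k) else 0)" for y
    proof -
      have w: "walk (\<lambda>i. y (rev_index k i)) j = walk y k - walk y (k - j)" if "j \<le> k" for j
        using that by (rule walk_rev)
      have "(\<forall>j<k. walk (\<lambda>i. y (rev_index k i)) j < walk (\<lambda>i. y (rev_index k i)) k) \<longleftrightarrow> pos_upto k y"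
      proof
        assume L: "\<forall>j<k. walk (\<lambda>i. y (rev_index k i)) j < walk (\<lambda>i. y (rev_index k i)) k"
        show "pos_upto k y" unfolding pos_upto_def
        proof
          fix j assume j: "j \<in> {1..k}"
          then have "k - j < k" "k - (k - j) = j" by auto
          then show "0 < walk y j" using L w[of "k - j"] w[of k] by auto
        qed
      next
        assume P: "pos_upto k y"
        show "\<forall>j<k. walk (\<lambda>i. y (rev_index k i)) j < walk (\<lambda>i. y (rev_index k i)) k"
        proof (intro allI impI)
          fix j assume j: "j < k"
          then have "k - j \<in> {1..k}" by auto
          then show "walk (\<lambda>i. y (rev_index k i)) j < walk (\<lambda>i. y (rev_index k i)) k"
            using P j w[of j] w[of k] by (auto simp: pos_upto_def)
        qed
      qed
      then show ?thesis using w[of k] by simp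
    qed
    then show ?thesis using integral_reindex[OF inj_rev_index am, of k k] by simp
  qed
  have "(\<integral>y. f (run_max n y) \<partial>Q) = (\<integral>y. (\<Sum>k\<le>n. ?a k y * ?b (n - k) (\<lambda>i. y (k + i))) \<partial>Q)"
    by (subst first_argmax_sum) (rule refl)
  also have "\<dots> = (\<Sum>k\<le>n. (\<integral>y. ?a k y * ?b (n - k) (\<lambda>i. y (k + i)) \<partial>Q))"
    by (rule Bochner_Integration.integral_sum) (rule indep_split(1)[OF a b dep])
  also have "\<dots> = (\<Sum>k\<le>n. (\<integral>y. ?a k y \<partial>Q) * (\<integral>y. ?b (n - k) y \<partial>Q))"
    by (intro sum.cong refl indep_split(2)[OF a b dep])
  finally show ?thesis by (simp only: rev)
qed

end

section \<open>Ladder epochs and level crossing of the log-likelihood walk\<close>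

lemma interval_integral_exp: "(LBINT t=0..ereal w. exp t) = exp w - 1"
proof -
  have "(LBINT t=ereal 0..ereal w. exp t) = exp w - exp 0"
    by (rule interval_integral_FTC_finite)
      (auto intro!: continuous_intros derivative_eq_intros simp: has_real_derivative_iff_has_vector_derivative[symmetric])
  then show ?thesis by (simp add: zero_ereal_def)
qed

lemma integral_exp_Icc:
  assumes "0 \<le> w"
  shows "(\<integral>t. indicator {0..w} t * exp t \<partial>lborel) = exp w - (1::real)"
  using interval_integral_exp[of w] interval_integral_Icc[of 0 w "exp :: real \<Rightarrow> real"] assms
  by (simp add: zero_ereal_def set_lebesgue_integral_def)

text \<open>\<open>\<mu>\<close> stands for the law of one log-likelihood ratio before the change.
  \<open>exp_1\<close> expresses that the likelihood ratio integrates to one, and the integral of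
  \<open>z * exp z\<close> is the mean after the change, that is, the Kullback-Leibler
  number.\<close>

locale cusum_law = iid_steps +
  assumes exp_int: "integrable \<mu> (\<lambda>z. exp z)" and exp_1: "(\<integral>z. exp z \<partial>\<mu>) = 1"
    and z_int: "integrable \<mu> (\<lambda>z. z)"
    and zexp_int: "integrable \<mu> (\<lambda>z. z * exp z)" and zexp_pos: "0 < (\<integral>z. z * exp z \<partial>\<mu>)"
    and nonarith: "\<nexists>d. AE z in \<mu>. \<exists>m::int. z = d * of_int m"
    and mu_pos: "0 < measure \<mu> {0<..}" and mu_neg: "0 < measure \<mu> {..<0}"
begin

text \<open>In the application this is the Bhattacharyya coefficient, the integral of the square
  root of \<open>f0 * f1\<close>. Being below 1, it gives a Chernoff bound with geometric decay for
  the tail of the ladder epoch.\<close>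

definition rho :: real where "rho = (\<integral>z. exp (z / 2) \<partial>\<mu>)"

lemma half_exp_int: "integrable \<mu> (\<lambda>z. exp (z / 2))"
proof (rule Bochner_Integration.integrable_bound)
  show "integrable \<mu> (\<lambda>z. 1 + exp z)" using exp_int by auto
  have "exp (z / 2) \<le> 1 + exp z" for z :: real
  proof (cases "0 \<le> z")
    case True then show ?thesis by (simp add: add_increasing)
  next
    case False
    then have "exp (z / 2) \<le> 1" by simp
    then show ?thesis by (simp add: add_increasing2)
  qed
  then show "AE z in \<mu>. norm (exp (z / 2)) \<le> norm (1 + exp z)"
    by (intro AE_I2) (simp add: abs_of_pos add_pos_pos)
qed measurable

lemma rho_nonneg: "0 \<le> rho"
  unfolding rho_def by simp

text \<open>The second moment of \<open>exp (z / 2) - 1\<close> is \<open>2 - 2 * rho\<close>, so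
  \<open>rho \<ge> 1\<close> would force \<open>z = 0\<close> almost surely, against the mass on
  negative steps.\<close>

lemma rho_less_1: "rho < 1"
proof (rule ccontr)
  assume "\<not> rho < 1"
  have e: "(exp (z / 2) - 1)\<^sup>2 = exp z - 2 * exp (z / 2) + 1" for z :: real
    by (simp add: power2_diff exp_double[symmetric])
  have i: "integrable \<mu> (\<lambda>z. (exp (z / 2) - 1)\<^sup>2)"
    unfolding e using exp_int half_exp_int by auto
  have "(\<integral>z. (exp (z / 2) - 1)\<^sup>2 \<partial>\<mu>) = 2 - 2 * rho"
    unfolding e rho_def using exp_int half_exp_int prob_space by (simp add: exp_1)
  then have "(\<integral>z. (exp (z / 2) - 1)\<^sup>2 \<partial>\<mu>) = 0" using \<open>\<not> rho < 1\<close>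
    by (smt (verit) Bochner_Integration.integral_nonneg zero_le_power2)
  then have "AE z in \<mu>. (exp (z / 2) - 1)\<^sup>2 = 0"
    by (subst (asm) integral_nonneg_eq_0_iff_AE[OF i]) auto
  then have "AE z in \<mu>. z \<notin> {..<0}" by eventually_elim auto
  then have "measure \<mu> {..<0} = 0" by (subst prob_eq_0) (auto simp: sets_mu)
  then show False using mu_neg by simp
qed

lemma exp_half_walk: "integrable Q (\<lambda>y. exp (walk y k / 2))" "(\<integral>y. exp (walk y k / 2) \<partial>Q) = rho ^ k"
proof (induction k)
  case 0
  { case 1 show ?case by simp next case 2 show ?case using seq.P.prob_space by simp }
next
  case (Suc k)
  have dep: "depends k (\<lambda>y. exp (walk y k / 2))"
  proof (rule dependsI)
    fix y z :: "nat \<Rightarrow> real" assume "\<And>i. i < k \<Longrightarrow> y i = z i"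
    then have "walk y k = walk z k" by (rule walk_cong)
    then show "exp (walk y k / 2) = exp (walk z k / 2)" by simp
  qed
  have m: "(\<lambda>z::real. exp (z / 2)) \<in> borel_measurable borel" by measurable
  have b: "integrable Q (\<lambda>y. exp (y 0 / 2))" "(\<integral>y. exp (y 0 / 2) \<partial>Q) = rho"
    using integral_component[OF m, of 0] half_exp_int unfolding rho_def by blast+
  have eq: "exp (walk y (Suc k) / 2) = exp (walk y k / 2) * exp (y (k + 0) / 2)" for y
    by (simp add: walk_Suc add_divide_distrib exp_add)
  { case 1 show ?case unfolding eq by (rule indep_split(1)[OF Suc.IH(1) b(1) dep])
  next case 2 show ?case unfolding eq using indep_split(2)[OF Suc.IH(1) b(1) dep] Suc.IH(2) b(2) by simp }
qed

text \<open>With \<open>T\<close> the first \<open>k \<ge> 1\<close> such that \<open>walk y k \<le> 0\<close>, \<open>t k\<close> is the probability of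
  \<open>T > k\<close>; hence the sum of \<open>t\<close> is the mean of \<open>T\<close>.\<close>
definition t :: "nat \<Rightarrow> real" where
  "t k = (\<integral>y. (if pos_upto k y then 1 else 0) \<partial>Q)"

definition r :: "nat \<Rightarrow> real" where
  "r n = (\<integral>y. (if \<forall>j\<in>{1..n}. walk y j \<le> 0 then 1 else 0) \<partial>Q)"

lemma integrable_if_Q:
  assumes "Measurable.pred Q A" "f \<in> borel_measurable Q" "\<And>y. A y \<Longrightarrow> \<bar>f y\<bar> \<le> (B::real)" "0 \<le> B"
  shows "integrable Q (\<lambda>y. if A y then f y else 0)"
  by (rule integrable_Q_bounded[where B=B]) (use assms in auto)

lemma t_nonneg: "0 \<le> t k"
  unfolding t_def by (rule Bochner_Integration.integral_nonneg) auto

lemma t_0: "t 0 = 1"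
  using seq.P.prob_space by (simp add: t_def pos_upto_def)

lemma t_le: "t k \<le> rho ^ k"
proof -
  have "t k \<le> (\<integral>y. exp (walk y k / 2) \<partial>Q)"
    unfolding t_def
  proof (rule integral_mono)
    show "integrable Q (\<lambda>y. if pos_upto k y then 1 else 0::real)"
      by (rule integrable_if_Q[where B=1]) auto
    show "integrable Q (\<lambda>y. exp (walk y k / 2))" by (rule exp_half_walk)
    show "(if pos_upto k y then 1 else 0) \<le> exp (walk y k / 2)" for y
    proof (cases "k = 0 \<or> \<not> pos_upto k y")
      case False
      then have "0 < walk y k" by (auto simp: pos_upto_def)
      then show ?thesis by simp
    qed (auto simp: less_imp_le)
  qed
  then show ?thesis by (simp add: exp_half_walk)
qed

lemma t_summable: "summable t"
proof (rule summable_comparison_test[OF _ summable_geometric])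
  show "\<exists>N. \<forall>n\<ge>N. norm (t n) \<le> rho ^ n" using t_le t_nonneg by auto
  show "norm rho < 1" using rho_less_1 rho_nonneg by simp
qed

lemma r_bounds: "0 \<le> r n" "r n \<le> 1"
proof -
  show "0 \<le> r n" unfolding r_def by (rule Bochner_Integration.integral_nonneg) auto
  have "r n \<le> (\<integral>y. 1 \<partial>Q)" unfolding r_def
    by (rule integral_mono[OF integrable_if_Q[where B=1]]) auto
  then show "r n \<le> 1" using seq.P.prob_space by simp
qed

lemma r_antimono: "decseq r"
  unfolding decseq_Suc_iff r_def
  by (intro allI integral_mono integrable_if_Q[where B=1]) auto

text \<open>The probability that the walk never becomes positive; \<open>r_inf_eq\<close> shows that
  it is the reciprocal of the mean ladder epoch.\<close>

definition r_inf :: real where "r_inf = lim r"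

lemma r_tendsto: "r \<longlonglongrightarrow> r_inf"
proof -
  obtain L where "r \<longlonglongrightarrow> L"
    using decseq_convergent[OF r_antimono] r_bounds(1) by metis
  then show ?thesis unfolding r_inf_def by (simp add: limI)
qed

text \<open>Dominated convergence for series: each factor \<open>r (n - k)\<close> tends to
  \<open>r_inf\<close>, and the summable sequence \<open>t\<close> majorises the weights.\<close>

lemma renewal_convolution:
  assumes "\<And>k. \<bar>w k\<bar> \<le> B * t k"
  shows "(\<lambda>n. \<Sum>k\<le>n. w k * r (n - k)) \<longlonglongrightarrow> r_inf * (\<Sum>k. w k)" "summable w"
proof -
  have s: "summable (\<lambda>k. B * t k)" using t_summable by (rule summable_mult)
  show sw: "summable w" using assms by (intro summable_comparison_test[OF _ s]) auto
  let ?a = "\<lambda>k n. if k \<le> n then w k * r (n - k) else 0"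
  have lim: "(?a k \<longlongrightarrow> w k * r_inf) sequentially" for k
  proof -
    have "(\<lambda>n. w k * r (n - k)) \<longlonglongrightarrow> w k * r_inf"
      using r_tendsto by (intro tendsto_mult tendsto_const) (rule filterlim_compose[OF _ filterlim_minus_const_nat_at_top])
    then show ?thesis
      by (rule Lim_transform_eventually[OF _ eventually_sequentiallyI[of k]]) simp
  qed
  have bd: "norm (?a k n) \<le> B * t k" for k n
  proof -
    have "\<bar>w k\<bar> * r (n - k) \<le> \<bar>w k\<bar> * 1" using r_bounds by (intro mult_left_mono) auto
    then show ?thesis using assms[of k] r_bounds[of "n - k"] by (auto simp: abs_mult intro: order_trans[of _ "\<bar>w k\<bar>"])
  qed
  have "((\<lambda>n. \<Sum>k. ?a k n) \<longlongrightarrow> (\<Sum>k. w k * r_inf)) sequentially"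
    by (rule tannerys_theorem[THEN conjunct2, THEN conjunct2, OF lim _ s])
      (use bd in \<open>auto intro!: always_eventually\<close>)
  moreover have "(\<Sum>k. ?a k n) = (\<Sum>k\<le>n. w k * r (n - k))" for n
    by (subst suminf_finite[of "{..n}"]) auto
  moreover have "(\<Sum>k. w k * r_inf) = r_inf * (\<Sum>k. w k)"
    using suminf_mult2[OF sw, of r_inf] by (simp add: mult.commute)
  ultimately show "(\<lambda>n. \<Sum>k\<le>n. w k * r (n - k)) \<longlonglongrightarrow> r_inf * (\<Sum>k. w k)" by simp
qed

text \<open>The decomposition at the first maximum, applied to the constant function 1, has total
  mass 1 for every \<open>n\<close>; then \<open>n\<close> tends to infinity.\<close>

lemma r_inf_eq: "r_inf * (\<Sum>k. t k) = 1"
proof -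
  have "(\<Sum>k\<le>n. t k * r (n - k)) = 1" for n
    using expectation_run_max[of "\<lambda>_. 1" 1 n] seq.P.prob_space by (simp add: t_def r_def)
  moreover have "(\<lambda>n. \<Sum>k\<le>n. t k * r (n - k)) \<longlonglongrightarrow> r_inf * (\<Sum>k. t k)"
    by (rule renewal_convolution[where B=1]) (simp add: t_nonneg)
  ultimately show ?thesis by (simp add: LIMSEQ_const_iff)
qed

lemma t_sum_pos: "0 < (\<Sum>k. t k)"
proof -
  have "t 0 \<le> (\<Sum>k. t k)" using sum_le_suminf[OF t_summable, of "{0}"] t_nonneg by simp
  then show ?thesis by (simp add: t_0)
qed

lemma r_inf_pos: "0 < r_inf"
  using r_inf_eq t_sum_pos by (metis zero_less_mult_pos2 zero_less_one)

definition psi_n :: "nat \<Rightarrow> real \<Rightarrow> real" where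
  "psi_n n h = (\<integral>y. (if h \<le> run_max n y then 1 else 0) \<partial>Q)"

lemma psi_n_bounds: "0 \<le> psi_n n h" "psi_n n h \<le> 1"
proof -
  show "0 \<le> psi_n n h" unfolding psi_n_def by (rule Bochner_Integration.integral_nonneg) auto
  have "psi_n n h \<le> (\<integral>y. 1 \<partial>Q)" unfolding psi_n_def
    by (rule integral_mono[OF integrable_if_Q[where B=1]]) auto
  then show "psi_n n h \<le> 1" using seq.P.prob_space by simp
qed

lemma psi_n_antimono: "h \<le> h' \<Longrightarrow> psi_n n h' \<le> psi_n n h"
  unfolding psi_n_def by (intro integral_mono integrable_if_Q[where B=1]) auto

lemma measurable_antimono:
  fixes f :: "real \<Rightarrow> real"
  assumes "\<And>x y. x \<le> y \<Longrightarrow> f y \<le> f x"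
  shows "f \<in> borel_measurable borel"
proof -
  have "(\<lambda>x. - f x) \<in> borel_measurable borel" by (rule borel_measurable_mono) (auto simp: mono_def assms)
  then have "(\<lambda>x. - (- f x)) \<in> borel_measurable borel" by measurable
  then show ?thesis by simp
qed

lemma psi_n_measurable [measurable]: "psi_n n \<in> borel_measurable borel"
  by (rule measurable_antimono) (rule psi_n_antimono)

lemma psi_n_nonpos: "h \<le> 0 \<Longrightarrow> psi_n n h = 1"
  using run_max_nonneg[of n] seq.P.prob_space unfolding psi_n_def by (simp add: order_trans[of h 0])

lemma psi_n_incseq: "incseq (\<lambda>n. psi_n n h)"
  unfolding incseq_Suc_iff psi_n_def
  by (intro allI integral_mono integrable_if_Q[where B=1]) (auto simp: run_max_ge_iff intro: le_SucI)

text \<open>First-step analysis. Positivity of \<open>h\<close> excludes index 0 as a crossing, so a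
  crossing within \<open>n + 1\<close> steps is one within \<open>n\<close> steps after the
  first.\<close>

lemma psi_n_Suc:
  assumes h: "0 < h"
  shows "psi_n (Suc n) h = (\<integral>z. psi_n n (h - z) \<partial>\<mu>)"
proof -
  have eq: "h \<le> run_max (Suc n) (comb_seq 1 y z) \<longleftrightarrow> h - y 0 \<le> run_max n z" for y z
  proof -
    have w: "walk (comb_seq 1 y z) (Suc k) = y 0 + walk z k" for k
      using walk_add[of "comb_seq 1 y z" 1 k] comb_seq_shift[of 1 y z] by (simp add: walk_def)
    have "h \<le> run_max (Suc n) (comb_seq 1 y z) \<longleftrightarrow> (\<exists>k\<le>n. h \<le> walk (comb_seq 1 y z) (Suc k))"
      unfolding run_max_ge_iff
    proof
      assume "\<exists>k\<le>Suc n. h \<le> walk (comb_seq 1 y z) k"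
      then obtain k where k: "k \<le> Suc n" "h \<le> walk (comb_seq 1 y z) k" by blast
      then show "\<exists>k\<le>n. h \<le> walk (comb_seq 1 y z) (Suc k)" using h by (cases k) auto
    qed auto
    then show ?thesis unfolding w run_max_ge_iff by (simp add: algebra_simps)
  qed
  have i: "integrable Q (\<lambda>y. if h \<le> run_max (Suc n) y then 1 else 0 :: real)"
    by (rule integrable_if_Q[where B=1]) auto
  have "psi_n (Suc n) h = (\<integral>y. psi_n n (h - y 0) \<partial>Q)"
    unfolding psi_n_def by (subst integral_split[OF i, of 1]) (simp only: eq)
  also have "\<dots> = (\<integral>z. psi_n n (h - z) \<partial>\<mu>)" by (rule integral_component) measurable
  finally show ?thesis .
qed

text \<open>Lundberg's inequality: since \<open>exp Z\<close> has mean 1, the bound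
  \<open>exp (- h)\<close> reproduces itself under first-step analysis.\<close>

lemma psi_n_le: "psi_n n h \<le> exp (- h)"
proof (induction n arbitrary: h)
  case 0
  show ?case
  proof (cases "h \<le> 0")
    case True
    then have "1 \<le> exp (- h)" by simp
    then show ?thesis using psi_n_bounds(2)[of 0 h] by linarith
  next
    case False
    then have "psi_n 0 h = 0" by (simp add: psi_n_def run_max_def)
    then show ?thesis by simp
  qed
next
  case (Suc n)
  show ?case
  proof (cases "h \<le> 0")
    case True
    then have "1 \<le> exp (- h)" by simp
    then show ?thesis using psi_n_bounds(2)[of "Suc n" h] by linarith
  next
    case False
    then have "psi_n (Suc n) h = (\<integral>z. psi_n n (h - z) \<partial>\<mu>)" by (simp add: psi_n_Suc)
    also have "\<dots> \<le> (\<integral>z. exp (- h) * exp z \<partial>\<mu>)"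
    proof (rule integral_mono)
      show "integrable \<mu> (\<lambda>z. psi_n n (h - z))"
        by (rule integrable_const_bound[where B=1]) (auto simp: psi_n_bounds abs_of_nonneg)
      show "integrable \<mu> (\<lambda>z. exp (- h) * exp z)" using exp_int by simp
      show "psi_n n (h - z) \<le> exp (- h) * exp z" for z using Suc[of "h - z"] by (simp add: exp_add[symmetric])
    qed
    also have "\<dots> = exp (- h)" by (simp add: exp_1)
    finally show ?thesis .
  qed
qed

definition psi :: "real \<Rightarrow> real" where "psi h = lim (\<lambda>n. psi_n n h)"

lemma psi_tendsto: "(\<lambda>n. psi_n n h) \<longlonglongrightarrow> psi h"
proof -
  obtain L where "(\<lambda>n. psi_n n h) \<longlonglongrightarrow> L"
    using incseq_convergent[OF psi_n_incseq] psi_n_bounds(2) by metis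
  then show ?thesis unfolding psi_def by (simp add: limI)
qed

lemma psi_bounds: "0 \<le> psi h" "psi h \<le> 1" "psi h \<le> exp (- h)"
proof -
  show "0 \<le> psi h" by (rule LIMSEQ_le_const[OF psi_tendsto]) (simp add: psi_n_bounds)
  show "psi h \<le> 1" by (rule LIMSEQ_le_const2[OF psi_tendsto]) (simp add: psi_n_bounds)
  show "psi h \<le> exp (- h)" by (rule LIMSEQ_le_const2[OF psi_tendsto]) (simp add: psi_n_le)
qed

lemma psi_antimono: "h \<le> h' \<Longrightarrow> psi h' \<le> psi h"
  by (rule LIMSEQ_le[OF psi_tendsto psi_tendsto]) (simp add: psi_n_antimono)

lemma psi_measurable [measurable]: "psi \<in> borel_measurable borel"
  by (rule measurable_antimono) (rule psi_antimono)

lemma psi_nonpos: "h \<le> 0 \<Longrightarrow> psi h = 1"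
  using psi_tendsto[of h] by (simp add: psi_n_nonpos LIMSEQ_const_iff)

lemma psi_eq:
  assumes "0 < h"
  shows "psi h = (\<integral>z. psi (h - z) \<partial>\<mu>)"
proof -
  have "(\<lambda>n. \<integral>z. psi_n n (h - z) \<partial>\<mu>) \<longlonglongrightarrow> (\<integral>z. psi (h - z) \<partial>\<mu>)"
    by (rule integral_dominated_convergence[where w="\<lambda>_. 1"])
      (auto simp: psi_tendsto psi_n_bounds abs_of_nonneg)
  moreover have "(\<lambda>n. psi_n (Suc n) h) \<longlonglongrightarrow> psi h" using psi_tendsto by (rule LIMSEQ_Suc)
  ultimately show ?thesis using assms by (simp add: psi_n_Suc LIMSEQ_unique)
qed

end

section \<open>Exponential tilting and the value of the flux\<close>

context cusum_law
begin

text \<open>In the application this is the law of the log-likelihood ratio after the change, under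
  which the walk drifts upwards.\<close>

definition nu :: "real measure" where "nu = density \<mu> (\<lambda>z. ennreal (exp z))"

lemma sets_nu [measurable_cong]: "sets nu = sets borel"
  by (simp add: nu_def sets_mu)

lemma integral_nu:
  fixes f :: "real \<Rightarrow> real"
  assumes "f \<in> borel_measurable borel"
  shows "(\<integral>z. f z \<partial>nu) = (\<integral>z. exp z * f z \<partial>\<mu>)" and "integrable nu f \<longleftrightarrow> integrable \<mu> (\<lambda>z. exp z * f z)"
proof -
  have [measurable]: "f \<in> borel_measurable \<mu>" using assms by measurable
  show "(\<integral>z. f z \<partial>nu) = (\<integral>z. exp z * f z \<partial>\<mu>)"
    unfolding nu_def by (subst integral_density) auto
  show "integrable nu f \<longleftrightarrow> integrable \<mu> (\<lambda>z. exp z * f z)"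
    unfolding nu_def by (subst integrable_density) auto
qed

lemma AE_nu: "(AE z in nu. P z) \<longleftrightarrow> (AE z in \<mu>. P z)"
  unfolding nu_def by (subst AE_density) auto

lemma prob_space_nu: "prob_space nu"
proof
  have "emeasure nu (space nu) = (\<integral>\<^sup>+z. ennreal (exp z) \<partial>\<mu>)"
    unfolding nu_def by (subst emeasure_density) (auto intro!: nn_integral_cong)
  also have "\<dots> = 1" using exp_int by (subst nn_integral_eq_integral) (auto simp: exp_1)
  finally show "emeasure nu (space nu) = 1" .
qed

lemma nu_positive:
  assumes "0 < measure \<mu> B" "B \<in> sets borel"
  shows "0 < measure nu B"
proof (rule ccontr)
  interpret nu: prob_space nu by (rule prob_space_nu)
  assume "\<not> 0 < measure nu B"
  then have "AE z in nu. z \<notin> B" using assms(2) by (subst nu.prob_eq_0[symmetric]) (auto simp: sets_nu zero_less_measure_iff)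
  then have "measure \<mu> B = 0" unfolding AE_nu using assms(2) by (subst prob_eq_0) (auto simp: sets_mu)
  then show False using assms by simp
qed

lemma renewal_law_nu: "renewal_law nu"
proof -
  interpret nu: prob_space nu by (rule prob_space_nu)
  show ?thesis
  proof
    show "sets nu = sets borel" by (rule sets_nu)
    show "integrable nu (\<lambda>z. z)" using zexp_int by (subst integral_nu(2)) (auto simp: mult.commute)
    show "\<nexists>d. AE z in nu. \<exists>m::int. z = d * of_int m" unfolding AE_nu by (rule nonarith)
    show "0 < measure nu {0<..}" "0 < measure nu {..<0}"
      by (auto intro!: nu_positive mu_pos mu_neg)
  qed
qed

abbreviation I_KL :: real where "I_KL \<equiv> \<integral>z. z * exp z \<partial>\<mu>"

lemma prim_psi_tendsto:
  "(\<lambda>n. LBINT t=0..ereal w. exp t * psi_n n t) \<longlonglongrightarrow> (LBINT t=0..ereal w. exp t * psi t)"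
proof (cases "0 \<le> w")
  case False
  have "(LBINT t=0..ereal w. exp t * psi_n n t) = (LBINT t=0..ereal w. exp t * psi t)" for n
    using False by (intro interval_integral_cong) (auto simp: psi_n_nonpos psi_nonpos einterval_def min_def max_def)
  then show ?thesis by simp
next
  case True
  have eq: "(LBINT t=0..ereal w. exp t * f t) = (\<integral>t. indicator {0..w} t * (exp t * f t) \<partial>lborel)" for f :: "real \<Rightarrow> real"
    using interval_integral_Icc[OF True, of "\<lambda>t. exp t * f t"] by (simp add: zero_ereal_def set_lebesgue_integral_def)
  show ?thesis
    unfolding eq
  proof (rule integral_dominated_convergence)
    show "integrable lborel (\<lambda>t. indicator {0..w} t * exp w)"
      by (intro integrable_mult_left integrable_indicator_Icc)
    show "AE t in lborel. (\<lambda>n. indicator {0..w} t * (exp t * psi_n n t)) \<longlonglongrightarrow> indicator {0..w} t * (exp t * psi t)"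
      by (intro AE_I2 tendsto_mult tendsto_const psi_tendsto)
    have "exp t * psi_n n t \<le> exp w" if "t \<le> w" for t n
    proof -
      have "exp t * psi_n n t \<le> exp t * 1" by (intro mult_left_mono psi_n_bounds) auto
      also have "\<dots> \<le> exp w" using that by simp
      finally show ?thesis .
    qed
    then show "AE t in lborel. norm (indicator {0..w} t * (exp t * psi_n n t)) \<le> indicator {0..w} t * exp w" for n
      by (intro AE_I2) (auto simp: indicator_def abs_of_nonneg psi_n_bounds)
  qed measurable
qed

text \<open>Layer-cake formula: integrating \<open>exp t\<close> over those \<open>t\<close> in
  \<open>[0, w]\<close> that the maximum reaches gives \<open>exp (min (run_max n y) w) - 1\<close>.
  For negative \<open>w\<close> the oriented integral agrees, because the maximum is nonnegative and
  \<open>psi_n\<close> is 1 there.\<close>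

lemma prim_psi_n:
  "(LBINT t=0..ereal w. exp t * psi_n n t) = (\<integral>y. exp (min (run_max n y) w) \<partial>Q) - 1"
proof (cases "0 \<le> w")
  case False
  have "(LBINT t=0..ereal w. exp t * psi_n n t) = (LBINT t=0..ereal w. exp t)"
    using False by (intro interval_integral_cong) (auto simp: psi_n_nonpos einterval_def min_def max_def)
  moreover have "min (run_max n y) w = w" for y using False run_max_nonneg[of n y] by simp
  ultimately show ?thesis using seq.P.prob_space by (simp add: interval_integral_exp)
next
  case True
  interpret LQ: pair_sigma_finite lborel Q ..
  let ?f = "\<lambda>t y. indicator {0..w} t * exp t * (if t \<le> run_max n y then 1 else 0)"
  have int: "integrable (lborel \<Otimes>\<^sub>M Q) (\<lambda>(t, y). ?f t y)"
    by (rule integrable_lborel_pair_bounded[OF seq.P.prob_space_axioms, where B="exp w" and a=0 and b=w])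
      (auto simp: indicator_def)
  have ie: "integrable Q (\<lambda>y. exp (min (run_max n y) w))"
    by (rule integrable_Q_bounded[where B="exp w"]) auto
  have inner: "(\<integral>t. ?f t y \<partial>lborel) = exp (min (run_max n y) w) - 1" for y
  proof -
    have "(\<integral>t. ?f t y \<partial>lborel) = (\<integral>t. indicator {0..min (run_max n y) w} t * exp t \<partial>lborel)"
      by (intro Bochner_Integration.integral_cong) (auto simp: indicator_def)
    also have "\<dots> = exp (min (run_max n y) w) - 1"
      using True run_max_nonneg[of n y] by (intro integral_exp_Icc) auto
    finally show ?thesis .
  qed
  have "(LBINT t=0..ereal w. exp t * psi_n n t) = (\<integral>t. indicator {0..w} t * (exp t * psi_n n t) \<partial>lborel)"
    using interval_integral_Icc[OF True, of "\<lambda>t. exp t * psi_n n t"] by (simp add: zero_ereal_def set_lebesgue_integral_def)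
  also have "\<dots> = (\<integral>t. (\<integral>y. ?f t y \<partial>Q) \<partial>lborel)"
    by (simp add: psi_n_def mult.assoc)
  also have "\<dots> = (\<integral>y. (\<integral>t. ?f t y \<partial>lborel) \<partial>Q)"
    using LQ.Fubini_integral[OF int] by simp
  also have "\<dots> = (\<integral>y. exp (min (run_max n y) w) - 1 \<partial>Q)" by (simp only: inner)
  also have "\<dots> = (\<integral>y. exp (min (run_max n y) w) \<partial>Q) - 1"
    using seq.P.prob_space by (subst Bochner_Integration.integral_diff[OF ie]) auto
  finally show ?thesis .
qed

lemma prim_psi_n_measurable [measurable]: "(\<lambda>w. LBINT t=0..ereal w. exp t * psi_n n t) \<in> borel_measurable borel"
  unfolding prim_psi_n by measurable

lemma prim_psi_measurable [measurable]: "(\<lambda>w. LBINT t=0..ereal w. exp t * psi t) \<in> borel_measurable borel"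
  by (rule borel_measurable_LIMSEQ_real[OF prim_psi_tendsto]) measurable

text \<open>Index shift: \<open>hit k\<close> is the event \<open>T = k + 1\<close>, so \<open>eta\<close> below is the mean of the exponential
  of the ladder height.\<close>
definition hit :: "nat \<Rightarrow> (nat \<Rightarrow> real) \<Rightarrow> bool" where
  "hit k y \<longleftrightarrow> pos_upto k y \<and> walk y (Suc k) \<le> 0"

lemma hit_measurable [measurable]: "Measurable.pred Q (hit k)"
  unfolding hit_def[abs_def] by measurable

definition eta_n :: "nat \<Rightarrow> real" where
  "eta_n k = (\<integral>y. (if hit k y then exp (walk y (Suc k)) else 0) \<partial>Q)"

definition eta :: real where "eta = (\<Sum>k. eta_n k)"

lemma hit_prob: "(\<integral>y. (if hit k y then 1 else 0) \<partial>Q) = t k - t (Suc k)"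
proof -
  have "(\<integral>y. (if hit k y then 1 else 0) \<partial>Q) = (\<integral>y. (if pos_upto k y then 1 else 0) - (if pos_upto (Suc k) y then 1 else 0) \<partial>Q)"
    by (intro Bochner_Integration.integral_cong) (auto simp: hit_def pos_upto_Suc)
  also have "\<dots> = t k - t (Suc k)" unfolding t_def
    by (intro Bochner_Integration.integral_diff integrable_if_Q[where B=1]) auto
  finally show ?thesis .
qed

lemma t_tendsto_0: "t \<longlonglongrightarrow> 0"
  using t_summable by (rule summable_LIMSEQ_zero)

lemma hit_prob_sums: "(\<lambda>k. t k - t (Suc k)) sums 1"
  using telescope_sums'[OF t_tendsto_0] by (simp add: t_0)

lemma eta_n_bounds: "0 \<le> eta_n k" "eta_n k \<le> t k - t (Suc k)"
proof -
  show "0 \<le> eta_n k" unfolding eta_n_def by (rule Bochner_Integration.integral_nonneg) auto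
  show "eta_n k \<le> t k - t (Suc k)" unfolding eta_n_def hit_prob[symmetric]
    by (intro integral_mono integrable_if_Q[where B=1]) (auto simp: hit_def)
qed

lemma eta_summable: "summable eta_n"
  by (rule summable_comparison_test[OF _ sums_summable[OF hit_prob_sums]])
    (use eta_n_bounds in \<open>auto simp: abs_of_nonneg\<close>)

text \<open>By the layer-cake formula and \<open>exp_1\<close>, the flux of the
  \<open>n\<close>-step approximation is the mean of a function \<open>f\<close> of the running
  maximum. Splitting at the first maximum and taking one more step turns \<open>f\<close> into the
  loss \<open>1 - exp\<close> of the ladder height.\<close>

lemma flux_value: "(\<integral>z. exp z * - (LBINT t=0..ereal (- z). exp t * psi t) \<partial>\<mu>) = r_inf * (1 - eta)"
proof -
  let ?D = "\<lambda>n z. \<integral>y. exp (min (run_max n y + z) 0) \<partial>Q"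
  \<comment> \<open>The expected value of \<open>1 - exp\<close> of the position after one step from
    \<open>x\<close>, counted only if that step leads to 0 or below.\<close>
  define f where "f x = (\<integral>z. 1 - exp (min (x + z) 0) \<partial>\<mu>)" for x :: real
  have [measurable]: "f \<in> borel_measurable borel" unfolding f_def by measurable
  have ix: "integrable \<mu> (\<lambda>z. 1 - exp (min (x + z) 0))" for x
    by (rule integrable_const_bound[where B=1]) (auto simp: abs_le_iff)
  have f0: "0 \<le> f x" for x unfolding f_def by (rule Bochner_Integration.integral_nonneg) auto
  have f1: "f x \<le> 1" for x
  proof -
    have "f x \<le> (\<integral>z. 1 \<partial>\<mu>)" unfolding f_def by (rule integral_mono[OF ix]) auto
    then show ?thesis using prob_space by simp
  qed
  have D: "exp z * - (LBINT t=0..ereal (- z). exp t * psi_n n t) = exp z - ?D n z" for n z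
  proof -
    have "exp z * (\<integral>y. exp (min (run_max n y) (- z)) \<partial>Q) = (\<integral>y. exp z * exp (min (run_max n y) (- z)) \<partial>Q)" by simp
    also have "\<dots> = ?D n z"
      by (intro Bochner_Integration.integral_cong refl) (simp add: exp_add[symmetric] min_add_distrib_left add.commute)
    finally show ?thesis unfolding prim_psi_n by (simp add: algebra_simps)
  qed
  have Dm [measurable]: "?D n \<in> borel_measurable borel" for n by measurable
  have iy: "integrable Q (\<lambda>y. exp (min (run_max n y + z) 0))" for n z
    by (rule integrable_Q_bounded[where B=1]) auto
  have D01: "0 \<le> ?D n z" "?D n z \<le> 1" for n z
  proof -
    show "0 \<le> ?D n z" by (rule Bochner_Integration.integral_nonneg) auto
    have "?D n z \<le> (\<integral>y. 1 \<partial>Q)" by (rule integral_mono[OF iy]) auto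
    then show "?D n z \<le> 1" using seq.P.prob_space by simp
  qed
  have "(\<lambda>n. \<integral>z. exp z - ?D n z \<partial>\<mu>) \<longlonglongrightarrow> (\<integral>z. exp z * - (LBINT t=0..ereal (- z). exp t * psi t) \<partial>\<mu>)"
  proof (rule integral_dominated_convergence[where w="\<lambda>z. exp z + 1"])
    show "integrable \<mu> (\<lambda>z. exp z + 1)" using exp_int by simp
    show "AE z in \<mu>. (\<lambda>n. exp z - ?D n z) \<longlonglongrightarrow> exp z * - (LBINT t=0..ereal (- z). exp t * psi t)"
      unfolding D[symmetric] by (intro AE_I2 tendsto_mult tendsto_const tendsto_minus prim_psi_tendsto)
    show "AE z in \<mu>. norm (exp z - ?D n z) \<le> exp z + 1" for n
    proof (rule AE_I2)
      fix z :: real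
      have "0 < exp z" by simp
      then show "norm (exp z - ?D n z) \<le> exp z + 1" using D01[of n z] unfolding real_norm_def by linarith
    qed
  qed measurable
  moreover have "(\<integral>z. exp z - ?D n z \<partial>\<mu>) = (\<integral>y. f (run_max n y) \<partial>Q)" for n
  proof -
    interpret MQ: pair_sigma_finite \<mu> Q ..
    have "integrable (\<mu> \<Otimes>\<^sub>M Q) (\<lambda>(z, y). exp (min (run_max n y + z) 0))"
    proof -
      interpret MQP: pair_prob_space \<mu> Q ..
      show ?thesis by (rule MQP.P.integrable_const_bound[where B=1]) (auto simp: split_beta')
    qed
    from MQ.Fubini_integral[OF this] have Fub: "(\<integral>z. ?D n z \<partial>\<mu>) = (\<integral>y. (\<integral>z. exp (min (run_max n y + z) 0) \<partial>\<mu>) \<partial>Q)" by simp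
    have e: "integrable \<mu> (\<lambda>z. exp (min (x + z) 0))" for x
      by (rule integrable_const_bound[where B=1]) auto
    have fx: "f x = 1 - (\<integral>z. exp (min (x + z) 0) \<partial>\<mu>)" for x
      unfolding f_def using prob_space by (subst Bochner_Integration.integral_diff[OF _ e]) auto
    have "integrable Q (\<lambda>y. f (run_max n y))" by (rule integrable_Q_bounded[where B=1]) (auto simp: f0 f1)
    then have "(\<integral>y. 1 - f (run_max n y) \<partial>Q) = 1 - (\<integral>y. f (run_max n y) \<partial>Q)"
      using seq.P.prob_space by (subst Bochner_Integration.integral_diff) auto
    moreover have "(\<integral>y. 1 - f (run_max n y) \<partial>Q) = (\<integral>z. ?D n z \<partial>\<mu>)" unfolding Fub fx by simp
    moreover have "integrable \<mu> (?D n)" by (rule integrable_const_bound[where B=1]) (auto simp: D01 abs_of_nonneg)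
    ultimately show ?thesis using exp_int by (simp add: exp_1 Bochner_Integration.integral_diff)
  qed
  moreover define w where "w k = (\<integral>y. (if pos_upto k y then f (walk y k) else 0) \<partial>Q)" for k
  have "(\<lambda>n. \<integral>y. f (run_max n y) \<partial>Q) \<longlonglongrightarrow> r_inf * (\<Sum>k. w k)"
  proof -
    have iw: "integrable Q (\<lambda>y. if pos_upto k y then f (walk y k) else 0)" for k
      by (rule integrable_if_Q[where B=1]) (auto simp: f0 f1)
    have "w k \<le> t k" for k unfolding w_def t_def
      by (intro integral_mono iw integrable_if_Q[where B=1]) (auto simp: f1)
    moreover have "0 \<le> w k" for k unfolding w_def by (rule Bochner_Integration.integral_nonneg) (auto simp: f0)
    ultimately have "\<bar>w k\<bar> \<le> 1 * t k" for k by simp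
    from renewal_convolution(1)[OF this]
    have "(\<lambda>n. \<Sum>k\<le>n. w k * r (n - k)) \<longlonglongrightarrow> r_inf * (\<Sum>k. w k)" .
    moreover have "(\<integral>y. f (run_max n y) \<partial>Q) = (\<Sum>k\<le>n. w k * r (n - k))" for n
      unfolding w_def r_def by (rule expectation_run_max[where B=1]) (auto simp: f0 f1 abs_of_nonneg)
    ultimately show ?thesis by simp
  qed
  \<comment> \<open>The step inside \<open>f\<close> is appended to the path of length
    \<open>k\<close>: the integrand then vanishes unless step \<open>k + 1\<close> is the first
    descent.\<close>
  moreover have "w k = (t k - t (Suc k)) - eta_n k" for k
  proof -
    have "w k = (\<integral>y. (if pos_upto k y then 1 - exp (min (walk y k + y k) 0) else 0) \<partial>Q)"
      unfolding w_def f_def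
      by (rule integral_step[symmetric, where B=1]) (auto simp: pos_upto_depends abs_le_iff)
    also have "\<dots> = (\<integral>y. (if hit k y then 1 else 0) - (if hit k y then exp (walk y (Suc k)) else 0) \<partial>Q)"
      by (intro Bochner_Integration.integral_cong) (auto simp: hit_def walk_Suc min_def)
    also have "\<dots> = (t k - t (Suc k)) - eta_n k" unfolding hit_prob[symmetric] eta_n_def
      by (intro Bochner_Integration.integral_diff integrable_if_Q[where B=1]) (auto simp: hit_def)
    finally show ?thesis .
  qed
  moreover have "(\<Sum>k. (t k - t (Suc k)) - eta_n k) = 1 - eta"
    using suminf_diff[OF sums_summable[OF hit_prob_sums] eta_summable] sums_unique[OF hit_prob_sums] by (simp add: eta_def)
  ultimately show ?thesis by (simp add: LIMSEQ_unique)
qed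

lemma psi_exp_limit: "((\<lambda>h. exp h * psi h) \<longlongrightarrow> r_inf * (1 - eta) / I_KL) at_top"
proof -
  interpret nu: renewal_law nu by (rule renewal_law_nu)
  let ?g = "\<lambda>h. exp h * psi h"
  have g1: "?g h \<le> 1" for h
  proof -
    have "?g h \<le> exp h * exp (- h)" by (intro mult_left_mono psi_bounds) auto
    then show ?thesis by (simp add: exp_minus)
  qed
  have drift: "(\<integral>z. z \<partial>nu) = I_KL" by (subst integral_nu(1)) (auto simp: mult.commute)
  have flux: "(\<integral>z. - (LBINT t=0..ereal (- z). ?g t) \<partial>nu) = r_inf * (1 - eta)"
    by (subst integral_nu(1)) (measurable, rule flux_value)
  have "(?g \<longlongrightarrow> (\<integral>z. - (LBINT t=0..ereal (- z). ?g t) \<partial>nu) / (\<integral>z. z \<partial>nu)) at_top"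
  proof (rule nu.renewal_limit)
    show "?g \<in> borel_measurable borel" by measurable
    show "0 \<le> ?g x" for x by (simp add: psi_bounds)
    show "?g x \<le> 1" for x by (rule g1)
    show "?g h = (\<integral>z. ?g (h - z) \<partial>nu)" if "0 < h" for h
    proof -
      \<comment> \<open>The tilting weight \<open>exp z\<close> cancels the factor
        \<open>exp (- z)\<close> in \<open>exp (h - z)\<close>, so this is the renewal equation of
        \<open>psi\<close> under \<open>\<mu>\<close>.\<close>
      have "(\<integral>z. ?g (h - z) \<partial>nu) = (\<integral>z. exp z * ?g (h - z) \<partial>\<mu>)" by (rule integral_nu) measurable
      also have "\<dots> = (\<integral>z. exp h * psi (h - z) \<partial>\<mu>)"
        by (intro Bochner_Integration.integral_cong refl) (simp add: exp_diff)
      also have "\<dots> = ?g h" by (simp add: psi_eq[OF that, symmetric])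
      finally show ?thesis by simp
    qed
    \<comment> \<open>The growth bound is nothing but the monotonicity of
      \<open>psi\<close>.\<close>
    show "?g (x + u) \<le> exp u * ?g x" if "0 \<le> u" for x u
      using psi_antimono[of x "x + u"] that by (simp add: exp_add mult_left_mono)
    show "0 < (\<integral>z. z \<partial>nu)" unfolding drift by (rule zexp_pos)
  qed
  then show ?thesis by (simp only: flux drift)
qed

end

section \<open>Cycles of the CUSUM statistic\<close>

primrec cus :: "(nat \<Rightarrow> real) \<Rightarrow> nat \<Rightarrow> real" where
  "cus y 0 = 0"
| "cus y (Suc k) = max 0 (cus y k + y k)"

lemma cus_shift: "cus y k = 0 \<Longrightarrow> cus y (k + j) = cus (\<lambda>i. y (k + i)) j"
  by (induction j) auto

lemma cus_eq_walk: "pos_upto k y \<Longrightarrow> cus y k = walk y k"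
  by (induction k) (auto simp: pos_upto_Suc[abs_def] walk_Suc)

definition stay :: "real \<Rightarrow> nat \<Rightarrow> (nat \<Rightarrow> real) \<Rightarrow> bool" where
  "stay h k y \<longleftrightarrow> (\<forall>j\<in>{1..k}. 0 < walk y j \<and> walk y j < h)"

lemma stay_Suc: "stay h (Suc k) y \<longleftrightarrow> stay h k y \<and> 0 < walk y (Suc k) \<and> walk y (Suc k) < h"
  by (auto simp: stay_def le_Suc_eq)

lemma stay_imp_pos_upto: "stay h k y \<Longrightarrow> pos_upto k y"
  by (auto simp: stay_def pos_upto_def)

lemma stay_depends: "depends k (stay h k)"
proof (rule dependsI)
  fix y z :: "nat \<Rightarrow> real" assume *: "\<And>i. i < k \<Longrightarrow> y i = z i"
  have "walk y j = walk z j" if "j \<le> k" for j using * that by (intro walk_cong) auto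
  then show "stay h k y = stay h k z" by (auto simp: stay_def)
qed

text \<open>The path is split at its first descending ladder epoch, where the CUSUM statistic restarts
  from zero.\<close>
lemma cus_below_split:
  assumes h: "0 < h"
  shows "(if \<forall>j\<le>m. cus y j < h then 1 else 0 :: real) = (if stay h m y then 1 else 0) +
    (\<Sum>k<m. (if stay h k y \<and> walk y (Suc k) \<le> 0 then 1 else 0) *
       (if \<forall>j\<le>m - Suc k. cus (\<lambda>i. y (Suc k + i)) j < h then 1 else 0))"
    (is "_ = _ + (\<Sum>k<m. ?s k)")
proof (cases "pos_upto m y")
  case True
  have p: "pos_upto j y" if "j \<le> m" for j using True that by (auto simp: pos_upto_def)
  have "?s k = 0" if "k < m" for k
    using True that by (auto simp: pos_upto_def dest!: bspec[of _ _ "Suc k"])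
  moreover have "(\<forall>j\<le>m. cus y j < h) \<longleftrightarrow> stay h m y"
  proof
    assume "\<forall>j\<le>m. cus y j < h"
    then show "stay h m y" using p True cus_eq_walk unfolding stay_def pos_upto_def
      by (metis (no_types, lifting) True atLeastAtMost_iff pos_upto_def)
  next
    assume s: "stay h m y"
    show "\<forall>j\<le>m. cus y j < h"
    proof (intro allI impI)
      fix j assume "j \<le> m"
      then show "cus y j < h" using s h cus_eq_walk[OF p, of j] by (cases j) (auto simp: stay_def)
    qed
  qed
  moreover from calculation(1) have "(\<Sum>k<m. ?s k) = 0" by (intro sum.neutral) blast
  ultimately show ?thesis by simp
next
  case False
  let ?P = "\<lambda>k. walk y (Suc k) \<le> 0"
  \<comment> \<open>The index is shifted by one: the first descending ladder epoch is
    \<open>k0 + 1\<close>.\<close>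
  define k0 where "k0 = (LEAST k. ?P k)"
  obtain j where j: "j \<in> {1..m}" "walk y j \<le> 0" using False by (auto simp: pos_upto_def not_less)
  then have ex: "?P (j - 1)" "j - 1 < m" by auto
  have P0: "?P k0" unfolding k0_def by (rule LeastI) (rule ex)
  have k0m: "k0 < m" using Least_le[of ?P, OF ex(1)] ex(2) unfolding k0_def by linarith
  have lt: "0 < walk y j" if "1 \<le> j" "j \<le> k0" for j
  proof -
    have "j - 1 < k0" using that by simp
    then have "\<not> ?P (j - 1)" unfolding k0_def by (rule not_less_Least)
    then show ?thesis using that by simp
  qed
  have pos: "pos_upto j y" if "j \<le> k0" for j using lt that by (auto simp: pos_upto_def)
  \<comment> \<open>Up to \<open>k0\<close> the statistic equals the walk, so the reflection takes
    effect at the first step that makes the walk nonpositive.\<close>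
  have c0: "cus y (Suc k0) = 0" using P0 cus_eq_walk[OF pos[of k0]] by (simp add: walk_Suc)
  have "?s k = 0" if "k \<noteq> k0" for k
  proof (cases "k < k0")
    case True
    then show ?thesis using lt[of "Suc k"] by auto
  next
    case False
    then have "Suc k0 \<in> {1..k}" using that by auto
    then have "\<not> stay h k y" using P0 unfolding stay_def by (meson linorder_not_le)
    then show ?thesis by simp
  qed
  then have "(\<Sum>k\<in>{..<m} - {k0}. ?s k) = 0" by (intro sum.neutral) blast
  then have sum: "(\<Sum>k<m. ?s k) = ?s k0" using k0m by (subst sum.remove[of _ k0]) auto
  have nst: "\<not> stay h m y" using False stay_imp_pos_upto by blast
  have "(\<forall>j\<le>m. cus y j < h) \<longleftrightarrow> stay h k0 y \<and> (\<forall>j\<le>m - Suc k0. cus (\<lambda>i. y (Suc k0 + i)) j < h)"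
  proof safe
    assume a: "\<forall>j\<le>m. cus y j < h"
    show "stay h k0 y" unfolding stay_def
      using a lt cus_eq_walk[OF pos] k0m by (metis (full_types) atLeastAtMost_iff less_imp_le_nat order_trans)
    show "cus (\<lambda>i. y (Suc k0 + i)) j < h" if "j \<le> m - Suc k0" for j
      using a[rule_format, of "Suc k0 + j"] that k0m unfolding cus_shift[OF c0] by simp
  next
    fix j assume s: "stay h k0 y" and b: "\<forall>j\<le>m - Suc k0. cus (\<lambda>i. y (Suc k0 + i)) j < h" and j: "j \<le> m"
    show "cus y j < h"
    proof (cases "j \<le> k0")
      case True
      then show ?thesis using s h cus_eq_walk[OF pos[OF True]] by (cases j) (auto simp: stay_def)
    next
      case False
      then have "j = Suc k0 + (j - Suc k0)" by simp
      then show ?thesis using b j cus_shift[OF c0, of "j - Suc k0"] by (metis diff_le_mono)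
    qed
  qed
  then show ?thesis using sum nst P0 by simp
qed

lemma squeeze_zero:
  fixes w x :: "nat \<Rightarrow> real"
  assumes "\<And>k. 0 \<le> w k" "\<And>k. w k \<le> x k" "x \<longlonglongrightarrow> 0"
  shows "w \<longlonglongrightarrow> 0"
  by (rule tendsto_sandwich[OF _ _ tendsto_const assms(3)]) (use assms in auto)

lemma tendsto_suminf_dominated:
  fixes a :: "nat \<Rightarrow> nat \<Rightarrow> 'b :: {real_normed_algebra, banach}"
  assumes "\<And>k. (\<lambda>n. a n k) \<longlonglongrightarrow> b k" "\<And>n k. norm (a n k) \<le> M k" "summable M"
  shows "(\<lambda>n. \<Sum>k. a n k) \<longlonglongrightarrow> (\<Sum>k. b k)"
  using tannerys_theorem[where a="\<lambda>k n. a n k" and b=b and M=M and F=sequentially] assms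
  by (auto intro!: always_eventually)

context cusum_law
begin

lemma stay_measurable [measurable]: "Measurable.pred Q (stay h k)"
  unfolding stay_def[abs_def] by measurable

definition exit_down :: "real \<Rightarrow> nat \<Rightarrow> (nat \<Rightarrow> real) \<Rightarrow> bool" where
  "exit_down h k y \<longleftrightarrow> stay h k y \<and> walk y (Suc k) \<le> 0"

definition exit_up :: "real \<Rightarrow> nat \<Rightarrow> (nat \<Rightarrow> real) \<Rightarrow> bool" where
  "exit_up h k y \<longleftrightarrow> stay h k y \<and> h \<le> walk y (Suc k)"

lemma exit_measurable [measurable]:
  "Measurable.pred Q (exit_down h k)" "Measurable.pred Q (exit_up h k)"
  unfolding exit_down_def[abs_def] exit_up_def[abs_def] by measurable

definition u :: "real \<Rightarrow> nat \<Rightarrow> real" where "u h k = (\<integral>y. (if stay h k y then 1 else 0) \<partial>Q)"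
definition d :: "real \<Rightarrow> nat \<Rightarrow> real" where "d h k = (\<integral>y. (if exit_down h k y then 1 else 0) \<partial>Q)"
definition g :: "real \<Rightarrow> nat \<Rightarrow> real" where "g h k = (\<integral>y. (if exit_up h k y then 1 else 0) \<partial>Q)"
text \<open>The defect of the returning cycles. By \<open>g_sums\<close> it is the probability that
  a cycle ends at or above \<open>h\<close>, since the walk almost surely leaves the strip.\<close>

definition p :: "real \<Rightarrow> real" where "p h = 1 - (\<Sum>k. d h k)"

lemma u_bounds: "0 \<le> u h k" "u h k \<le> t k"
proof -
  show "0 \<le> u h k" unfolding u_def by (rule Bochner_Integration.integral_nonneg) auto
  show "u h k \<le> t k" unfolding u_def t_def
    by (intro integral_mono integrable_if_Q[where B=1]) (auto simp: stay_imp_pos_upto)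
qed

lemma d_bounds: "0 \<le> d h k" "d h k \<le> t k - t (Suc k)"
proof -
  show "0 \<le> d h k" unfolding d_def by (rule Bochner_Integration.integral_nonneg) auto
  show "d h k \<le> t k - t (Suc k)" unfolding d_def hit_prob[symmetric]
    by (intro integral_mono integrable_if_Q[where B=1]) (auto simp: exit_down_def hit_def stay_imp_pos_upto)
qed

lemma d_summable: "summable (d h)"
  by (rule summable_comparison_test[OF _ sums_summable[OF hit_prob_sums]])
    (use d_bounds in \<open>auto simp: abs_of_nonneg\<close>)

lemma u_tendsto_0: "u h \<longlonglongrightarrow> 0"
  by (rule squeeze_zero[OF u_bounds t_tendsto_0])

lemma split_exit:
  fixes f :: "real \<Rightarrow> real"
  assumes h: "0 < h" and [measurable]: "f \<in> borel_measurable borel" and B: "\<And>x. \<bar>f x\<bar> \<le> B"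
  shows "(\<integral>y. (if stay h k y then f (walk y (Suc k)) else 0) \<partial>Q) =
    (\<integral>y. (if stay h (Suc k) y then f (walk y (Suc k)) else 0) \<partial>Q) +
    ((\<integral>y. (if exit_up h k y then f (walk y (Suc k)) else 0) \<partial>Q) +
     (\<integral>y. (if exit_down h k y then f (walk y (Suc k)) else 0) \<partial>Q))"
proof -
  have B0: "0 \<le> B" using B[of 0] by simp
  have i: "integrable Q (\<lambda>y. if A y then f (walk y (Suc k)) else 0)" if "Measurable.pred Q A" for A
    using that by (rule integrable_if_Q[where B=B]) (auto simp: B B0)
  have "(\<integral>y. (if stay h k y then f (walk y (Suc k)) else 0) \<partial>Q) =
    (\<integral>y. (if stay h (Suc k) y then f (walk y (Suc k)) else 0) +
      ((if exit_up h k y then f (walk y (Suc k)) else 0) + (if exit_down h k y then f (walk y (Suc k)) else 0)) \<partial>Q)"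
    using h by (intro Bochner_Integration.integral_cong) (auto simp: stay_Suc exit_up_def exit_down_def)
  also have "\<dots> = (\<integral>y. (if stay h (Suc k) y then f (walk y (Suc k)) else 0) \<partial>Q) +
    (\<integral>y. (if exit_up h k y then f (walk y (Suc k)) else 0) + (if exit_down h k y then f (walk y (Suc k)) else 0) \<partial>Q)"
    by (intro Bochner_Integration.integral_add Bochner_Integration.integrable_add i) measurable
  also have "(\<integral>y. (if exit_up h k y then f (walk y (Suc k)) else 0) + (if exit_down h k y then f (walk y (Suc k)) else 0) \<partial>Q) =
    (\<integral>y. (if exit_up h k y then f (walk y (Suc k)) else 0) \<partial>Q) + (\<integral>y. (if exit_down h k y then f (walk y (Suc k)) else 0) \<partial>Q)"
    by (intro Bochner_Integration.integral_add i) measurable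
  finally show ?thesis .
qed

lemma g_sums:
  assumes "0 < h"
  shows "g h sums p h"
proof -
  have step: "u h k = u h (Suc k) + (g h k + d h k)" for k
    unfolding u_def g_def d_def by (rule split_exit[OF assms, of "\<lambda>_. 1" 1 k]) auto
  have eq: "g h k = (u h k - u h (Suc k)) - d h k" for k using step[of k] by linarith
  have u0: "u h 0 = 1" using seq.P.prob_space by (simp add: u_def stay_def)
  have "(\<lambda>k. (u h k - u h (Suc k)) - d h k) sums ((u h 0 - 0) - (\<Sum>k. d h k))"
    by (intro sums_diff telescope_sums' u_tendsto_0 summable_sums d_summable)
  then show ?thesis unfolding p_def u0 eq[symmetric] by simp
qed

text \<open>The contribution to \<open>psi h\<close> of paths whose first cycle closes at step
  \<open>k + 1\<close> but which cross \<open>h\<close> later, the walk continuing from where it is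
  instead of restarting at 0.\<close>

definition b :: "real \<Rightarrow> nat \<Rightarrow> real" where
  "b h k = (\<integral>y. (if exit_down h k y then psi (h - walk y (Suc k)) else 0) \<partial>Q)"

lemma b_bounds: "0 \<le> b h k" "b h k \<le> d h k"
proof -
  show "0 \<le> b h k" unfolding b_def by (rule Bochner_Integration.integral_nonneg) (auto simp: psi_bounds)
  show "b h k \<le> d h k" unfolding b_def d_def
    by (intro integral_mono integrable_if_Q[where B=1]) (auto simp: psi_bounds abs_of_nonneg)
qed

lemma abs_psi_le: "\<bar>psi x\<bar> \<le> 1"
  by (simp add: psi_bounds)

text \<open>Optional stopping for the bounded harmonic function \<open>x \<mapsto> psi (h - x)\<close> at the exit from
  \<open>(0, h)\<close>.\<close>
lemma psi_decomposition:
  assumes h: "0 < h"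
  shows "(\<lambda>k. g h k + b h k) sums psi h"
proof -
  define a where "a k = (\<integral>y. (if stay h k y then psi (h - walk y k) else 0) \<partial>Q)" for k
  have step: "a k = a (Suc k) + (g h k + b h k)" for k
  proof -
    have "(\<integral>y. (if stay h k y then psi (h - (walk y k + y k)) else 0) \<partial>Q) =
      (\<integral>y. (if stay h k y then (\<integral>z. psi (h - (walk y k + z)) \<partial>\<mu>) else 0) \<partial>Q)"
    proof (rule integral_step[where F="\<lambda>x z. psi (h - (x + z))" and B=1])
      show "\<bar>psi (h - (x + z))\<bar> \<le> 1" for x z by (rule abs_psi_le)
      have "(\<lambda>w. h - (fst w + snd w)) \<in> borel_measurable (borel \<Otimes>\<^sub>M borel)" by measurable
      from measurable_compose[OF this psi_measurable]
      show "(\<lambda>(x, z). psi (h - (x + z))) \<in> borel_measurable (borel \<Otimes>\<^sub>M borel)"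
        by (simp add: split_beta')
    qed (rule stay_depends stay_measurable)+
    also have "\<dots> = a k" unfolding a_def
    proof (intro Bochner_Integration.integral_cong refl if_cong)
      fix y assume "stay h k y"
      then have "0 < h - walk y k" using h by (cases k) (auto simp: stay_def)
      from psi_eq[OF this] show "(\<integral>z. psi (h - (walk y k + z)) \<partial>\<mu>) = psi (h - walk y k)"
        unfolding diff_diff_eq by (rule sym)
    qed
    finally have "a k = (\<integral>y. (if stay h k y then psi (h - walk y (Suc k)) else 0) \<partial>Q)" unfolding walk_Suc by (rule sym)
    also have "\<dots> = a (Suc k) + ((\<integral>y. (if exit_up h k y then psi (h - walk y (Suc k)) else 0) \<partial>Q) + b h k)"
      unfolding a_def b_def
    proof (rule split_exit[OF h, where f="\<lambda>x. psi (h - x)" and B=1])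
      show "\<bar>psi (h - x)\<bar> \<le> 1" for x by (rule abs_psi_le)
      have "(\<lambda>x. h - x) \<in> borel_measurable borel" by measurable
      from measurable_compose[OF this psi_measurable]
      show "(\<lambda>x. psi (h - x)) \<in> borel_measurable borel" .
    qed
    also have "(\<integral>y. (if exit_up h k y then psi (h - walk y (Suc k)) else 0) \<partial>Q) = g h k"
      unfolding g_def by (intro Bochner_Integration.integral_cong) (auto simp: exit_up_def psi_nonpos)
    finally show ?thesis .
  qed
  have eq: "a k - a (Suc k) = g h k + b h k" for k using step[of k] by linarith
  have a0: "a 0 = psi h" using seq.P.prob_space by (simp add: a_def stay_def)
  have "0 \<le> a k" for k unfolding a_def by (rule Bochner_Integration.integral_nonneg) (auto simp: psi_bounds)
  moreover have "a k \<le> u h k" for k unfolding a_def u_def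
    by (intro integral_mono integrable_if_Q[where B=1]) (auto simp: psi_bounds abs_of_nonneg)
  ultimately have "a \<longlonglongrightarrow> 0" using u_tendsto_0[of h] by (rule squeeze_zero)
  then have "(\<lambda>k. a k - a (Suc k)) sums (a 0 - 0)" by (rule telescope_sums')
  then show ?thesis unfolding eq a0 by simp
qed

lemma p_eq:
  assumes "0 < h"
  shows "p h = psi h - (\<Sum>k. b h k)" and "summable (b h)"
proof -
  show s: "summable (b h)"
    by (rule summable_comparison_test[OF _ d_summable[of h]]) (use b_bounds in \<open>auto simp: abs_of_nonneg\<close>)
  have "(\<lambda>k. g h k + b h k) sums (p h + (\<Sum>k. b h k))"
    by (intro sums_add g_sums assms summable_sums s)
  from sums_unique2[OF this psi_decomposition[OF assms]] show "p h = psi h - (\<Sum>k. b h k)" by simp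
qed

lemma eventually_stay:
  assumes X: "filterlim X at_top sequentially"
  shows "\<forall>\<^sub>F n in sequentially. stay (X n) k y \<longleftrightarrow> pos_upto k y"
proof -
  have "\<forall>\<^sub>F n in sequentially. \<forall>j\<in>{1..k}. walk y j < X n"
    using X by (intro eventually_ball_finite ballI) (auto simp: filterlim_at_top_dense)
  then show ?thesis by eventually_elim (auto simp: stay_def pos_upto_def)
qed

lemma u_tendsto_t:
  assumes X: "filterlim X at_top sequentially"
  shows "(\<lambda>n. u (X n) k) \<longlonglongrightarrow> t k"
  unfolding u_def t_def
proof (rule integral_dominated_convergence[where w="\<lambda>_. 1"])
  show "AE y in Q. (\<lambda>n. if stay (X n) k y then 1 else 0) \<longlonglongrightarrow> (if pos_upto k y then 1 else 0::real)"
  proof (rule AE_I2)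
    fix y
    have "\<forall>\<^sub>F n in sequentially. (if stay (X n) k y then 1 else 0) = (if pos_upto k y then 1 else 0::real)"
      using eventually_stay[OF X, of k y] by eventually_elim simp
    then show "(\<lambda>n. if stay (X n) k y then 1 else 0) \<longlonglongrightarrow> (if pos_upto k y then 1 else 0::real)"
      by (rule tendsto_eventually)
  qed
qed auto

lemma d_tendsto:
  assumes X: "filterlim X at_top sequentially"
  shows "(\<lambda>n. d (X n) k) \<longlonglongrightarrow> t k - t (Suc k)"
  unfolding d_def hit_prob[symmetric]
proof (rule integral_dominated_convergence[where w="\<lambda>_. 1"])
  show "AE y in Q. (\<lambda>n. if exit_down (X n) k y then 1 else 0) \<longlonglongrightarrow> (if hit k y then 1 else 0::real)"
  proof (rule AE_I2)
    fix y
    have "\<forall>\<^sub>F n in sequentially. (if exit_down (X n) k y then 1 else 0) = (if hit k y then 1 else 0::real)"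
      using eventually_stay[OF X, of k y] by eventually_elim (simp add: exit_down_def hit_def)
    then show "(\<lambda>n. if exit_down (X n) k y then 1 else 0) \<longlonglongrightarrow> (if hit k y then 1 else 0::real)"
      by (rule tendsto_eventually)
  qed
qed auto

text \<open>Write \<open>exp h\<close> as \<open>exp S * exp (h - S)\<close> with \<open>S\<close>
  the position after the descent. The second factor times \<open>psi (h - S)\<close> tends to the
  constant of \<open>psi_exp_limit\<close>, and the first is at most 1, so dominated convergence
  applies.\<close>

lemma exp_b_tendsto:
  assumes X: "filterlim X at_top sequentially"
  shows "(\<lambda>n. exp (X n) * b (X n) k) \<longlonglongrightarrow> r_inf * (1 - eta) / I_KL * eta_n k"
proof -
  let ?C = "r_inf * (1 - eta) / I_KL" and ?g = "\<lambda>h. exp h * psi h"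
  have g1: "?g h \<le> 1" for h
  proof -
    have "?g h \<le> exp h * exp (- h)" by (intro mult_left_mono psi_bounds) auto
    then show ?thesis by (simp add: exp_minus)
  qed
  have eq: "exp (X n) * b (X n) k = (\<integral>y. (if exit_down (X n) k y then exp (walk y (Suc k)) * ?g (X n - walk y (Suc k)) else 0) \<partial>Q)" for n
    unfolding b_def integral_mult_right_zero[symmetric]
    by (intro Bochner_Integration.integral_cong refl) (simp add: exp_diff)
  have "(\<lambda>n. exp (X n) * b (X n) k) \<longlonglongrightarrow> (\<integral>y. (if hit k y then exp (walk y (Suc k)) * ?C else 0) \<partial>Q)"
    unfolding eq
  proof (rule integral_dominated_convergence[where w="\<lambda>_. 1"])
    show "AE y in Q. (\<lambda>n. if exit_down (X n) k y then exp (walk y (Suc k)) * ?g (X n - walk y (Suc k)) else 0)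
      \<longlonglongrightarrow> (if hit k y then exp (walk y (Suc k)) * ?C else 0)"
    proof (rule AE_I2)
      fix y
      have "filterlim (\<lambda>n. - walk y (Suc k) + X n) at_top sequentially"
        by (rule filterlim_tendsto_add_at_top[OF tendsto_const X])
      from filterlim_compose[OF psi_exp_limit this]
      have "(\<lambda>n. ?g (X n - walk y (Suc k))) \<longlonglongrightarrow> ?C" by simp
      then have "(\<lambda>n. if hit k y then exp (walk y (Suc k)) * ?g (X n - walk y (Suc k)) else 0)
        \<longlonglongrightarrow> (if hit k y then exp (walk y (Suc k)) * ?C else 0)" by (cases "hit k y") (auto intro!: tendsto_mult tendsto_const simp del: times_divide_eq_right)
      moreover have "\<forall>\<^sub>F n in sequentially. (if hit k y then exp (walk y (Suc k)) * ?g (X n - walk y (Suc k)) else 0) =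
        (if exit_down (X n) k y then exp (walk y (Suc k)) * ?g (X n - walk y (Suc k)) else 0)"
        using eventually_stay[OF X, of k y] by eventually_elim (simp add: exit_down_def hit_def)
      ultimately show "(\<lambda>n. if exit_down (X n) k y then exp (walk y (Suc k)) * ?g (X n - walk y (Suc k)) else 0)
        \<longlonglongrightarrow> (if hit k y then exp (walk y (Suc k)) * ?C else 0)" by (rule Lim_transform_eventually)
    qed
    show "AE y in Q. norm (if exit_down (X n) k y then exp (walk y (Suc k)) * ?g (X n - walk y (Suc k)) else 0) \<le> 1" for n
    proof (rule AE_I2)
      fix y
      have "exp (walk y (Suc k)) * ?g (X n - walk y (Suc k)) \<le> 1" if "walk y (Suc k) \<le> 0"
        using mult_mono[of "exp (walk y (Suc k))" 1, OF _ g1] that by (simp add: psi_bounds)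
      then show "norm (if exit_down (X n) k y then exp (walk y (Suc k)) * ?g (X n - walk y (Suc k)) else 0) \<le> 1"
        by (auto simp: exit_down_def psi_bounds abs_of_nonneg)
    qed
  qed measurable
  also have "(\<integral>y. (if hit k y then exp (walk y (Suc k)) * ?C else 0) \<partial>Q) = (\<integral>y. ?C * (if hit k y then exp (walk y (Suc k)) else 0) \<partial>Q)"
    by (intro Bochner_Integration.integral_cong) auto
  also have "\<dots> = ?C * eta_n k" unfolding eta_n_def by simp
  finally show ?thesis .
qed

text \<open>Lundberg's bound gives \<open>exp h * psi (h - S) \<le> exp S \<le> 1\<close> after a
  descent. The result is uniform in \<open>h\<close> and summable over \<open>k\<close>.\<close>

lemma exp_b_le:
  assumes "0 < h"
  shows "exp h * b h k \<le> t k - t (Suc k)"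
proof -
  have "exp h * b h k = (\<integral>y. (if exit_down h k y then exp h * psi (h - walk y (Suc k)) else 0) \<partial>Q)"
    unfolding b_def integral_mult_right_zero[symmetric]
    by (intro Bochner_Integration.integral_cong) auto
  also have "\<dots> \<le> (\<integral>y. (if hit k y then 1 else 0) \<partial>Q)"
  proof (intro integral_mono integrable_if_Q)
    fix y
    have "exp h * psi (h - walk y (Suc k)) \<le> 1" if "walk y (Suc k) \<le> 0"
    proof -
      have "exp h * psi (h - walk y (Suc k)) \<le> exp h * exp (- (h - walk y (Suc k)))"
        by (intro mult_left_mono psi_bounds) auto
      also have "\<dots> = exp (walk y (Suc k))" by (simp add: exp_add[symmetric])
      finally show ?thesis using that by (simp add: order_trans[of _ "exp (walk y (Suc k))"])
    qed
    then show "(if exit_down h k y then exp h * psi (h - walk y (Suc k)) else 0) \<le> (if hit k y then 1 else 0)"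
      by (auto simp: exit_down_def hit_def stay_imp_pos_upto)
    show "\<bar>exp h * psi (h - walk y (Suc k))\<bar> \<le> exp h" by (simp add: abs_mult psi_bounds abs_of_nonneg)
  qed auto
  finally show ?thesis by (simp only: hit_prob)
qed

text \<open>\<open>p h\<close> is \<open>psi h\<close> minus the sum of \<open>b h k\<close>. After
  scaling, the subtracted part is asymptotically \<open>eta\<close> times the first, and this
  produces the second factor \<open>1 - eta\<close>.\<close>

lemma p_tendsto:
  assumes X: "filterlim X at_top sequentially"
  shows "(\<lambda>n. exp (X n) * p (X n)) \<longlonglongrightarrow> r_inf * (1 - eta)\<^sup>2 / I_KL"
proof -
  let ?C = "r_inf * (1 - eta) / I_KL"
  have pos: "\<forall>\<^sub>F n in sequentially. 0 < X n" using X by (auto simp: filterlim_at_top_dense)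
  \<comment> \<open>The majorant has to hold for every \<open>n\<close>, but \<open>exp_b_le\<close>
    needs a positive level; the finitely many other terms are set to 0.\<close>
  define a where "a n k = (if 0 < X n then exp (X n) * b (X n) k else 0)" for n k
  have "(\<lambda>n. \<Sum>k. a n k) \<longlonglongrightarrow> (\<Sum>k. ?C * eta_n k)"
  proof (rule tendsto_suminf_dominated[OF _ _ sums_summable[OF hit_prob_sums]])
    show "(\<lambda>n. a n k) \<longlonglongrightarrow> ?C * eta_n k" for k
      by (rule Lim_transform_eventually[OF exp_b_tendsto[OF X]]) (use pos in eventually_elim, simp add: a_def)
    show "norm (a n k) \<le> t k - t (Suc k)" for n k
      using exp_b_le[of "X n" k] b_bounds[of "X n" k] d_bounds[of "X n" k] unfolding a_def by auto
  qed
  moreover have "(\<Sum>k. ?C * eta_n k) = ?C * eta"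
    unfolding eta_def by (rule suminf_mult[OF eta_summable])
  ultimately have "(\<lambda>n. exp (X n) * psi (X n) - (\<Sum>k. a n k)) \<longlonglongrightarrow> ?C - ?C * eta"
    using filterlim_compose[OF psi_exp_limit X] by (intro tendsto_diff) auto
  moreover have "\<forall>\<^sub>F n in sequentially. exp (X n) * psi (X n) - (\<Sum>k. a n k) = exp (X n) * p (X n)"
    using pos
  proof eventually_elim
    case (elim n)
    have "(\<Sum>k. a n k) = exp (X n) * (\<Sum>k. b (X n) k)"
      using elim unfolding a_def by (simp add: suminf_mult[OF p_eq(2)])
    then show ?case unfolding p_eq(1)[OF elim] by (simp only: right_diff_distrib)
  qed
  ultimately have "(\<lambda>n. exp (X n) * p (X n)) \<longlonglongrightarrow> ?C - ?C * eta" by (rule Lim_transform_eventually)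
  moreover have "?C - ?C * eta = r_inf * (1 - eta)\<^sup>2 / I_KL"
    by (simp add: power2_eq_square algebra_simps diff_divide_distrib add_divide_distrib)
  ultimately show ?thesis by simp
qed

definition v :: "real \<Rightarrow> nat \<Rightarrow> real" where
  "v h m = (\<integral>y. (if \<forall>j\<le>m. cus y j < h then 1 else 0) \<partial>Q)"

lemma cus_measurable [measurable]: "(\<lambda>y. cus y k) \<in> borel_measurable Q"
  by (induction k) auto

lemma v_bounds: "0 \<le> v h m" "v h m \<le> 1"
proof -
  show "0 \<le> v h m" unfolding v_def by (rule Bochner_Integration.integral_nonneg) auto
  have "v h m \<le> (\<integral>y. 1 \<partial>Q)" unfolding v_def
    by (rule integral_mono[OF integrable_if_Q[where B=1]]) auto
  then show "v h m \<le> 1" using seq.P.prob_space by simp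
qed

lemma v_antimono: "decseq (v h)"
  unfolding decseq_Suc_iff v_def
  by (intro allI integral_mono integrable_if_Q[where B=1]) auto

lemma v_0: "0 < h \<Longrightarrow> v h 0 = 1"
  using seq.P.prob_space by (simp add: v_def)

lemma v_renewal:
  assumes h: "0 < h"
  shows "v h m = u h m + (\<Sum>k<m. d h k * v h (m - Suc k))"
proof -
  let ?a = "\<lambda>k y. if exit_down h k y then 1 else 0 :: real"
  let ?b = "\<lambda>m y. if \<forall>j\<le>m. cus y j < h then 1 else 0 :: real"
  have a: "integrable Q (?a k)" for k by (rule integrable_if_Q[where B=1]) auto
  have b: "integrable Q (?b m)" for m by (rule integrable_if_Q[where B=1]) auto
  have s: "integrable Q (\<lambda>y. if stay h m y then 1 else 0 :: real)" by (rule integrable_if_Q[where B=1]) auto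
  have dep: "depends (Suc k) (?a k)" for k
  proof (rule dependsI)
    fix y z :: "nat \<Rightarrow> real" assume *: "\<And>i. i < Suc k \<Longrightarrow> y i = z i"
    have "walk y j = walk z j" if "j \<le> Suc k" for j using * that by (intro walk_cong) auto
    then have "exit_down h k y \<longleftrightarrow> exit_down h k z" by (auto simp: exit_down_def stay_def)
    then show "?a k y = ?a k z" by simp
  qed
  have "v h m = (\<integral>y. (if stay h m y then 1 else 0) + (\<Sum>k<m. ?a k y * ?b (m - Suc k) (\<lambda>i. y (Suc k + i))) \<partial>Q)"
    unfolding v_def exit_down_def by (subst cus_below_split[OF h]) (rule refl)
  also have "\<dots> = u h m + (\<integral>y. (\<Sum>k<m. ?a k y * ?b (m - Suc k) (\<lambda>i. y (Suc k + i))) \<partial>Q)"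
    unfolding u_def by (intro Bochner_Integration.integral_add s Bochner_Integration.integrable_sum indep_split(1)[OF a b dep])
  also have "(\<integral>y. (\<Sum>k<m. ?a k y * ?b (m - Suc k) (\<lambda>i. y (Suc k + i))) \<partial>Q) =
      (\<Sum>k<m. (\<integral>y. ?a k y * ?b (m - Suc k) (\<lambda>i. y (Suc k + i)) \<partial>Q))"
    by (intro Bochner_Integration.integral_sum indep_split(1)[OF a b dep])
  also have "\<dots> = (\<Sum>k<m. d h k * v h (m - Suc k))"
    unfolding d_def v_def by (intro sum.cong refl indep_split(2)[OF a b dep])
  finally show ?thesis .
qed

definition e :: "nat \<Rightarrow> real" where
  "e k = (\<integral>y. (if hit k y then walk y (Suc k) else 0) \<partial>Q)"

lemma component: "integrable Q (\<lambda>y. y i)" "(\<integral>y. y i \<partial>Q) = (\<integral>z. z \<partial>\<mu>)"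
proof -
  have m: "(\<lambda>z::real. z) \<in> borel_measurable borel" by measurable
  show "integrable Q (\<lambda>y. y i)" "(\<integral>y. y i \<partial>Q) = (\<integral>z. z \<partial>\<mu>)"
    using integral_component[OF m, of i] z_int by blast+
qed

lemma walk_integrable: "integrable Q (\<lambda>y. walk y k)"
  unfolding walk_def by (intro Bochner_Integration.integrable_sum component)

lemma integrable_if_walk:
  assumes [measurable]: "Measurable.pred Q A"
  shows "integrable Q (\<lambda>y. if A y then walk y k else 0)"
  by (rule Bochner_Integration.integrable_bound[OF walk_integrable[of k]]) auto

text \<open>Wald's identity by telescoping: the mean position on the event that the ladder epoch
  exceeds \<open>k\<close> gains the mean step times \<open>t k\<close> and loses
  \<open>e k\<close>. It tends to 0 because of the Chernoff bound.\<close>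

lemma wald: "e sums ((\<integral>z. z \<partial>\<mu>) * (\<Sum>k. t k))"
proof -
  let ?m = "\<integral>z. z \<partial>\<mu>"
  define w where "w k = (\<integral>y. (if pos_upto k y then walk y k else 0) \<partial>Q)" for k
  have step: "w k + ?m * t k = w (Suc k) + e k" for k
  proof -
    let ?a = "\<lambda>y. if pos_upto k y then 1 else 0 :: real"
    have a: "integrable Q ?a" by (rule integrable_if_Q[where B=1]) auto
    have b: "integrable Q (\<lambda>y. y 0)" "(\<integral>y. y 0 \<partial>Q) = ?m"
      by (rule component)+
    have dep: "depends k ?a" using pos_upto_depends[of k] by (auto simp: depends_def)
    have 1: "integrable Q (\<lambda>y. ?a y * y (k + 0))" "(\<integral>y. ?a y * y (k + 0) \<partial>Q) = t k * ?m"
      using indep_split[OF a b(1) dep] b(2) by (auto simp: t_def)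
    have "w k + ?m * t k = (\<integral>y. (if pos_upto k y then walk y k else 0) + ?a y * y (k + 0) \<partial>Q)"
      using Bochner_Integration.integral_add[OF integrable_if_walk[of "pos_upto k" k] 1(1)] 1(2)
      by (simp add: w_def mult.commute)
    also have "\<dots> = (\<integral>y. (if pos_upto (Suc k) y then walk y (Suc k) else 0) + (if hit k y then walk y (Suc k) else 0) \<partial>Q)"
      by (intro Bochner_Integration.integral_cong refl) (auto simp: pos_upto_Suc hit_def walk_Suc)
    also have "\<dots> = w (Suc k) + e k" unfolding w_def e_def
      by (intro Bochner_Integration.integral_add integrable_if_walk) measurable
    finally show ?thesis .
  qed
  have w0: "0 \<le> w k" for k unfolding w_def
  proof (rule Bochner_Integration.integral_nonneg)
    show "0 \<le> (if pos_upto k y then walk y k else 0)" for y by (cases k) (auto simp: pos_upto_def less_imp_le)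
  qed
  have w1: "w k \<le> 2 * rho ^ k" for k
  proof -
    have "w k \<le> (\<integral>y. 2 * exp (walk y k / 2) \<partial>Q)" unfolding w_def
    proof (intro integral_mono integrable_if_walk)
      \<comment> \<open>From \<open>1 + x / 2 \<le> exp (x / 2)\<close> one has
        \<open>x \<le> 2 * exp (x / 2)\<close>.\<close>
      show "(if pos_upto k y then walk y k else 0) \<le> 2 * exp (walk y k / 2)" for y
        using exp_ge_add_one_self[of "walk y k / 2"] exp_gt_zero[of "walk y k / 2"] by (simp add: field_simps)
    qed (auto simp: exp_half_walk)
    then show ?thesis by (simp add: exp_half_walk)
  qed
  have "(\<lambda>k. 2 * rho ^ k) \<longlonglongrightarrow> 2 * 0"
    using rho_nonneg rho_less_1 by (intro tendsto_mult tendsto_const LIMSEQ_realpow_zero)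
  then have "w \<longlonglongrightarrow> 0" using squeeze_zero[OF w0 w1] by simp
  then have "(\<lambda>k. w k - w (Suc k)) sums (w 0 - 0)" by (rule telescope_sums')
  moreover have "w 0 = 0" unfolding w_def by (rule integral_eq_zero_AE) simp
  ultimately have "(\<lambda>k. w k - w (Suc k)) sums 0" by simp
  then have "(\<lambda>k. (w k - w (Suc k)) + ?m * t k) sums (0 + ?m * (\<Sum>k. t k))"
    by (intro sums_add sums_mult summable_sums t_summable)
  moreover have "(w k - w (Suc k)) + ?m * t k = e k" for k using step[of k] by linarith
  ultimately show ?thesis by simp
qed

lemma e_nonpos: "e k \<le> 0"
proof -
  have "0 \<le> (\<integral>y. - (if hit k y then walk y (Suc k) else 0) \<partial>Q)"
    by (rule Bochner_Integration.integral_nonneg) (auto simp: hit_def)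
  then show ?thesis by (simp add: e_def)
qed

text \<open>A weak ladder height may be 0, so strictness needs an event: the first step is negative
  with positive probability, and then the ladder height is strictly negative.\<close>

lemma eta_less_1: "eta < 1"
proof -
  have i: "integrable Q (\<lambda>y. if hit 0 y then 1 - exp (y 0) else 0)"
    by (rule integrable_if_Q[where B=1]) (auto simp: hit_def walk_Suc)
  have d0: "(\<integral>y. (if hit 0 y then 1 - exp (y 0) else 0) \<partial>Q) = (t 0 - t (Suc 0)) - eta_n 0"
  proof -
    have "(\<integral>y. (if hit 0 y then 1 - exp (y 0) else 0) \<partial>Q) = (\<integral>y. (if hit 0 y then 1 else 0) - (if hit 0 y then exp (walk y (Suc 0)) else 0) \<partial>Q)"
      by (intro Bochner_Integration.integral_cong) (auto simp: walk_Suc)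
    also have "\<dots> = (t 0 - t (Suc 0)) - eta_n 0" unfolding hit_prob[symmetric] eta_n_def
      by (intro Bochner_Integration.integral_diff integrable_if_Q[where B=1]) (auto simp: hit_def)
    finally show ?thesis .
  qed
  have "(\<integral>y. (if hit 0 y then 1 - exp (y 0) else 0) \<partial>Q) \<noteq> 0"
  proof
    assume "(\<integral>y. (if hit 0 y then 1 - exp (y 0) else 0) \<partial>Q) = 0"
    then have "AE y in Q. (if hit 0 y then 1 - exp (y 0) else 0) = 0"
      by (subst (asm) integral_nonneg_eq_0_iff_AE[OF i]) (auto simp: hit_def walk_Suc)
    then have "AE y in Q. \<not> y 0 < 0" by eventually_elim (auto simp: hit_def walk_Suc pos_upto_def)
    then have 0: "(\<integral>y. indicator {..<0} (y 0) \<partial>Q) = (0::real)"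
      by (intro integral_eq_zero_AE) (auto elim!: eventually_mono)
    have m: "(indicator {..<0} :: real \<Rightarrow> real) \<in> borel_measurable borel" by measurable
    have "(\<integral>z. indicator {..<0} z \<partial>\<mu>) = (0::real)" using 0 unfolding integral_component(1)[OF m] .
    then show False using mu_neg by (simp add: sets_mu)
  qed
  then have "eta_n 0 < t 0 - t (Suc 0)" using d0 eta_n_bounds(2)[of 0] by simp
  then have "0 < (\<Sum>k. (t k - t (Suc k)) - eta_n k)"
    using eta_n_bounds by (intro suminf_pos2[of _ 0] summable_diff sums_summable[OF hit_prob_sums] eta_summable) auto
  also have "\<dots> = 1 - eta"
    using suminf_diff[OF sums_summable[OF hit_prob_sums] eta_summable] sums_unique[OF hit_prob_sums] by (simp add: eta_def)
  finally show ?thesis by simp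
qed

text \<open>Summation by parts equates the two formulas for the mean ladder epoch; the boundary term
  \<open>k * t k\<close> vanishes by geometric decay.\<close>

lemma weighted_hit_sums: "(\<lambda>k. real (Suc k) * (t k - t (Suc k))) sums (\<Sum>k. t k)"
proof -
  have eq: "real (Suc k) * (t k - t (Suc k)) = (real k * t k - real (Suc k) * t (Suc k)) + t k" for k
    by (simp add: algebra_simps)
  have "(\<lambda>k. real k * rho ^ k) \<longlonglongrightarrow> 0"
    using rho_nonneg rho_less_1 by (intro powser_times_n_limit_0) auto
  then have "(\<lambda>k. real k * t k) \<longlonglongrightarrow> 0"
    by (rule squeeze_zero[rotated 2]) (auto intro!: mult_left_mono t_le simp: t_nonneg)
  from sums_add[OF telescope_sums'[OF this] summable_sums[OF t_summable]]
  show ?thesis unfolding eq by simp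
qed

end

section \<open>Exponential limits from renewal equations\<close>

lemma char_exponential:
  assumes l: "0 < l"
  shows "char (density lborel (\<lambda>x. ennreal (exponential_density l x))) s = of_real l / (of_real l - \<i> * of_real s)"
proof -
  \<comment> \<open>The real part of \<open>w\<close> is \<open>l > 0\<close>, so the antiderivative
    vanishes at infinity and the integral is its negated value at 0.\<close>
  define w :: complex where "w = of_real l - \<i> * of_real s"
  let ?f = "\<lambda>x::real. of_real l * exp (- w * of_real x) :: complex"
  let ?F = "\<lambda>x::real. - (of_real l / w) * exp (- w * of_real x)"
  have Rew: "Re w = l" by (simp add: w_def)
  then have w0: "w \<noteq> 0" using l by auto
  have nf: "norm (?f x) = l * exp (- x * l)" for x using l Rew by (simp add: norm_mult norm_exp_eq_Re mult.commute)
  have dm: "exponential_density l \<in> borel_measurable lborel" by measurable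
  have di: "integrable lborel (exponential_density l)"
  proof (rule integrableI_nonneg)
    interpret prob_space "density lborel (\<lambda>x. ennreal (exponential_density l x))"
      using l by (rule prob_space_exponential_density)
    have "(\<integral>\<^sup>+x. ennreal (exponential_density l x) \<partial>lborel) = 1"
      using emeasure_space_1 by (simp add: emeasure_density)
    then show "(\<integral>\<^sup>+x. ennreal (exponential_density l x) \<partial>lborel) < \<infinity>" by simp
  qed (use l dm in \<open>auto simp: erlang_density_def\<close>)
  have si: "set_integrable lborel (einterval 0 \<infinity>) ?f"
    unfolding set_integrable_def
  proof (rule Bochner_Integration.integrable_bound[OF di])
    have "(\<lambda>x. indicator (einterval 0 \<infinity>) x *\<^sub>R ?f x) \<in> borel_measurable borel" by measurable
    then show "(\<lambda>x. indicator (einterval 0 \<infinity>) x *\<^sub>R ?f x) \<in> borel_measurable lborel" by simp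
    show "AE x in lborel. norm (indicator (einterval 0 \<infinity>) x *\<^sub>R ?f x) \<le> norm (exponential_density l x)"
      using l by (intro AE_I2) (simp only: norm_scaleR nf, auto simp: indicator_def einterval_def exponential_density_def)
  qed
  have "char (density lborel (\<lambda>x. ennreal (exponential_density l x))) s = (CLINT x|lborel. exponential_density l x *\<^sub>R iexp (s * x))"
    unfolding char_def using l by (subst integral_density) (auto simp: erlang_density_def)
  also have "\<dots> = (CLINT x|lborel. indicator (einterval 0 \<infinity>) x *\<^sub>R ?f x)"
  proof (rule integral_cong_AE)
    have "AE x in lborel. x \<noteq> (0::real)" by (rule AE_lborel_singleton)
    then show "AE x in lborel. exponential_density l x *\<^sub>R iexp (s * x) = indicator (einterval 0 \<infinity>) x *\<^sub>R ?f x"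
    proof eventually_elim
      fix x :: real assume "x \<noteq> 0"
      then show "exponential_density l x *\<^sub>R iexp (s * x) = indicator (einterval 0 \<infinity>) x *\<^sub>R ?f x"
        by (auto simp: erlang_density_def einterval_def indicator_def scaleR_conv_of_real exp_of_real[symmetric] exp_add[symmetric] algebra_simps w_def)
    qed
  qed (use borel_measurable_integrable[OF si[unfolded set_integrable_def]] in measurable)
  also have "\<dots> = (LBINT x=0..\<infinity>. ?f x)"
  proof -
    have "0 \<le> (\<infinity>::ereal)" by simp
    then show ?thesis by (simp only: interval_lebesgue_integral_def set_lebesgue_integral_def if_True)
  qed
  also have "\<dots> = 0 - ?F 0"
  proof (rule interval_integral_FTC_integrable[where F="?F"])
    show "(?F has_vector_derivative ?f x) (at x)" for x
    proof (rule has_vector_derivative_real_field)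
      show "((\<lambda>z. - (of_real l / w) * exp (- w * z)) has_field_derivative ?f x) (at (of_real x))"
        using w0 by (auto intro!: derivative_eq_intros)
    qed
    show "isCont ?f x" for x by (intro continuous_intros)
    show "set_integrable lborel (einterval 0 \<infinity>) ?f" by (rule si)
    have "(?F \<longlongrightarrow> ?F 0) (at_right 0)"
      by (intro continuous_intros tendsto_intros)
    then show "((?F \<circ> real_of_ereal) \<longlongrightarrow> ?F 0) (at_right 0)"
      unfolding zero_ereal_def ereal_tendsto_simps .
    have "((\<lambda>x. norm (?F x)) \<longlongrightarrow> 0) at_top"
    proof -
      have "norm (?F x) = l / norm w * exp (- l * x)" for x
        using l Rew by (simp add: norm_mult norm_divide norm_exp_eq_Re)
      moreover have "((\<lambda>x. l / norm w * exp (- l * x)) \<longlongrightarrow> l / norm w * 0) at_top"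
        using l by (intro tendsto_mult tendsto_const) real_asymp
      ultimately show ?thesis by simp
    qed
    then have "(?F \<longlongrightarrow> 0) at_top" by (rule tendsto_norm_zero_cancel)
    then show "((?F \<circ> real_of_ereal) \<longlongrightarrow> 0) (at_left \<infinity>)" unfolding ereal_tendsto_simps .
  qed auto
  finally show ?thesis by (simp add: w_def)
qed


lemma one_minus_iexp_over:
  assumes a: "a \<longlonglongrightarrow> 0" "\<And>n. 0 < a n"
  shows "(\<lambda>n. (1 - iexp (x * a n)) / of_real (a n)) \<longlonglongrightarrow> - (\<i> * of_real x)"
proof -
  have "(\<lambda>n. x\<^sup>2 * a n / 2) \<longlonglongrightarrow> x\<^sup>2 * 0 / 2" by (intro tendsto_intros a) simp
  then have lim: "(\<lambda>n. x\<^sup>2 * a n / 2) \<longlonglongrightarrow> 0" by simp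
  have "(\<lambda>n. (1 - iexp (x * a n)) / of_real (a n) - - (\<i> * of_real x)) \<longlonglongrightarrow> 0"
  proof (rule Lim_null_comparison[OF _ lim], intro always_eventually allI)
    fix n
    have "cmod (iexp (x * a n) - (1 + \<i> * (x * a n))) \<le> (x * a n)\<^sup>2 / 2"
      using iexp_approx1[of "x * a n" 1] by (simp add: numeral_2_eq_2)
    then have "cmod (iexp (x * a n) - (1 + \<i> * (x * a n))) / a n \<le> (x * a n)\<^sup>2 / 2 / a n"
      using a(2)[of n] by (intro divide_right_mono) auto
    moreover have "(1 - iexp (x * a n)) / of_real (a n) - - (\<i> * of_real x) = - ((iexp (x * a n) - (1 + \<i> * (x * a n))) / of_real (a n))"
      using a(2)[of n] by (simp add: field_simps)
    moreover have "(x * a n)\<^sup>2 / 2 / a n = x\<^sup>2 * a n / 2" using a(2)[of n] by (simp add: power2_eq_square)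
    ultimately show "norm ((1 - iexp (x * a n)) / of_real (a n) - - (\<i> * of_real x)) \<le> x\<^sup>2 * a n / 2"
      using a(2)[of n] by (simp only: norm_minus_cancel norm_divide norm_of_real abs_of_pos)
  qed
  then show ?thesis by (rule LIM_zero_cancel)
qed

lemma one_minus_iexp_bound: "cmod (1 - iexp x) \<le> \<bar>x\<bar>"
  using iexp_approx1[of x 0] by (simp add: norm_minus_commute)

lemma renewal_generating_function:
  fixes v u d :: "nat \<Rightarrow> real" and z :: complex
  assumes ren: "\<And>m. v m = u m + (\<Sum>k<m. d k * v (m - Suc k))"
    and v: "summable v" "\<And>m. 0 \<le> v m" and u: "summable u" "\<And>m. 0 \<le> u m"
    and d: "summable d" "\<And>k. 0 \<le> d k" and z: "cmod z \<le> 1"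
  shows "(\<Sum>m. of_real (v m) * z ^ m) * (1 - (\<Sum>k. of_real (d k) * z ^ Suc k)) = (\<Sum>m. of_real (u m) * z ^ m)"
proof -
  have nle: "norm (of_real x * z ^ m) \<le> x" if "0 \<le> x" for x :: real and m
    using that z power_le_one[of "cmod z" m] by (simp add: norm_mult norm_power mult_left_le)
  have sv: "summable (\<lambda>m. norm (of_real (v m) * z ^ m))"
    by (rule summable_comparison_test[OF _ v(1)]) (use nle v(2) in auto)
  have su: "summable (\<lambda>m. norm (of_real (u m) * z ^ m))"
    by (rule summable_comparison_test[OF _ u(1)]) (use nle u(2) in auto)
  have sd: "summable (\<lambda>k. norm (of_real (d k) * z ^ Suc k))"
    by (rule summable_comparison_test[OF _ d(1)]) (use nle[OF d(2)] in \<open>simp del: power_Suc\<close>)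
  \<comment> \<open>Shifting \<open>d\<close> by one index makes the convolution with
    \<open>m - Suc k\<close> a plain Cauchy product.\<close>
  define D where "D j = (case j of 0 \<Rightarrow> 0 | Suc k \<Rightarrow> of_real (d k) * z ^ Suc k)" for j
  have sD: "summable (\<lambda>j. norm (D j))"
    using sd by (subst summable_Suc_iff[symmetric]) (simp add: D_def)
  have D: "(\<Sum>j. D j) = (\<Sum>k. of_real (d k) * z ^ Suc k)"
    using suminf_split_head[OF summable_norm_cancel[OF sD]] by (simp add: D_def del: power_Suc)
  have conv: "of_real (v m) * z ^ m = of_real (u m) * z ^ m + (\<Sum>i\<le>m. D i * (of_real (v (m - i)) * z ^ (m - i)))" for m
  proof -
    have "(\<Sum>i\<le>m. D i * (of_real (v (m - i)) * z ^ (m - i))) = (\<Sum>k<m. D (Suc k) * (of_real (v (m - Suc k)) * z ^ (m - Suc k)))"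
      by (simp only: lessThan_Suc_atMost[symmetric] sum.lessThan_Suc_shift) (simp add: D_def)
    also have "\<dots> = (\<Sum>k<m. of_real (d k * v (m - Suc k)) * z ^ m)"
    proof (intro sum.cong refl)
      fix k assume "k \<in> {..<m}"
      then have "z ^ Suc k * z ^ (m - Suc k) = z ^ m" by (simp only: power_add[symmetric]) auto
      then show "D (Suc k) * (of_real (v (m - Suc k)) * z ^ (m - Suc k)) = of_real (d k * v (m - Suc k)) * z ^ m"
        by (simp add: D_def ac_simps)
    qed
    also have "\<dots> = of_real (\<Sum>k<m. d k * v (m - Suc k)) * z ^ m" by (simp add: sum_distrib_right)
    finally show ?thesis by (subst ren[of m]) (simp add: distrib_right)
  qed
  have "(\<lambda>m. \<Sum>i\<le>m. D i * (of_real (v (m - i)) * z ^ (m - i))) sums ((\<Sum>j. D j) * (\<Sum>m. of_real (v m) * z ^ m))"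
    by (rule Cauchy_product_sums[OF sD sv])
  from sums_add[OF summable_sums[OF summable_norm_cancel[OF su]] this]
  have "(\<lambda>m. of_real (v m) * z ^ m) sums ((\<Sum>m. of_real (u m) * z ^ m) + (\<Sum>j. D j) * (\<Sum>m. of_real (v m) * z ^ m))"
    unfolding conv[symmetric] .
  from sums_unique[OF this] show ?thesis unfolding D by (simp add: algebra_simps)
qed

text \<open>The convolution contributes at most the total of \<open>d\<close> times the partial sum
  of \<open>v\<close>. As this total is below 1, it can be absorbed on the left.\<close>

lemma renewal_summable:
  fixes v u d :: "nat \<Rightarrow> real"
  assumes ren: "\<And>m. v m = u m + (\<Sum>k<m. d k * v (m - Suc k))"
    and v: "\<And>m. 0 \<le> v m" and u: "summable u" "\<And>m. 0 \<le> u m"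
    and d: "summable d" "\<And>k. 0 \<le> d k" "(\<Sum>k. d k) < 1"
  shows "summable v"
proof -
  have "(\<Sum>m\<le>N. v m) \<le> (\<Sum>m. u m) / (1 - (\<Sum>k. d k))" for N
  proof -
    let ?V = "\<Sum>m\<le>N. v m"
    have V0: "0 \<le> ?V" by (simp add: v sum_nonneg)
    have "(\<Sum>m\<le>N. \<Sum>k<m. d k * v (m - Suc k)) = (\<Sum>k<N. \<Sum>m=Suc k..N. d k * v (m - Suc k))"
      by (rule sum.nested_swap')
    also have "\<dots> \<le> (\<Sum>k<N. d k * ?V)"
    proof (rule sum_mono)
      fix k
      have "(\<Sum>m=Suc k..N. v (m - Suc k)) = sum v ((\<lambda>m. m - Suc k) ` {Suc k..N})"
        by (subst sum.reindex) (auto simp: inj_on_def)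
      also have "\<dots> \<le> ?V" by (rule sum_mono2) (auto simp: v)
      finally show "(\<Sum>m=Suc k..N. d k * v (m - Suc k)) \<le> d k * ?V"
        unfolding sum_distrib_left[symmetric] by (intro mult_left_mono d)
    qed
    also have "\<dots> = (\<Sum>k<N. d k) * ?V" by (simp add: sum_distrib_right)
    also have "\<dots> \<le> (\<Sum>k. d k) * ?V" by (intro mult_right_mono sum_le_suminf d V0) (auto simp: d)
    finally have c: "(\<Sum>m\<le>N. \<Sum>k<m. d k * v (m - Suc k)) \<le> (\<Sum>k. d k) * ?V" .
    have "?V = (\<Sum>m\<le>N. u m) + (\<Sum>m\<le>N. \<Sum>k<m. d k * v (m - Suc k))"
      by (subst ren) (simp add: sum.distrib)
    moreover have "(\<Sum>m\<le>N. u m) \<le> (\<Sum>m. u m)" by (intro sum_le_suminf u) (auto simp: u)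
    ultimately have "?V * (1 - (\<Sum>k. d k)) \<le> (\<Sum>m. u m)" using c by (simp add: algebra_simps)
    then show ?thesis using d(3) by (simp add: pos_le_divide_eq)
  qed
  moreover have "(\<Sum>m<N. v m) \<le> (\<Sum>m\<le>N. v m)" for N by (rule sum_mono2) (auto simp: v)
  ultimately have "(\<Sum>m<N. v m) \<le> (\<Sum>m. u m) / (1 - (\<Sum>k. d k))" for N by (rule order_trans[rotated])
  with v show ?thesis by (rule summableI_nonneg_bounded)
qed

lemma renewal_mean:
  fixes v u d :: "nat \<Rightarrow> real"
  assumes ren: "\<And>m. v m = u m + (\<Sum>k<m. d k * v (m - Suc k))"
    and v: "\<And>m. 0 \<le> v m" and u: "summable u" "\<And>m. 0 \<le> u m"
    and d: "summable d" "\<And>k. 0 \<le> d k" "(\<Sum>k. d k) < 1"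
  shows "(\<Sum>m. v m) = (\<Sum>m. u m) / (1 - (\<Sum>k. d k))"
proof -
  have sv: "summable v" by (rule renewal_summable) (fact assms)+
  have "(\<Sum>m. of_real (v m) * 1 ^ m) * (1 - (\<Sum>k. of_real (d k) * 1 ^ Suc k)) = (\<Sum>m. of_real (u m) * 1 ^ m :: complex)"
    by (rule renewal_generating_function[OF ren sv v u d(1,2)]) simp
  then have "complex_of_real ((\<Sum>m. v m) * (1 - (\<Sum>k. d k))) = of_real (\<Sum>m. u m)"
    using sv u(1) d(1) by (simp add: suminf_of_real)
  then have "(\<Sum>m. v m) * (1 - (\<Sum>k. d k)) = (\<Sum>m. u m)" by (simp only: of_real_eq_iff)
  then show ?thesis using d(3) by (simp add: field_simps)
qed

text \<open>The continuity theorem needs actual distributions. Reading \<open>v m\<close> as the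
  probability that a time exceeds \<open>m\<close>, the drop from \<open>v m\<close> to
  \<open>v (Suc m)\<close> is the mass at \<open>m + 1\<close>, and 0 has none.\<close>

lemma pmf_of_survival:
  fixes v :: "nat \<Rightarrow> real"
  assumes v0: "v 0 = 1" and v: "decseq v" and lim: "v \<longlonglongrightarrow> 0"
  obtains p :: "nat pmf" where "pmf p 0 = 0" "\<And>m. pmf p (Suc m) = v m - v (Suc m)"
proof -
  define f where "f m = (case m of 0 \<Rightarrow> 0 | Suc k \<Rightarrow> v k - v (Suc k))" for m
  have f0: "0 \<le> f m" for m using v by (auto simp: f_def decseq_Suc_iff split: nat.split)
  have "(\<lambda>m. f (Suc m)) sums 1" using telescope_sums'[OF lim] by (simp add: f_def v0)
  then have "f sums 1" by (subst (asm) sums_Suc_iff) (simp add: f_def)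
  then have "(\<integral>\<^sup>+m. ennreal (f m) \<partial>count_space UNIV) = 1"
    using suminf_ennreal_eq[OF f0] by (simp add: nn_integral_count_space_nat)
  then have "pmf (embed_pmf f) m = f m" for m using f0 by (intro pmf_embed_pmf)
  then show ?thesis using that[of "embed_pmf f"] by (simp add: f_def)
qed

lemma cdf_of_survival:
  fixes v :: "nat \<Rightarrow> real"
  assumes v0: "v 0 = 1" and p: "pmf p 0 = 0" "\<And>m. pmf p (Suc m) = v m - v (Suc m)" and a: "0 < a" and y: "0 \<le> y"
  shows "cdf (distr (measure_pmf p) borel (\<lambda>m. a * real m)) y = 1 - v (nat \<lfloor>y / a\<rfloor>)"
proof -
  let ?N = "nat \<lfloor>y / a\<rfloor>"
  have "(\<lambda>m. a * real m) -` {..y} = {..?N}"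
  proof (rule set_eqI)
    fix m
    have "a * real m \<le> y \<longleftrightarrow> real m \<le> y / a" using a by (simp add: field_simps)
    also have "\<dots> \<longleftrightarrow> m \<le> ?N" using a y by (simp add: le_nat_iff le_floor_iff)
    finally show "m \<in> (\<lambda>m. a * real m) -` {..y} \<longleftrightarrow> m \<in> {..?N}" by simp
  qed
  then have "cdf (distr (measure_pmf p) borel (\<lambda>m. a * real m)) y = measure (measure_pmf p) {..?N}"
    unfolding cdf_def by (subst measure_distr) auto
  also have "\<dots> = (\<Sum>m\<le>?N. pmf p m)" by (rule measure_measure_pmf_finite) simp
  also have "(\<Sum>m\<le>N. pmf p m) = 1 - v N" for N by (induction N) (auto simp: p v0)
  finally show ?thesis .
qed

text \<open>Summation by parts for the generating function at the unimodular point
  \<open>z = iexp (s * a)\<close>; it expresses the characteristic function through the series that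
  the renewal equation determines.\<close>

lemma char_of_survival:
  fixes v :: "nat \<Rightarrow> real"
  assumes v: "decseq v" "summable v" "v 0 = 1" and p: "pmf p 0 = 0" "\<And>m. pmf p (Suc m) = v m - v (Suc m)"
  shows "char (distr (measure_pmf p) borel (\<lambda>m. a * real m)) s =
    1 - (1 - iexp (s * a)) * (\<Sum>m. of_real (v m) * iexp (s * a) ^ m)"
proof -
  define z where "z = iexp (s * a)"
  have zp: "iexp (s * (a * real m)) = z ^ m" for m
    unfolding z_def by (simp add: exp_of_nat_mult[symmetric] algebra_simps)
  have nz: "norm (z ^ m) = 1" for m by (simp add: norm_power z_def)
  have v0: "0 \<le> v m" for m
    using decseq_ge[OF v(1) summable_LIMSEQ_zero[OF v(2)]] .
  have sv: "summable (\<lambda>m. of_real (v m) * z ^ m)"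
    by (rule summable_norm_cancel, rule summable_comparison_test[OF _ v(2)]) (use v0 nz in \<open>auto simp: norm_mult\<close>)
  have sp: "summable (\<lambda>m. norm (of_real (pmf p m) * z ^ m))"
  proof -
    have "summable (\<lambda>m. pmf p (Suc m))" unfolding p using v(2) by (intro summable_diff) (simp_all add: summable_Suc_iff)
    then have "summable (pmf p)" by (simp only: summable_Suc_iff)
    then show ?thesis by (simp add: norm_mult nz)
  qed
  have "char (distr (measure_pmf p) borel (\<lambda>m. a * real m)) s = (CLINT m|measure_pmf p. iexp (s * (a * real m)))"
    unfolding char_def by (rule integral_distr) auto
  also have "\<dots> = (CLINT m|measure_pmf p. z ^ m)" by (simp only: zp)
  also have "\<dots> = (CLINT m|count_space UNIV. pmf p m *\<^sub>R z ^ m)"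
    unfolding measure_pmf_eq_density by (subst integral_density) auto
  also have "\<dots> = (\<Sum>m. of_real (pmf p m) * z ^ m)"
    using sp by (subst integral_count_space_nat) (auto simp: integrable_count_space_nat_iff scaleR_conv_of_real)
  also have "\<dots> = (\<Sum>m. of_real (pmf p (Suc m)) * z ^ Suc m)"
    using suminf_split_head[OF summable_norm_cancel[OF sp]] by (simp add: p(1) del: power_Suc)
  also have "\<dots> = (\<Sum>m. z * (of_real (v m) * z ^ m) - of_real (v (Suc m)) * z ^ Suc m)"
    by (simp add: p algebra_simps)
  also have "\<dots> = z * (\<Sum>m. of_real (v m) * z ^ m) - (\<Sum>m. of_real (v (Suc m)) * z ^ Suc m)"
    using sv summable_ignore_initial_segment[OF sv, of 1]
    by (subst suminf_diff[symmetric]) (auto simp: suminf_mult intro!: summable_mult)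
  also have "(\<Sum>m. of_real (v (Suc m)) * z ^ Suc m) = (\<Sum>m. of_real (v m) * z ^ m) - 1"
    using suminf_split_head[OF sv] by (simp add: v(3) del: power_Suc)
  finally show ?thesis unfolding z_def[symmetric] by (simp add: algebra_simps)
qed

text \<open>The renewal equation gives the characteristic function of the survival time in closed form,
  and continuity of characteristic functions finishes the proof.\<close>
lemma renewal_exponential_limit:
  fixes v u d :: "nat \<Rightarrow> nat \<Rightarrow> real" and t q a :: "nat \<Rightarrow> real"
  assumes ren: "\<And>n m. v n m = u n m + (\<Sum>k<m. d n k * v n (m - Suc k))"
    and v: "\<And>n. v n 0 = 1" "\<And>n. decseq (v n)" "\<And>n m. 0 \<le> v n m"
    and u: "\<And>n m. 0 \<le> u n m" "\<And>n m. u n m \<le> t m" "\<And>m. (\<lambda>n. u n m) \<longlonglongrightarrow> t m"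
    and t: "summable t"
    and d: "\<And>n k. 0 \<le> d n k" "\<And>n k. d n k \<le> q k" "\<And>k. (\<lambda>n. d n k) \<longlonglongrightarrow> q k"
    and q: "(\<lambda>k. real (Suc k) * q k) sums (\<Sum>m. t m)"
    and a: "a \<longlonglongrightarrow> 0" "\<And>n. 0 < a n"
    and p: "\<And>n. (\<Sum>k. d n k) < 1" "(\<lambda>n. (1 - (\<Sum>k. d n k)) / a n) \<longlonglongrightarrow> c"
    and c: "0 < c" and \<theta>: "0 < (\<Sum>m. t m)" and y: "0 < y"
  shows "(\<lambda>n. v n (nat \<lfloor>y / a n\<rfloor>)) \<longlonglongrightarrow> exp (- (c / (\<Sum>m. t m)) * y)"
proof -
  let ?\<theta> = "\<Sum>m. t m"
  let ?l = "c / ?\<theta>"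
  let ?M = "density lborel (\<lambda>x. ennreal (exponential_density ?l x))"
  have l: "0 < ?l" using c \<theta> by simp
  have su: "summable (u n)" for n by (rule summable_comparison_test[OF _ t]) (use u in auto)
  have sqk: "summable (\<lambda>k. real (Suc k) * q k)" using q by (rule sums_summable)
  have q0: "0 \<le> q k" for k using d(1,2) order_trans by blast
  have "norm (q k) \<le> real (Suc k) * q k" for k
    using mult_right_mono[of 1 "real (Suc k)" "q k"] q0[of k] by simp
  then have sq: "summable q" by (intro summable_comparison_test[OF _ sqk]) auto
  have sd: "summable (d n)" for n by (rule summable_comparison_test[OF _ sq]) (use d in auto)
  have sv: "summable (v n)" for n by (rule renewal_summable[OF ren v(3) su u(1) sd d(1) p(1)])
  have v0: "v n \<longlonglongrightarrow> 0" for n using sv by (rule summable_LIMSEQ_zero)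
  have "\<exists>P::nat pmf. pmf P 0 = 0 \<and> (\<forall>m. pmf P (Suc m) = v n m - v n (Suc m))" for n
    using pmf_of_survival[OF v(1,2) v0, of n] by metis
  then obtain P :: "nat \<Rightarrow> nat pmf" where P: "\<And>n. pmf (P n) 0 = 0" "\<And>n m. pmf (P n) (Suc m) = v n m - v n (Suc m)"
    by metis
  define N where "N n = distr (measure_pmf (P n)) borel (\<lambda>m. a n * real m)" for n
  have N: "real_distribution (N n)" for n
    unfolding N_def by (rule prob_space.real_distribution_distr) (auto intro: measure_pmf.prob_space_axioms)
  interpret M: prob_space ?M using l by (rule prob_space_exponential_density)
  have M: "real_distribution ?M"
    by (intro real_distribution.intro M.prob_space_axioms real_distribution_axioms.intro) auto
  have conv: "(\<lambda>n. char (N n) s) \<longlonglongrightarrow> char ?M s" for s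
  proof -
    define z where "z n = iexp (s * a n)" for n
    have zn: "cmod (z n) = 1" for n by (simp add: z_def)
    have z1: "z \<longlonglongrightarrow> 1"
    proof -
      have "(\<lambda>n. iexp (s * a n)) \<longlonglongrightarrow> exp (\<i> * of_real (s * 0))" by (intro tendsto_intros a)
      then show ?thesis unfolding z_def by simp
    qed
    have zk: "(\<lambda>n. z n ^ k) \<longlonglongrightarrow> 1" for k using tendsto_power[OF z1, of k] by simp
    define U where "U n = (\<Sum>m. of_real (u n m) * z n ^ m)" for n
    define V where "V n = (\<Sum>m. of_real (v n m) * z n ^ m)" for n
    define F where "F n = (1 - (\<Sum>k. of_real (d n k) * z n ^ Suc k))" for n
    have VF: "V n * F n = U n" for n
      unfolding V_def F_def U_def
      by (rule renewal_generating_function[OF ren sv v(3) su u(1) sd d(1)]) (simp add: zn)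
    have Ulim: "U \<longlonglongrightarrow> of_real ?\<theta>"
    proof -
      have "(\<lambda>n. \<Sum>m. of_real (u n m) * z n ^ m) \<longlonglongrightarrow> (\<Sum>m. complex_of_real (t m))"
      proof (rule tendsto_suminf_dominated[OF _ _ t])
        show "(\<lambda>n. of_real (u n m) * z n ^ m) \<longlonglongrightarrow> complex_of_real (t m)" for m
          using tendsto_mult[OF tendsto_of_real[OF u(3)] zk] by simp
        show "cmod (of_real (u n m) * z n ^ m) \<le> t m" for n m
          using u(1,2)[of n m] by (simp add: norm_mult norm_power zn)
      qed
      then show ?thesis unfolding U_def suminf_of_real[OF t] .
    qed
    \<comment> \<open>\<open>F n\<close> is split into the defect
      \<open>1 - (\<Sum>k. d n k)\<close> and the sum of \<open>d n k * (1 - z n ^ Suc k)\<close>.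
      Divided by \<open>a n\<close>, the first tends to \<open>c\<close> and the second, by
      first-order expansion, to \<open>- \<i> * s\<close> times the mean cycle length.\<close>
    have Flim: "(\<lambda>n. F n / of_real (a n)) \<longlonglongrightarrow> of_real c - \<i> * of_real (s * ?\<theta>)"
    proof -
      have zb: "cmod (1 - z n ^ Suc k) \<le> \<bar>s\<bar> * a n * real (Suc k)" for n k
      proof -
        have "z n ^ Suc k = iexp (s * (a n * real (Suc k)))"
          unfolding z_def exp_of_nat_mult[symmetric] by (simp add: algebra_simps)
        then show ?thesis using one_minus_iexp_bound[of "s * (a n * real (Suc k))"] a(2)[of n]
          by (simp only: abs_mult abs_of_nat abs_of_pos mult.assoc)
      qed
      have "(\<lambda>n. \<Sum>k. of_real (d n k) * ((1 - z n ^ Suc k) / of_real (a n))) \<longlonglongrightarrow> (\<Sum>k. of_real (q k) * - (\<i> * of_real (s * real (Suc k))))"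
      proof (rule tendsto_suminf_dominated)
        show "summable (\<lambda>k. \<bar>s\<bar> * (real (Suc k) * q k))" using sqk by (rule summable_mult)
        show "(\<lambda>n. of_real (d n k) * ((1 - z n ^ Suc k) / of_real (a n))) \<longlonglongrightarrow> of_real (q k) * - (\<i> * of_real (s * real (Suc k)))" for k
        proof (intro tendsto_mult tendsto_of_real d(3))
          have "z n ^ Suc k = iexp (s * real (Suc k) * a n)" for n
            unfolding z_def exp_of_nat_mult[symmetric] by (simp add: algebra_simps)
          then show "(\<lambda>n. (1 - z n ^ Suc k) / of_real (a n)) \<longlonglongrightarrow> - (\<i> * of_real (s * real (Suc k)))"
            using one_minus_iexp_over[OF a, of "s * real (Suc k)"] by simp
        qed
        show "cmod (of_real (d n k) * ((1 - z n ^ Suc k) / of_real (a n))) \<le> \<bar>s\<bar> * (real (Suc k) * q k)" for n k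
        proof -
          have "cmod ((1 - z n ^ Suc k) / of_real (a n)) \<le> \<bar>s\<bar> * real (Suc k)"
            using zb[of n k] a(2)[of n] by (simp add: norm_divide pos_divide_le_eq ac_simps del: power_Suc of_nat_Suc)
          then have "d n k * cmod ((1 - z n ^ Suc k) / of_real (a n)) \<le> q k * (\<bar>s\<bar> * real (Suc k))"
            using d(1,2)[of n k] q0[of k] by (intro mult_mono) auto
          moreover have "cmod (of_real (d n k) * ((1 - z n ^ Suc k) / of_real (a n))) = d n k * cmod ((1 - z n ^ Suc k) / of_real (a n))"
            using d(1)[of n k] by (simp only: norm_mult norm_of_real abs_of_nonneg)
          ultimately show ?thesis by (simp only: ac_simps)
        qed
      qed
      moreover have "(\<Sum>k. of_real (q k) * - (\<i> * of_real (s * real (Suc k)))) = - \<i> * of_real (s * ?\<theta>)"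
      proof -
        have "(\<lambda>k. - \<i> * of_real s * complex_of_real (real (Suc k) * q k)) sums (- \<i> * of_real s * complex_of_real ?\<theta>)"
          using q by (intro sums_mult) (simp only: sums_of_real_iff)
        moreover have "- \<i> * of_real s * complex_of_real (real (Suc k) * q k) = of_real (q k) * - (\<i> * of_real (s * real (Suc k)))" for k
          by (simp only: of_real_mult) (simp add: ac_simps)
        ultimately show ?thesis by (simp add: sums_unique[symmetric] ac_simps)
      qed
      ultimately have lim1: "(\<lambda>n. of_real ((1 - (\<Sum>k. d n k)) / a n) + (\<Sum>k. of_real (d n k) * ((1 - z n ^ Suc k) / of_real (a n))))
        \<longlonglongrightarrow> of_real c + - \<i> * of_real (s * ?\<theta>)"
        by (intro tendsto_add tendsto_of_real p(2)) simp
      have "of_real ((1 - (\<Sum>k. d n k)) / a n) + (\<Sum>k. of_real (d n k) * ((1 - z n ^ Suc k) / of_real (a n))) = F n / of_real (a n)" for n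
      proof -
        have s1: "summable (\<lambda>k. complex_of_real (d n k))" using sd[of n] by (simp add: summable_of_real)
        have s2: "summable (\<lambda>k. of_real (d n k) * z n ^ Suc k)"
          by (rule summable_norm_cancel) (use sd[of n] d(1) in \<open>simp add: norm_mult norm_power zn del: power_Suc\<close>)
        have "(\<Sum>k. of_real (d n k) * ((1 - z n ^ Suc k) / of_real (a n))) =
          (\<Sum>k. (of_real (d n k) - of_real (d n k) * z n ^ Suc k) / of_real (a n))"
          by (intro suminf_cong) (simp add: algebra_simps)
        also have "\<dots> = ((\<Sum>k. of_real (d n k)) - (\<Sum>k. of_real (d n k) * z n ^ Suc k)) / of_real (a n)"
          by (subst suminf_divide[OF summable_diff[OF s1 s2]], subst suminf_diff[OF s1 s2]) (rule refl)
        finally show ?thesis unfolding F_def using suminf_of_real[OF sd[of n], where 'a=complex]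
          by (simp add: diff_divide_distrib del: power_Suc)
      qed
      then show ?thesis using lim1 by simp
    qed
    let ?w = "of_real c - \<i> * of_real (s * ?\<theta>) :: complex"
    have w0: "?w \<noteq> 0" using c by (auto simp: complex_eq_iff)
    have Fn0: "F n \<noteq> 0" for n
    proof
      assume "F n = 0"
      then have "(\<Sum>k. of_real (d n k) * z n ^ Suc k) = 1" by (simp add: F_def)
      moreover have "cmod (\<Sum>k. of_real (d n k) * z n ^ Suc k) \<le> (\<Sum>k. d n k)"
        by (rule norm_suminf_le[OF _ sd]) (use d(1) in \<open>simp add: norm_mult norm_power zn del: power_Suc\<close>)
      ultimately show False using p(1)[of n] by simp
    qed
    have "char (N n) s = 1 - (1 - z n) / of_real (a n) * (U n / (F n / of_real (a n)))" for n
    proof -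
      have "V n = U n / F n" using VF[of n] Fn0[of n] by (simp add: field_simps)
      then have "V n = U n / (F n / of_real (a n)) / of_real (a n)" using a(2)[of n] by simp
      then show ?thesis unfolding N_def V_def
        by (subst char_of_survival[OF v(2) sv v(1) P]) (simp add: z_def)
    qed
    moreover have "(\<lambda>n. 1 - (1 - z n) / of_real (a n) * (U n / (F n / of_real (a n)))) \<longlonglongrightarrow> 1 - - (\<i> * of_real s) * (of_real ?\<theta> / ?w)"
      unfolding z_def using w0 by (intro tendsto_intros one_minus_iexp_over[OF a] Ulim Flim)
    \<comment> \<open>The limit simplifies to \<open>c\<close> over \<open>c\<close> minus
      \<open>\<i> * s\<close> times the mean cycle length, the characteristic function of an
      exponential law whose rate is \<open>c\<close> divided by that length.\<close>
    moreover have "1 - - (\<i> * of_real s) * (of_real ?\<theta> / ?w) = of_real ?l / (of_real ?l - \<i> * of_real s)"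
    proof -
      have \<theta>0: "complex_of_real ?\<theta> \<noteq> 0" using \<theta> by simp
      have "of_real ?l - \<i> * of_real s = ?w / of_real ?\<theta>" using \<theta>0 by (simp add: field_simps)
      then have "of_real ?l / (of_real ?l - \<i> * of_real s) = of_real c / ?w" using \<theta>0 by simp
      also have "\<dots> = 1 - - (\<i> * of_real s) * (of_real ?\<theta> / ?w)" using w0 by (simp add: field_simps)
      finally show ?thesis by simp
    qed
    ultimately show ?thesis unfolding char_exponential[OF l] by simp
  qed
  have "weak_conv_m N ?M" using N M conv by (rule levy_continuity)
  \<comment> \<open>Weak convergence yields distribution functions at continuity points only; the
    limit law has no atoms.\<close>
  moreover have "isCont (cdf ?M) y"
  proof -
    interpret RM: real_distribution ?M by (rule M)
    have "emeasure ?M {y} = (\<integral>\<^sup>+x. ennreal (exponential_density ?l x) * indicator {y} x \<partial>lborel)"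
      by (rule emeasure_density) auto
    also have "\<dots> = 0" by (rule nn_integral_null_set) (simp add: null_sets_def)
    finally show ?thesis unfolding RM.isCont_cdf measure_def by simp
  qed
  ultimately have "(\<lambda>n. cdf (N n) y) \<longlonglongrightarrow> cdf ?M y" by (simp add: weak_conv_m_def weak_conv_def)
  moreover have "cdf (N n) y = 1 - v n (nat \<lfloor>y / a n\<rfloor>)" for n
    unfolding N_def using cdf_of_survival[OF v(1) P a(2), of y n n] y by simp
  moreover have "cdf ?M y = 1 - exp (- ?l * y)"
  proof -
    have "emeasure ?M {..y} = ennreal (erlang_CDF 0 ?l y)" using l y by (intro emeasure_erlang_density) auto
    moreover have "0 \<le> 1 - exp (- ?l * y)"
    proof -
      have "- ?l * y \<le> 0" using mult_pos_pos[OF l y] unfolding mult_minus_left by (simp only: neg_le_0_iff_le less_imp_le)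
      then have "exp (- ?l * y) \<le> 1" by (simp only: exp_le_one_iff)
      then show ?thesis by (simp only: diff_ge_0_iff_ge)
    qed
    moreover have "erlang_CDF 0 ?l y = 1 - exp (- ?l * y)" using y by (simp add: erlang_CDF_def)
    ultimately show ?thesis unfolding cdf_def measure_def by (simp only: enn2real_ennreal)
  qed
  ultimately have lim: "(\<lambda>n. 1 - v n (nat \<lfloor>y / a n\<rfloor>)) \<longlonglongrightarrow> 1 - exp (- ?l * y)"
    by (simp only:)
  show ?thesis using tendsto_diff[OF tendsto_const[of 1] lim] by simp
qed

section \<open>Two-state Markov chains\<close>

lemma sums_from_Suc:
  fixes f :: "nat \<Rightarrow> real"
  assumes "f 0 = 0" "(\<lambda>n. f (Suc n)) sums s"
  shows "f sums s"
  using sums_Suc[OF assms(2)] assms(1) by simp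

locale two_state_chain = prob_space M for M :: "'a measure" +
  fixes \<xi> :: "nat \<Rightarrow> 'a \<Rightarrow> nat" and \<alpha> \<beta> :: real
  assumes chain: "markov_chain M {0, 1} (two_state_matrix \<alpha> \<beta>) \<xi>"
    and start: "AE \<omega> in M. \<xi> 0 \<omega> = 1"
    and \<alpha>: "0 < \<alpha>" "\<alpha> < 1" and \<beta>: "0 < \<beta>" "\<beta> < 1"
begin

lemma xi_measurable [measurable]: "\<xi> n \<in> measurable M (count_space UNIV)"
  using chain by (simp add: markov_chain_def)

lemma xi_range: "\<omega> \<in> space M \<Longrightarrow> \<xi> n \<omega> = 0 \<or> \<xi> n \<omega> = 1"
  using chain by (auto simp: markov_chain_def)

text \<open>\<open>markov_chain\<close> conditions on single complete histories. The event
  \<open>R\<close> together with the current state is a finite disjoint union of histories up to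
  time \<open>n\<close>, all ending in \<open>s\<close>, so the transition probability factors out
  of the sum.\<close>

lemma markov_step:
  assumes dep: "\<And>x y. (\<And>k. k \<le> n \<Longrightarrow> x k = y k) \<Longrightarrow> R x = R y" and s': "s' \<in> {0, 1}"
  shows "prob {\<omega> \<in> space M. R (\<lambda>k. \<xi> k \<omega>) \<and> \<xi> n \<omega> = s \<and> \<xi> (Suc n) \<omega> = s'} =
    two_state_matrix \<alpha> \<beta> s s' * prob {\<omega> \<in> space M. R (\<lambda>k. \<xi> k \<omega>) \<and> \<xi> n \<omega> = s}"
proof -
  define H where "H = {h \<in> PiE {..n} (\<lambda>_. {0, 1}). R h \<and> h n = s}"
  define E where "E h = {\<omega> \<in> space M. \<forall>k\<le>n. \<xi> k \<omega> = h k}" for h :: "nat \<Rightarrow> nat"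
  define E' where "E' h = {\<omega> \<in> space M. \<xi> (Suc n) \<omega> = s' \<and> (\<forall>k\<le>n. \<xi> k \<omega> = h k)}" for h :: "nat \<Rightarrow> nat"
  have Em: "E h \<in> events" "E' h \<in> events" for h unfolding E_def E'_def by measurable
  have finH: "finite H" unfolding H_def by (rule finite_subset[OF _ finite_PiE[of "{..n}" "\<lambda>_. {0, 1::nat}"]]) auto
  have disj: "disjoint_family_on E H"
    unfolding disjoint_family_on_def
  proof (intro ballI impI)
    fix h h' assume h: "h \<in> H" "h' \<in> H" "h \<noteq> h'"
    then obtain k where "k \<le> n" "h k \<noteq> h' k" unfolding H_def by (metis (mono_tags, lifting) PiE_ext atMost_iff mem_Collect_eq)
    then show "E h \<inter> E h' = {}" unfolding E_def by force
  qed
  have "E' h \<subseteq> E h" for h by (auto simp: E_def E'_def)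
  then have disj': "disjoint_family_on E' H" using disj unfolding disjoint_family_on_def by blast
  have hist: "restrict (\<lambda>k. \<xi> k \<omega>) {..n} \<in> H" if "\<omega> \<in> space M" "R (\<lambda>k. \<xi> k \<omega>)" "\<xi> n \<omega> = s" for \<omega>
  proof -
    have "R (restrict (\<lambda>k. \<xi> k \<omega>) {..n}) = R (\<lambda>k. \<xi> k \<omega>)" by (rule dep) simp
    then show ?thesis using that xi_range[OF that(1)] by (auto simp: H_def)
  qed
  have RE: "R (\<lambda>k. \<xi> k \<omega>)" "\<xi> n \<omega> = s" if "h \<in> H" "\<omega> \<in> E h" for h \<omega>
  proof -
    have "R (\<lambda>k. \<xi> k \<omega>) = R h" by (rule dep) (use that in \<open>auto simp: E_def\<close>)
    then show "R (\<lambda>k. \<xi> k \<omega>)" "\<xi> n \<omega> = s" using that by (auto simp: E_def H_def)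
  qed
  have U: "{\<omega> \<in> space M. R (\<lambda>k. \<xi> k \<omega>) \<and> \<xi> n \<omega> = s} = (\<Union>h\<in>H. E h)"
  proof safe
    fix \<omega> assume "\<omega> \<in> space M" "R (\<lambda>k. \<xi> k \<omega>)" "s = \<xi> n \<omega>"
    then show "\<omega> \<in> (\<Union>h\<in>H. E h)" using hist by (intro UN_I[of "restrict (\<lambda>k. \<xi> k \<omega>) {..n}"]) (auto simp: E_def)
  qed (use RE in \<open>auto simp: E_def\<close>)
  have U': "{\<omega> \<in> space M. R (\<lambda>k. \<xi> k \<omega>) \<and> \<xi> n \<omega> = s \<and> \<xi> (Suc n) \<omega> = s'} = (\<Union>h\<in>H. E' h)"
  proof safe
    fix \<omega> assume "\<omega> \<in> space M" "R (\<lambda>k. \<xi> k \<omega>)" "s = \<xi> n \<omega>" "s' = \<xi> (Suc n) \<omega>"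
    then show "\<omega> \<in> (\<Union>h\<in>H. E' h)" using hist by (intro UN_I[of "restrict (\<lambda>k. \<xi> k \<omega>) {..n}"]) (auto simp: E'_def)
  qed (use RE \<open>\<And>h. E' h \<subseteq> E h\<close> in \<open>auto simp: E'_def E_def\<close>)
  have cond: "prob (E' h) = two_state_matrix \<alpha> \<beta> s s' * prob (E h)" if h: "h \<in> H" for h
  proof (cases "0 < prob (E h)")
    case True
    then have "\<P>(\<omega> in M. \<xi> (Suc n) \<omega> = s' \<bar> \<forall>k\<le>n. \<xi> k \<omega> = h k) = two_state_matrix \<alpha> \<beta> (h n) s'"
      using chain s' unfolding markov_chain_def E_def by blast
    then show ?thesis using True h by (simp add: cond_prob_def E_def E'_def H_def field_simps)
  next
    \<comment> \<open>A history of probability 0 has no prescribed conditional probability, but it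
      contributes 0 to both sides.\<close>
    case False
    then have "prob (E h) = 0" by (simp add: zero_less_measure_iff)
    moreover have "prob (E' h) \<le> prob (E h)" using \<open>\<And>h. E' h \<subseteq> E h\<close> Em by (intro finite_measure_mono) auto
    ultimately show ?thesis by (simp add: measure_le_0_iff)
  qed
  have "prob (\<Union>h\<in>H. E' h) = (\<Sum>h\<in>H. prob (E' h))" using Em by (intro finite_measure_finite_Union finH disj') auto
  also have "\<dots> = two_state_matrix \<alpha> \<beta> s s' * (\<Sum>h\<in>H. prob (E h))" by (simp add: cond sum_distrib_left)
  also have "(\<Sum>h\<in>H. prob (E h)) = prob (\<Union>h\<in>H. E h)" using Em by (intro finite_measure_finite_Union[symmetric] finH disj) auto
  finally show ?thesis unfolding U U' .
qed

text \<open>The initial epoch is left out because the statistic receives its first sample at epoch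
  1.\<close>

definition cnt :: "nat \<Rightarrow> 'a \<Rightarrow> nat" where "cnt n \<omega> = (\<Sum>k=1..n. \<xi> k \<omega>)"

lemma cnt_measurable [measurable]: "cnt n \<in> measurable M (count_space UNIV)"
  unfolding cnt_def[abs_def] by measurable

lemma cnt_le: "\<omega> \<in> space M \<Longrightarrow> cnt n \<omega> \<le> n"
proof (induction n)
  case (Suc n)
  then show ?case using xi_range[OF Suc.prems, of "Suc n"] by (auto simp: cnt_def)
qed (simp add: cnt_def)

lemma cnt_Suc: "cnt (Suc n) \<omega> = cnt n \<omega> + \<xi> (Suc n) \<omega>"
  by (simp add: cnt_def)

definition A :: "nat \<Rightarrow> nat \<Rightarrow> real" where "A n m = prob {\<omega> \<in> space M. cnt n \<omega> = m \<and> \<xi> n \<omega> = 1}"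
definition B :: "nat \<Rightarrow> nat \<Rightarrow> real" where "B n m = prob {\<omega> \<in> space M. cnt n \<omega> = m \<and> \<xi> n \<omega> = 0}"

lemma cnt_step:
  assumes "s' \<in> {0, 1}"
  shows "prob {\<omega> \<in> space M. cnt n \<omega> = m \<and> \<xi> n \<omega> = s \<and> \<xi> (Suc n) \<omega> = s'} =
    two_state_matrix \<alpha> \<beta> s s' * prob {\<omega> \<in> space M. cnt n \<omega> = m \<and> \<xi> n \<omega> = s}"
  unfolding cnt_def using assms by (intro markov_step[where R="\<lambda>x. (\<Sum>k=1..n. x k) = m"]) auto

lemma split_state:
  assumes [measurable]: "Measurable.pred M P"
  shows "prob {\<omega> \<in> space M. P \<omega>} = prob {\<omega> \<in> space M. P \<omega> \<and> \<xi> n \<omega> = 1} + prob {\<omega> \<in> space M. P \<omega> \<and> \<xi> n \<omega> = 0}"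
proof -
  have "prob {\<omega> \<in> space M. P \<omega>} = prob ({\<omega> \<in> space M. P \<omega> \<and> \<xi> n \<omega> = 1} \<union> {\<omega> \<in> space M. P \<omega> \<and> \<xi> n \<omega> = 0})"
    by (intro arg_cong[where f=prob] set_eqI) (use xi_range[of _ n] in blast)
  also have "\<dots> = prob {\<omega> \<in> space M. P \<omega> \<and> \<xi> n \<omega> = 1} + prob {\<omega> \<in> space M. P \<omega> \<and> \<xi> n \<omega> = 0}"
    by (rule finite_measure_Union) auto
  finally show ?thesis .
qed

lemma A_Suc_Suc: "A (Suc n) (Suc m) = \<beta> * A n m + (1 - \<alpha>) * B n m"
proof -
  have "A (Suc n) (Suc m) = prob {\<omega> \<in> space M. cnt n \<omega> = m \<and> \<xi> (Suc n) \<omega> = 1}"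
    unfolding A_def by (intro arg_cong[where f=prob]) (auto simp: cnt_Suc)
  also have "\<dots> = prob {\<omega> \<in> space M. (cnt n \<omega> = m \<and> \<xi> (Suc n) \<omega> = 1) \<and> \<xi> n \<omega> = 1} + prob {\<omega> \<in> space M. (cnt n \<omega> = m \<and> \<xi> (Suc n) \<omega> = 1) \<and> \<xi> n \<omega> = 0}"
    by (rule split_state) measurable
  also have "\<dots> = prob {\<omega> \<in> space M. cnt n \<omega> = m \<and> \<xi> n \<omega> = 1 \<and> \<xi> (Suc n) \<omega> = 1} + prob {\<omega> \<in> space M. cnt n \<omega> = m \<and> \<xi> n \<omega> = 0 \<and> \<xi> (Suc n) \<omega> = 1}"
    by (intro arg_cong2[where f="(+)"] arg_cong[where f=prob]) auto
  finally show ?thesis by (simp add: cnt_step two_state_matrix_def A_def B_def)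
qed

lemma A_Suc_0: "A (Suc n) 0 = 0"
proof -
  have "{\<omega> \<in> space M. cnt (Suc n) \<omega> = 0 \<and> \<xi> (Suc n) \<omega> = 1} = {}" by (auto simp: cnt_Suc)
  then show ?thesis unfolding A_def by (simp only: measure_empty)
qed

lemma B_Suc: "B (Suc n) m = (1 - \<beta>) * A n m + \<alpha> * B n m"
proof -
  have "B (Suc n) m = prob {\<omega> \<in> space M. cnt n \<omega> = m \<and> \<xi> (Suc n) \<omega> = 0}"
    unfolding B_def by (intro arg_cong[where f=prob]) (auto simp: cnt_Suc)
  also have "\<dots> = prob {\<omega> \<in> space M. (cnt n \<omega> = m \<and> \<xi> (Suc n) \<omega> = 0) \<and> \<xi> n \<omega> = 1} + prob {\<omega> \<in> space M. (cnt n \<omega> = m \<and> \<xi> (Suc n) \<omega> = 0) \<and> \<xi> n \<omega> = 0}"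
    by (rule split_state) measurable
  also have "\<dots> = prob {\<omega> \<in> space M. cnt n \<omega> = m \<and> \<xi> n \<omega> = 1 \<and> \<xi> (Suc n) \<omega> = 0} + prob {\<omega> \<in> space M. cnt n \<omega> = m \<and> \<xi> n \<omega> = 0 \<and> \<xi> (Suc n) \<omega> = 0}"
    by (intro arg_cong2[where f="(+)"] arg_cong[where f=prob]) auto
  finally show ?thesis by (simp add: cnt_step two_state_matrix_def A_def B_def)
qed

lemma A_0: "A 0 m = (if m = 0 then 1 else 0)"
proof (cases "m = 0")
  case True
  have "prob {\<omega> \<in> space M. \<xi> 0 \<omega> = 1} = 1" using start by (subst prob_Collect_eq_1) auto
  then show ?thesis using True by (simp add: A_def cnt_def)
qed (simp add: A_def cnt_def)

lemma B_0: "B 0 m = 0"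
proof -
  have "AE \<omega> in M. \<not> (cnt 0 \<omega> = m \<and> \<xi> 0 \<omega> = 0)" using start by eventually_elim auto
  then show ?thesis unfolding B_def by (subst prob_Collect_eq_0) auto
qed

lemma A_nonneg: "0 \<le> A n m" and B_nonneg: "0 \<le> B n m"
  by (simp_all add: A_def B_def)

lemma AB_zero: "n < m \<Longrightarrow> A n m = 0 \<and> B n m = 0"
proof -
  assume "n < m"
  then have "{\<omega> \<in> space M. cnt n \<omega> = m \<and> \<xi> n \<omega> = s} = {}" for s using cnt_le[of _ n] by fastforce
  then show ?thesis unfolding A_def B_def by (simp only: measure_empty simp_thms)
qed

text \<open>Almost surely exactly one epoch is the \<open>m\<close>-th activation, epoch 0 standing
  for \<open>m = 0\<close>. After it the chain moves to 0 with probability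
  \<open>1 - \<beta>\<close> and stays there for \<open>1 / (1 - \<alpha>)\<close> epochs on
  average. The recursions make this an induction on \<open>m\<close>; summability of
  \<open>B\<close> comes first, from partial sums \<open>?S\<close> with
  \<open>?S \<le> (1 - \<beta>) + \<alpha> * ?S\<close>.\<close>

lemma AB_sums: "(\<lambda>n. A n m) sums 1" "(\<lambda>n. B n m) sums ((1 - \<beta>) / (1 - \<alpha>))"
proof -
  have Bs: "(\<lambda>n. B n m) sums ((1 - \<beta>) / (1 - \<alpha>))" if As: "(\<lambda>n. A n m) sums 1" for m
  proof -
    have "(\<Sum>n<N. B n m) \<le> (1 - \<beta>) / (1 - \<alpha>)" for N
    proof -
      let ?S = "\<Sum>n<N. B n m"
      have "?S \<le> (\<Sum>n<Suc N. B n m)" by (simp add: B_nonneg)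
      also have "\<dots> = (\<Sum>n<N. (1 - \<beta>) * A n m + \<alpha> * B n m)"
        by (simp only: sum.lessThan_Suc_shift B_0 B_Suc)
      also have "\<dots> = (1 - \<beta>) * (\<Sum>n<N. A n m) + \<alpha> * ?S" by (simp add: sum.distrib sum_distrib_left)
      also have "\<dots> \<le> (1 - \<beta>) * 1 + \<alpha> * ?S"
      proof (intro add_right_mono mult_left_mono)
        have "(\<Sum>n<N. A n m) \<le> (\<Sum>n. A n m)" by (rule sum_le_suminf) (use As sums_summable A_nonneg in auto)
        then show "(\<Sum>n<N. A n m) \<le> 1" using sums_unique[OF As] by simp
      qed (use \<beta> in auto)
      finally have "?S * (1 - \<alpha>) \<le> 1 - \<beta>" by (simp add: algebra_simps)
      then show ?thesis using \<alpha> by (simp add: pos_le_divide_eq)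
    qed
    then have sB: "summable (\<lambda>n. B n m)" by (intro summableI_nonneg_bounded B_nonneg)
    have "(\<lambda>n. B (Suc n) m) sums ((1 - \<beta>) * 1 + \<alpha> * (\<Sum>n. B n m))"
      unfolding B_Suc by (intro sums_add sums_mult As summable_sums sB)
    then have "(\<lambda>n. B n m) sums ((1 - \<beta>) * 1 + \<alpha> * (\<Sum>n. B n m))" by (rule sums_from_Suc[rotated]) (rule B_0)
    then have "(\<Sum>n. B n m) = (1 - \<beta>) * 1 + \<alpha> * (\<Sum>n. B n m)" by (rule sums_unique[symmetric])
    then have "(1 - \<alpha>) * (\<Sum>n. B n m) = 1 - \<beta>" unfolding left_diff_distrib by linarith
    then have "(\<Sum>n. B n m) = (1 - \<beta>) / (1 - \<alpha>)" using \<alpha> by (simp add: eq_divide_eq mult.commute)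
    then show ?thesis using summable_sums[OF sB] by simp
  qed
  show As: "(\<lambda>n. A n m) sums 1"
  proof (induction m)
    case 0
    have "A n 0 = (if n = 0 then 1 else 0)" for n by (cases n) (auto simp: A_0 A_Suc_0)
    then show ?case using sums_single[of 0 "\<lambda>_. 1::real"] by simp
  next
    case (Suc m)
    have "(\<lambda>n. A (Suc n) (Suc m)) sums (\<beta> * 1 + (1 - \<alpha>) * ((1 - \<beta>) / (1 - \<alpha>)))"
      unfolding A_Suc_Suc by (intro sums_add sums_mult Suc Bs)
    then have "(\<lambda>n. A (Suc n) (Suc m)) sums 1" using \<alpha> by simp
    then show ?case by (rule sums_from_Suc[rotated]) (simp add: A_0)
  qed
  show "(\<lambda>n. B n m) sums ((1 - \<beta>) / (1 - \<alpha>))" by (rule Bs[OF As])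
qed

definition stat1 :: real where "stat1 = (1 - \<alpha>) / ((1 - \<alpha>) + (1 - \<beta>))"

lemma stat1_pos: "0 < stat1"
  using \<alpha> \<beta> by (simp add: stat1_def)

definition D :: "nat \<Rightarrow> nat \<Rightarrow> real" where "D n m = A n m + B n m"

lemma D_nonneg: "0 \<le> D n m"
  by (simp add: D_def A_nonneg B_nonneg)

text \<open>The mean number of epochs spent at one value of the count is the mean distance between
  activations, the reciprocal of the stationary probability.\<close>

lemma D_sums: "(\<lambda>n. D n m) sums (1 / stat1)"
proof -
  have "1 + (1 - \<beta>) / (1 - \<alpha>) = 1 / stat1" using \<alpha> by (simp add: stat1_def field_simps)
  then show ?thesis using sums_add[OF AB_sums] by (simp add: D_def)
qed

lemma D_eq: "D n m = prob {\<omega> \<in> space M. cnt n \<omega> = m}"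
proof -
  have "prob {\<omega> \<in> space M. cnt n \<omega> = m} = prob {\<omega> \<in> space M. cnt n \<omega> = m \<and> \<xi> n \<omega> = 1} + prob {\<omega> \<in> space M. cnt n \<omega> = m \<and> \<xi> n \<omega> = 0}"
    by (rule split_state) measurable
  then show ?thesis by (simp add: D_def A_def B_def)
qed

text \<open>An expectation in which the count enters through \<open>f\<close> on the active state
  and through \<open>g\<close> on the inactive one; \<open>lin_Suc\<close> is the backward equation
  for it.\<close>

definition lin :: "nat \<Rightarrow> (nat \<Rightarrow> real) \<Rightarrow> (nat \<Rightarrow> real) \<Rightarrow> real" where
  "lin n f g = (\<Sum>m\<le>n. f m * A n m + g m * B n m)"

lemma lin_Suc: "lin (Suc n) f g = lin n (\<lambda>m. \<beta> * f (Suc m) + (1 - \<beta>) * g m) (\<lambda>m. (1 - \<alpha>) * f (Suc m) + \<alpha> * g m)"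
proof -
  have "(\<Sum>m\<le>Suc n. f m * A (Suc n) m) = (\<Sum>m\<le>n. f (Suc m) * (\<beta> * A n m + (1 - \<alpha>) * B n m))"
    unfolding sum.atMost_Suc_shift by (simp add: A_Suc_0 A_Suc_Suc)
  moreover have "(\<Sum>m\<le>Suc n. g m * B (Suc n) m) = (\<Sum>m\<le>n. g m * ((1 - \<beta>) * A n m + \<alpha> * B n m))"
    using AB_zero[of n "Suc n"] by (simp add: B_Suc)
  ultimately show ?thesis unfolding lin_def sum.distrib[of "\<lambda>m. f m * A (Suc n) m"]
    by (simp add: sum.distrib[symmetric] algebra_simps)
qed

lemma lin_add: "lin n (\<lambda>m. f m + f' m) (\<lambda>m. g m + g' m) = lin n f g + lin n f' g'"
  by (simp add: lin_def sum.distrib algebra_simps)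

lemma lin_one: "lin n (\<lambda>_. 1) (\<lambda>_. 1) = 1"
proof (induction n)
  case 0
  then show ?case by (simp add: lin_def A_0 B_0)
next
  case (Suc n)
  then show ?case by (simp add: lin_Suc)
qed

lemma lin_mono: "(\<And>m. f m \<le> f' m) \<Longrightarrow> (\<And>m. g m \<le> g' m) \<Longrightarrow> lin n f g \<le> lin n f' g'"
  unfolding lin_def by (intro sum_mono add_mono mult_right_mono A_nonneg B_nonneg)

lemma lin_const: "lin n (\<lambda>_. c) (\<lambda>_. c) = c"
proof -
  have "lin n (\<lambda>_. c) (\<lambda>_. c) = c * lin n (\<lambda>_. 1) (\<lambda>_. 1)"
    by (simp add: lin_def sum_distrib_left algebra_simps)
  then show ?thesis by (simp add: lin_one)
qed

text \<open>The corrector \<open>kap\<close> on state 1 turns the centred count into a martingale.\<close>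
definition kap :: real where "kap = 1 / ((1 - \<alpha>) + (1 - \<beta>)) - 1"

definition sec :: "nat \<Rightarrow> real" where
  "sec n = lin n (\<lambda>m. (real m - stat1 * real n + kap)\<^sup>2) (\<lambda>m. (real m - stat1 * real n)\<^sup>2)"

text \<open>Mean-zero increments of the corrected count. From state 1 it rises by
  \<open>1 - stat1\<close> or falls by \<open>kap + stat1\<close>; from state 0 it rises by
  \<open>1 - stat1 + kap\<close> or falls by \<open>stat1\<close>.\<close>

lemma corrector: "\<beta> * (1 - stat1) = (1 - \<beta>) * (kap + stat1)" "(1 - \<alpha>) * (1 - stat1 + kap) = \<alpha> * stat1"
proof -
  define \<delta> where "\<delta> = (1 - \<alpha>) + (1 - \<beta>)"
  have \<delta>: "\<delta> \<noteq> 0" using \<alpha> \<beta> by (simp add: \<delta>_def)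
  have s: "stat1 * \<delta> = 1 - \<alpha>" "kap * \<delta> = 1 - \<delta>"
    unfolding stat1_def kap_def \<delta>_def[symmetric]
    by (simp only: times_divide_eq_left nonzero_mult_div_cancel_right[OF \<delta>],
      simp only: left_diff_distrib times_divide_eq_left mult_1 divide_self[OF \<delta>])
  have "(\<beta> * (1 - stat1)) * \<delta> = \<beta> * (\<delta> - stat1 * \<delta>)" by (simp add: algebra_simps)
  also have "\<dots> = (1 - \<beta>) * (kap * \<delta> + stat1 * \<delta>)" unfolding s by (simp add: \<delta>_def algebra_simps)
  also have "\<dots> = ((1 - \<beta>) * (kap + stat1)) * \<delta>" by (simp add: algebra_simps)
  finally show "\<beta> * (1 - stat1) = (1 - \<beta>) * (kap + stat1)" using \<delta> by simp
  have "((1 - \<alpha>) * (1 - stat1 + kap)) * \<delta> = (1 - \<alpha>) * (\<delta> - stat1 * \<delta> + kap * \<delta>)" by (simp add: algebra_simps)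
  also have "\<dots> = \<alpha> * (stat1 * \<delta>)" unfolding s by (simp add: \<delta>_def algebra_simps)
  also have "\<dots> = (\<alpha> * stat1) * \<delta>" by (simp add: algebra_simps)
  finally show "(1 - \<alpha>) * (1 - stat1 + kap) = \<alpha> * stat1" using \<delta> by simp
qed

text \<open>The larger of the two conditional variances of an increment, given the current
  state.\<close>

definition cst :: real where
  "cst = max (\<beta> * (1 - stat1)\<^sup>2 + (1 - \<beta>) * (kap + stat1)\<^sup>2) ((1 - \<alpha>) * (1 - stat1 + kap)\<^sup>2 + \<alpha> * stat1\<^sup>2)"

lemma sec_Suc: "sec (Suc n) \<le> sec n + cst"
proof -
  \<comment> \<open>A centred two-point increment with values \<open>p\<close> and
    \<open>- q\<close> adds its variance to the square, because the cross term vanishes.\<close>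
  have sq: "w * (x + p)\<^sup>2 + (1 - w) * (x - q)\<^sup>2 = x\<^sup>2 + (w * p\<^sup>2 + (1 - w) * q\<^sup>2)"
    if "w * p = (1 - w) * q" for w x p q :: real
  proof -
    have "w * (x + p)\<^sup>2 + (1 - w) * (x - q)\<^sup>2 = x\<^sup>2 + (w * p\<^sup>2 + (1 - w) * q\<^sup>2) + 2 * x * (w * p - (1 - w) * q)"
      by (simp add: power2_eq_square algebra_simps)
    then show ?thesis using that by simp
  qed
  have 1: "\<beta> * (real (Suc m) - stat1 * real (Suc n) + kap)\<^sup>2 + (1 - \<beta>) * (real m - stat1 * real (Suc n))\<^sup>2
     \<le> (real m - stat1 * real n + kap)\<^sup>2 + cst" for m
  proof -
    have "\<beta> * (real (Suc m) - stat1 * real (Suc n) + kap)\<^sup>2 + (1 - \<beta>) * (real m - stat1 * real (Suc n))\<^sup>2 =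
      \<beta> * ((real m - stat1 * real n + kap) + (1 - stat1))\<^sup>2 + (1 - \<beta>) * ((real m - stat1 * real n + kap) - (kap + stat1))\<^sup>2"
      by (simp add: algebra_simps)
    also have "\<dots> = (real m - stat1 * real n + kap)\<^sup>2 + (\<beta> * (1 - stat1)\<^sup>2 + (1 - \<beta>) * (kap + stat1)\<^sup>2)"
      by (rule sq) (rule corrector)
    finally show ?thesis by (simp add: cst_def)
  qed
  have 0: "(1 - \<alpha>) * (real (Suc m) - stat1 * real (Suc n) + kap)\<^sup>2 + \<alpha> * (real m - stat1 * real (Suc n))\<^sup>2
     \<le> (real m - stat1 * real n)\<^sup>2 + cst" for m
  proof -
    have "(1 - \<alpha>) * (real (Suc m) - stat1 * real (Suc n) + kap)\<^sup>2 + \<alpha> * (real m - stat1 * real (Suc n))\<^sup>2 =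
      (1 - \<alpha>) * ((real m - stat1 * real n) + (1 - stat1 + kap))\<^sup>2 + (1 - (1 - \<alpha>)) * ((real m - stat1 * real n) - stat1)\<^sup>2"
      by (simp add: algebra_simps)
    also have "\<dots> = (real m - stat1 * real n)\<^sup>2 + ((1 - \<alpha>) * (1 - stat1 + kap)\<^sup>2 + (1 - (1 - \<alpha>)) * stat1\<^sup>2)"
      by (rule sq) (use corrector in simp)
    finally show ?thesis by (simp add: cst_def)
  qed
  have "sec (Suc n) \<le> lin n (\<lambda>m. (real m - stat1 * real n + kap)\<^sup>2 + cst) (\<lambda>m. (real m - stat1 * real n)\<^sup>2 + cst)"
    unfolding sec_def lin_Suc by (intro lin_mono 1 0)
  also have "\<dots> = sec n + cst" unfolding lin_add lin_const sec_def ..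
  finally show ?thesis .
qed

lemma sec_le: "sec n \<le> kap\<^sup>2 + cst * real n"
proof (induction n)
  case 0
  then show ?case by (simp add: sec_def lin_def A_0 B_0)
next
  case (Suc n)
  then show ?case using sec_Suc[of n] by (simp add: algebra_simps)
qed

lemma D_concentration:
  assumes e: "0 < e"
  shows "(\<lambda>n. \<Sum>m\<le>n. (if e * real n < \<bar>real m - stat1 * real n\<bar> then D n m else 0)) \<longlonglongrightarrow> 0"
proof -
  let ?P = "\<lambda>n m. e * real n < \<bar>real m - stat1 * real n\<bar>"
  have bound: "(\<Sum>m\<le>n. (if ?P n m then D n m else 0)) \<le> 4 * (kap\<^sup>2 + cst * real n) / (e * real n)\<^sup>2"
    if n: "2 * \<bar>kap\<bar> \<le> e * real n" "0 < n" for n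
  proof -
    \<comment> \<open>Chebyshev's inequality is used with half of the deviation; the other half
      absorbs the corrector as soon as \<open>2 * \<bar>kap\<bar> \<le> e * real n\<close>.\<close>
    let ?c = "(e * real n / 2)\<^sup>2"
    have c: "0 < ?c" using e n by simp
    have sqle: "?c \<le> x\<^sup>2" if "e * real n / 2 \<le> \<bar>x\<bar>" for x
      using power_mono[OF that, of 2] e by simp
    have "?c * (\<Sum>m\<le>n. (if ?P n m then D n m else 0)) = lin n (\<lambda>m. if ?P n m then ?c else 0) (\<lambda>m. if ?P n m then ?c else 0)"
      unfolding lin_def sum_distrib_left by (intro sum.cong) (auto simp: D_def algebra_simps)
    also have "\<dots> \<le> sec n" unfolding sec_def
    proof (rule lin_mono)
      fix m
      show "(if ?P n m then ?c else 0) \<le> (real m - stat1 * real n + kap)\<^sup>2"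
      proof (cases "?P n m")
        case True
        then have "e * real n / 2 \<le> \<bar>real m - stat1 * real n + kap\<bar>" using n by linarith
        from sqle[OF this] show ?thesis using True by simp
      qed simp
      show "(if ?P n m then ?c else 0) \<le> (real m - stat1 * real n)\<^sup>2"
      proof (cases "?P n m")
        case True
        then have "e * real n / 2 \<le> \<bar>real m - stat1 * real n\<bar>" using n by linarith
        from sqle[OF this] show ?thesis using True by simp
      qed simp
    qed
    also have "\<dots> \<le> kap\<^sup>2 + cst * real n" by (rule sec_le)
    finally show ?thesis using c e n(2) by (simp add: field_simps power2_eq_square)
  qed
  have lim: "(\<lambda>n. 4 * (kap\<^sup>2 + cst * real n) / (e * real n)\<^sup>2) \<longlonglongrightarrow> 0" using e by real_asymp
  have "\<forall>\<^sub>F n in sequentially. 2 * \<bar>kap\<bar> \<le> e * real n \<and> 0 < n"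
  proof -
    obtain N :: nat where "2 * \<bar>kap\<bar> / e \<le> real N" using real_arch_simple by blast
    then show ?thesis using e
      by (intro eventually_sequentiallyI[of "Suc N"]) (auto simp: field_simps intro: order_trans mult_left_mono)
  qed
  then have ev: "\<forall>\<^sub>F n in sequentially. (\<Sum>m\<le>n. (if ?P n m then D n m else 0)) \<le> 4 * (kap\<^sup>2 + cst * real n) / (e * real n)\<^sup>2"
    by eventually_elim (rule bound, auto)
  have "\<forall>\<^sub>F n in sequentially. 0 \<le> (\<Sum>m\<le>n. (if ?P n m then D n m else 0))"
    by (intro always_eventually allI sum_nonneg) (simp add: D_nonneg)
  then show ?thesis using ev tendsto_const lim by (rule tendsto_sandwich)
qed

lemma D_total: "(\<Sum>m\<le>n. D n m) = 1"
  using lin_one[of n] by (simp add: lin_def D_def)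

end

section \<open>Thinning by the active epochs\<close>

text \<open>The sum averages \<open>v j\<close> over a random index concentrated near
  \<open>\<pi> * x / a j\<close>. Monotonicity of \<open>v j\<close> encloses it between two values
  whose limits are known, and indices far from the centre weigh little because
  \<open>v j \<le> 1\<close>.\<close>

lemma thinned_limit:
  fixes v D :: "nat \<Rightarrow> nat \<Rightarrow> real" and a :: "nat \<Rightarrow> real"
  assumes D: "\<And>n m. 0 \<le> D n m" "\<And>n. (\<Sum>m\<le>n. D n m) = 1"
    and conc: "\<And>e. 0 < e \<Longrightarrow> (\<lambda>n. \<Sum>m\<le>n. (if e * real n < \<bar>real m - \<pi> * real n\<bar> then D n m else 0)) \<longlonglongrightarrow> 0"
    and \<pi>: "0 < \<pi>"
    and v: "\<And>j m. 0 \<le> v j m" "\<And>j m. v j m \<le> 1" "\<And>j. decseq (v j)"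
    and a: "a \<longlonglongrightarrow> 0" "\<And>j. 0 < a j" and x: "0 < x"
    and lim: "\<And>y. 0 < y \<Longrightarrow> (\<lambda>j. v j (nat \<lfloor>y / a j\<rfloor>)) \<longlonglongrightarrow> exp (- l * y)"
  shows "(\<lambda>j. \<Sum>m\<le>nat \<lfloor>x / a j\<rfloor>. v j m * D (nat \<lfloor>x / a j\<rfloor>) m) \<longlonglongrightarrow> exp (- l * (\<pi> * x))"
proof -
  define n where "n j = nat \<lfloor>x / a j\<rfloor>" for j
  define s where "s j = (\<Sum>m\<le>n j. v j m * D (n j) m)" for j
  have n1: "real (n j) \<le> x / a j" for j
    using a(2)[of j] x by (simp add: n_def of_nat_nat)
  have n2: "x / a j - 1 < real (n j)" for j
    using a(2)[of j] x by (simp add: n_def of_nat_nat)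
  have ainf: "filterlim (\<lambda>j. 1 / a j) at_top sequentially"
    using a by (intro filterlim_inverse_at_top[of a sequentially, unfolded inverse_eq_divide]) auto
  have ninf: "filterlim n at_top sequentially"
  proof -
    have "filterlim (\<lambda>j. x * (1 / a j)) at_top sequentially"
      by (rule filterlim_tendsto_pos_mult_at_top[OF tendsto_const x ainf])
    then have "filterlim (\<lambda>j. \<lfloor>x / a j\<rfloor>) at_top sequentially"
      by (intro filterlim_compose[OF filterlim_floor_sequentially]) simp
    then show ?thesis unfolding n_def by (rule filterlim_compose[OF filterlim_nat_sequentially])
  qed
  \<comment> \<open>The bounds are asymmetric because of the floor: \<open>n j\<close> can fall
    short of \<open>x / a j\<close> by up to 1, which costs at most \<open>\<pi> - e\<close>, and
    the additional \<open>e * (x / a j)\<close> eventually covers it.\<close>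
  have main: "\<exists>bad. bad \<longlonglongrightarrow> 0 \<and> (\<forall>\<^sub>F j in sequentially. s j \<le> v j (nat \<lfloor>((\<pi> - 2 * e) * x) / a j\<rfloor>) + bad j
     \<and> v j (nat \<lfloor>((\<pi> + e) * x) / a j\<rfloor>) - bad j \<le> s j)" if e: "0 < e" "2 * e < \<pi>" for e
  proof -
    let ?bad = "\<lambda>n m. e * real n < \<bar>real m - \<pi> * real n\<bar>"
    define bad where "bad j = (\<Sum>m\<le>n j. (if ?bad (n j) m then D (n j) m else 0))" for j
    have b0: "bad \<longlonglongrightarrow> 0" unfolding bad_def by (rule filterlim_compose[OF conc[OF e(1)] ninf])
    have "\<forall>\<^sub>F j in sequentially. (\<pi> - e) / (e * x) \<le> 1 / a j"
      using ainf by (simp add: filterlim_at_top)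
    then have "\<forall>\<^sub>F j in sequentially. s j \<le> v j (nat \<lfloor>((\<pi> - 2 * e) * x) / a j\<rfloor>) + bad j
     \<and> v j (nat \<lfloor>((\<pi> + e) * x) / a j\<rfloor>) - bad j \<le> s j"
    proof eventually_elim
      case (elim j)
      let ?v1 = "v j (nat \<lfloor>((\<pi> - 2 * e) * x) / a j\<rfloor>)" and ?v2 = "v j (nat \<lfloor>((\<pi> + e) * x) / a j\<rfloor>)"
      have elim': "\<pi> - e \<le> e * (x / a j)" using elim e x by (simp add: pos_divide_le_eq ac_simps)
      have good: "v j m \<le> ?v1 \<and> ?v2 \<le> v j m" if m: "\<not> ?bad (n j) m" for m
      proof
        have "(\<pi> - e) * (x / a j - 1) \<le> (\<pi> - e) * real (n j)" using n2[of j] e by (intro mult_left_mono) auto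
        then have "(\<pi> - e) * (x / a j) - (\<pi> - e) \<le> (\<pi> - e) * real (n j)" by (simp only: right_diff_distrib mult_1_right)
        moreover have "(\<pi> - e) * real (n j) \<le> real m" using m by (simp add: left_diff_distrib abs_le_iff not_less)
        moreover have "(\<pi> - 2 * e) * (x / a j) = (\<pi> - e) * (x / a j) - e * (x / a j)" by (simp only: left_diff_distrib)
        ultimately have "(\<pi> - 2 * e) * (x / a j) \<le> real m" using elim' by linarith
        then have "((\<pi> - 2 * e) * x) / a j \<le> real m" by simp
        then have "\<lfloor>((\<pi> - 2 * e) * x) / a j\<rfloor> \<le> int m" by (simp add: floor_le_iff)
        then have "nat \<lfloor>((\<pi> - 2 * e) * x) / a j\<rfloor> \<le> m" by simp
        then show "v j m \<le> ?v1" using v(3)[of j] by (simp add: decseq_def)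
        have "real m \<le> (\<pi> + e) * real (n j)" using m by (simp add: algebra_simps abs_le_iff not_less)
        also have "\<dots> \<le> (\<pi> + e) * (x / a j)" using n1[of j] e \<pi> by (intro mult_left_mono) auto
        finally have "real m \<le> ((\<pi> + e) * x) / a j" by simp
        then have "m \<le> nat \<lfloor>((\<pi> + e) * x) / a j\<rfloor>" by (simp add: le_nat_floor)
        then show "?v2 \<le> v j m" using v(3)[of j] by (simp add: decseq_def)
      qed
      have "s j \<le> (\<Sum>m\<le>n j. ?v1 * D (n j) m + (if ?bad (n j) m then D (n j) m else 0))"
        unfolding s_def
      proof (rule sum_mono)
        fix m
        show "v j m * D (n j) m \<le> ?v1 * D (n j) m + (if ?bad (n j) m then D (n j) m else 0)"
        proof (cases "?bad (n j) m")
          case True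
          have "v j m * D (n j) m \<le> 1 * D (n j) m" by (intro mult_right_mono v D)
          moreover have "0 \<le> ?v1 * D (n j) m" by (intro mult_nonneg_nonneg v D)
          ultimately show ?thesis using True by simp
        next
          case False
          then show ?thesis using mult_right_mono[OF conjunct1[OF good[OF False]] D(1)[of "n j" m]] by simp
        qed
      qed
      also have "\<dots> = ?v1 + bad j"
        unfolding sum.distrib sum_distrib_left[symmetric] D(2) bad_def by simp
      finally have up: "s j \<le> ?v1 + bad j" .
      have "?v2 - bad j = (\<Sum>m\<le>n j. ?v2 * D (n j) m - (if ?bad (n j) m then D (n j) m else 0))"
        unfolding sum_subtractf sum_distrib_left[symmetric] D(2) bad_def by simp
      also have "\<dots> \<le> s j" unfolding s_def
      proof (rule sum_mono)
        fix m
        show "?v2 * D (n j) m - (if ?bad (n j) m then D (n j) m else 0) \<le> v j m * D (n j) m"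
        proof (cases "?bad (n j) m")
          case True
          have "?v2 * D (n j) m \<le> 1 * D (n j) m" by (intro mult_right_mono v D)
          moreover have "0 \<le> v j m * D (n j) m" by (intro mult_nonneg_nonneg v D)
          ultimately show ?thesis using True by simp
        next
          case False
          then show ?thesis using mult_right_mono[OF conjunct2[OF good[OF False]] D(1)[of "n j" m]] by simp
        qed
      qed
      finally show ?case using up by simp
    qed
    then show ?thesis using b0 by blast
  qed
  have small: "\<forall>\<^sub>F e in at_right 0. 0 < e \<and> 2 * e < \<pi>"
    using \<pi> unfolding eventually_at_right_field by (intro exI[of _ "\<pi> / 2"]) auto
  have "s \<longlonglongrightarrow> exp (- l * (\<pi> * x))"
  proof (rule order_tendstoI)
    fix c assume c: "exp (- l * (\<pi> * x)) < c"
    have "((\<lambda>e. exp (- l * ((\<pi> - 2 * e) * x))) \<longlongrightarrow> exp (- l * ((\<pi> - 2 * 0) * x))) (at_right 0)"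
      by (intro tendsto_intros)
    then have "\<forall>\<^sub>F e in at_right 0. exp (- l * ((\<pi> - 2 * e) * x)) < c"
      using c by (intro order_tendstoD(2)) auto
    then have "\<forall>\<^sub>F e in at_right 0. exp (- l * ((\<pi> - 2 * e) * x)) < c \<and> 0 < e \<and> 2 * e < \<pi>"
      using small by (rule eventually_conj)
    then obtain e where e: "exp (- l * ((\<pi> - 2 * e) * x)) < c" "0 < e" "2 * e < \<pi>"
      using eventually_happens'[OF trivial_limit_at_right_real] by blast
    obtain bad where bad0: "bad \<longlonglongrightarrow> 0" and ev: "\<forall>\<^sub>F j in sequentially. s j \<le> v j (nat \<lfloor>((\<pi> - 2 * e) * x) / a j\<rfloor>) + bad j
      \<and> v j (nat \<lfloor>((\<pi> + e) * x) / a j\<rfloor>) - bad j \<le> s j"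
      using main[OF e(2,3)] by blast
    have bad: "\<forall>\<^sub>F j in sequentially. s j \<le> v j (nat \<lfloor>((\<pi> - 2 * e) * x) / a j\<rfloor>) + bad j"
      using ev by (rule eventually_mono) simp
    have "(\<lambda>j. v j (nat \<lfloor>((\<pi> - 2 * e) * x) / a j\<rfloor>) + bad j) \<longlonglongrightarrow> exp (- l * ((\<pi> - 2 * e) * x)) + 0"
      using e x by (intro tendsto_add lim bad0) simp
    then have "\<forall>\<^sub>F j in sequentially. v j (nat \<lfloor>((\<pi> - 2 * e) * x) / a j\<rfloor>) + bad j < c"
      using e(1) by (intro order_tendstoD(2)) auto
    with bad show "\<forall>\<^sub>F j in sequentially. s j < c" by eventually_elim linarith
  next
    fix c assume c: "c < exp (- l * (\<pi> * x))"
    have "((\<lambda>e. exp (- l * ((\<pi> + e) * x))) \<longlongrightarrow> exp (- l * ((\<pi> + 0) * x))) (at_right 0)"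
      by (intro tendsto_intros)
    then have "\<forall>\<^sub>F e in at_right 0. c < exp (- l * ((\<pi> + e) * x))"
      using c by (intro order_tendstoD(1)) auto
    then have "\<forall>\<^sub>F e in at_right 0. c < exp (- l * ((\<pi> + e) * x)) \<and> 0 < e \<and> 2 * e < \<pi>"
      using small by (rule eventually_conj)
    then obtain e where e: "c < exp (- l * ((\<pi> + e) * x))" "0 < e" "2 * e < \<pi>"
      using eventually_happens'[OF trivial_limit_at_right_real] by blast
    obtain bad where bad0: "bad \<longlonglongrightarrow> 0" and ev: "\<forall>\<^sub>F j in sequentially. s j \<le> v j (nat \<lfloor>((\<pi> - 2 * e) * x) / a j\<rfloor>) + bad j
      \<and> v j (nat \<lfloor>((\<pi> + e) * x) / a j\<rfloor>) - bad j \<le> s j"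
      using main[OF e(2,3)] by blast
    have bad: "\<forall>\<^sub>F j in sequentially. v j (nat \<lfloor>((\<pi> + e) * x) / a j\<rfloor>) - bad j \<le> s j"
      using ev by (rule eventually_mono) simp
    have "(\<lambda>j. v j (nat \<lfloor>((\<pi> + e) * x) / a j\<rfloor>) - bad j) \<longlonglongrightarrow> exp (- l * ((\<pi> + e) * x)) - 0"
      using e x \<pi> by (intro tendsto_diff lim bad0) simp
    then have "\<forall>\<^sub>F j in sequentially. c < v j (nat \<lfloor>((\<pi> + e) * x) / a j\<rfloor>) - bad j"
      using e(1) by (intro order_tendstoD(1)) auto
    with bad show "\<forall>\<^sub>F j in sequentially. c < s j" by eventually_elim linarith
  qed
  then show ?thesis unfolding s_def n_def .
qed

context cusum_law
begin

text \<open>The alarm rate per observed sample on the scale \<open>exp h\<close>: the limit of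
  \<open>exp h * p h\<close> over the mean cycle length. As \<open>r_inf\<close> is itself the
  reciprocal of that length, the latter enters squared.\<close>

definition lam :: real where "lam = r_inf * (1 - eta)\<^sup>2 / I_KL / (\<Sum>k. t k)"

lemma lam_pos: "0 < lam"
  unfolding lam_def using r_inf_pos eta_less_1 zexp_pos t_sum_pos by (intro divide_pos_pos mult_pos_pos) auto

lemma p_eventually_pos:
  assumes X: "filterlim X at_top sequentially"
  shows "\<forall>\<^sub>F n in sequentially. 0 < X n \<and> 0 < p (X n)"
proof -
  have "0 < r_inf * (1 - eta)\<^sup>2 / I_KL"
    using r_inf_pos eta_less_1 zexp_pos by (intro divide_pos_pos mult_pos_pos) auto
  then have "\<forall>\<^sub>F n in sequentially. 0 < exp (X n) * p (X n)"
    using p_tendsto[OF X] by (intro order_tendstoD(1)) auto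
  moreover have "\<forall>\<^sub>F n in sequentially. 0 < X n" using X by (auto simp: filterlim_at_top_dense)
  ultimately show ?thesis by eventually_elim (simp add: zero_less_mult_iff)
qed

lemma p_eventually_pos_at_top: "\<forall>\<^sub>F h in at_top. 0 < h \<and> 0 < p h"
proof (rule ccontr)
  assume "\<not> ?thesis"
  \<comment> \<open>Positivity is known along sequences only, since the limits rest on dominated
    convergence; exceptions at arbitrarily high levels would form such a sequence.\<close>
  then have "\<exists>h\<ge>real n. \<not> (0 < h \<and> 0 < p h)" for n
    unfolding eventually_at_top_linorder by blast
  then obtain X where X: "\<And>n. real n \<le> X n" "\<And>n. \<not> (0 < X n \<and> 0 < p (X n))" by metis
  have "filterlim X at_top sequentially"
    by (rule filterlim_at_top_mono[OF filterlim_real_sequentially]) (use X(1) in auto)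
  from p_eventually_pos[OF this] X(2) show False by simp
qed

lemma v_exponential:
  assumes X: "filterlim X at_top sequentially" and y: "0 < y"
  shows "(\<lambda>j. v (X j) (nat \<lfloor>y / exp (- X j)\<rfloor>)) \<longlonglongrightarrow> exp (- lam * y)"
proof -
  obtain N where N: "\<And>j. N \<le> j \<Longrightarrow> 0 < X j \<and> 0 < p (X j)"
    using p_eventually_pos[OF X] by (auto simp: eventually_sequentially)
  \<comment> \<open>The limit theorem wants its conditions for all indices, so an initial segment is
    dropped and restored at the end.\<close>
  define X' where "X' j = X (j + N)" for j
  have X': "filterlim X' at_top sequentially"
    unfolding X'_def using X by (rule filterlim_compose) (rule filterlim_add_const_nat_at_top)
  have pos: "0 < X' j" "0 < p (X' j)" for j using N[of "j + N"] by (auto simp: X'_def)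
  have "(\<lambda>j. v (X' j) (nat \<lfloor>y / exp (- X' j)\<rfloor>)) \<longlonglongrightarrow> exp (- (r_inf * (1 - eta)\<^sup>2 / I_KL / (\<Sum>m. t m)) * y)"
  proof (rule renewal_exponential_limit[where v="\<lambda>j. v (X' j)" and u="\<lambda>j. u (X' j)" and d="\<lambda>j. d (X' j)"
        and t=t and q="\<lambda>k. t k - t (Suc k)" and a="\<lambda>j. exp (- X' j)"])
    show "v (X' n) m = u (X' n) m + (\<Sum>k<m. d (X' n) k * v (X' n) (m - Suc k))" for n m
      by (rule v_renewal[OF pos(1)])
    show "v (X' n) 0 = 1" for n by (rule v_0[OF pos(1)])
    show "(\<lambda>n. exp (- X' n)) \<longlonglongrightarrow> 0"
      using X' by (intro filterlim_compose[OF exp_at_bot]) (simp add: filterlim_uminus_at_bot)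
    show "(\<Sum>k. d (X' n) k) < 1" for n using pos(2)[of n] by (simp add: p_def)
    show "(\<lambda>n. (1 - (\<Sum>k. d (X' n) k)) / exp (- X' n)) \<longlonglongrightarrow> r_inf * (1 - eta)\<^sup>2 / I_KL"
      using p_tendsto[OF X'] unfolding p_def by (simp add: exp_minus field_simps)
    show "0 < r_inf * (1 - eta)\<^sup>2 / I_KL"
      using r_inf_pos eta_less_1 zexp_pos by (intro divide_pos_pos mult_pos_pos) auto
  qed (use v_antimono v_bounds u_bounds u_tendsto_t[OF X'] t_summable d_bounds d_tendsto[OF X'] weighted_hit_sums t_sum_pos y in auto)
  then have "(\<lambda>j. v (X (j + N)) (nat \<lfloor>y / exp (- X (j + N))\<rfloor>)) \<longlonglongrightarrow> exp (- lam * y)"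
    unfolding X'_def lam_def .
  then show ?thesis by (rule LIMSEQ_offset)
qed

lemma v_sum:
  assumes "0 < h" "0 < p h"
  shows "summable (v h)" "(\<Sum>m. v h m) = (\<Sum>m. u h m) / p h"
proof -
  have su: "summable (u h)" by (rule summable_comparison_test[OF _ t_summable]) (use u_bounds in auto)
  have d1: "(\<Sum>k. d h k) < 1" using assms(2) by (simp add: p_def)
  show "summable (v h)"
    by (rule renewal_summable[OF v_renewal[OF assms(1)] v_bounds(1) su u_bounds(1) d_summable d_bounds(1) d1])
  show "(\<Sum>m. v h m) = (\<Sum>m. u h m) / p h" unfolding p_def
    by (rule renewal_mean[OF v_renewal[OF assms(1)] v_bounds(1) su u_bounds(1) d_summable d_bounds(1) d1])
qed

lemma v_mean: "((\<lambda>h. exp (- h) * (\<Sum>m. v h m)) \<longlongrightarrow> 1 / lam) at_top"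
proof (rule tendsto_at_topI_sequentially)
  fix X :: "nat \<Rightarrow> real" assume X: "filterlim X at_top sequentially"
  have c: "r_inf * (1 - eta)\<^sup>2 / I_KL \<noteq> 0"
    using r_inf_pos eta_less_1 zexp_pos by simp
  have "(\<lambda>n. \<Sum>m. u (X n) m) \<longlonglongrightarrow> (\<Sum>m. t m)"
    by (rule tendsto_suminf_dominated[OF u_tendsto_t[OF X] _ t_summable]) (use u_bounds in \<open>auto simp: abs_of_nonneg\<close>)
  then have "(\<lambda>n. (\<Sum>m. u (X n) m) / (exp (X n) * p (X n))) \<longlonglongrightarrow> (\<Sum>m. t m) / (r_inf * (1 - eta)\<^sup>2 / I_KL)"
    by (rule tendsto_divide[OF _ p_tendsto[OF X] c])
  moreover have "\<forall>\<^sub>F n in sequentially. (\<Sum>m. u (X n) m) / (exp (X n) * p (X n)) = exp (- X n) * (\<Sum>m. v (X n) m)"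
    using p_eventually_pos[OF X] by eventually_elim (simp add: v_sum exp_minus field_simps)
  ultimately have "(\<lambda>n. exp (- X n) * (\<Sum>m. v (X n) m)) \<longlonglongrightarrow> (\<Sum>m. t m) / (r_inf * (1 - eta)\<^sup>2 / I_KL)"
    by (rule Lim_transform_eventually)
  then show "(\<lambda>n. exp (- X n) * (\<Sum>m. v (X n) m)) \<longlonglongrightarrow> 1 / lam" by (simp add: lam_def mult.commute)
qed

end

section \<open>First entry times and stopped values\<close>

lemma enat_less_first_entry: "enat n < first_entry W S \<omega> \<longleftrightarrow> (\<forall>k\<in>{1..n}. W k \<omega> \<notin> S)"
proof -
  have "enat n < first_entry W S \<omega> \<longleftrightarrow> enat (Suc n) \<le> first_entry W S \<omega>" by (simp add: Suc_ile_eq)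
  also have "\<dots> \<longleftrightarrow> (\<forall>k. 1 \<le> k \<and> W k \<omega> \<in> S \<longrightarrow> Suc n \<le> k)"
    unfolding first_entry_def le_Inf_iff by auto
  also have "\<dots> \<longleftrightarrow> (\<forall>k\<in>{1..n}. W k \<omega> \<notin> S)" by (auto simp: not_less_eq_eq)
  finally show ?thesis .
qed

lemma first_entry_eq_Suc:
  "first_entry W S \<omega> = enat (Suc k) \<longleftrightarrow> (\<forall>j\<in>{1..k}. W j \<omega> \<notin> S) \<and> W (Suc k) \<omega> \<in> S"
proof -
  have "first_entry W S \<omega> = enat (Suc k) \<longleftrightarrow> enat k < first_entry W S \<omega> \<and> \<not> enat (Suc k) < first_entry W S \<omega>"
    by (cases "first_entry W S \<omega>") auto
  then show ?thesis unfolding enat_less_first_entry by (auto simp: atLeastAtMostSuc_conv)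
qed

lemma first_entry_neq_0: "first_entry W S \<omega> \<noteq> enat 0"
proof -
  have "enat 0 < first_entry W S \<omega>" unfolding enat_less_first_entry by simp
  then show ?thesis by auto
qed

lemma ennreal_of_enat_eq_suminf: "ennreal_of_enat x = (\<Sum>n. if enat n < x then 1 else 0)"
proof (cases x)
  case (enat m)
  have "(\<Sum>n. if enat n < x then 1 else 0 :: ennreal) = (\<Sum>n<m. if enat n < x then 1 else 0)"
    by (rule suminf_finite) (auto simp: enat)
  then show ?thesis by (simp add: enat ennreal_of_nat_eq_real_of_nat)
next
  case infinity
  have "(\<Sum>n. 1 :: ennreal) = \<top>"
    by (simp add: suminf_eq_SUP ennreal_SUP_of_nat_eq_top)
  then show ?thesis by (simp add: infinity)
qed

context prob_space
begin

lemma first_entry_pred: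
  assumes [measurable]: "\<And>k. W k \<in> borel_measurable M" "S \<in> sets borel"
  shows "Measurable.pred M (\<lambda>\<omega>. enat n < first_entry W S \<omega>)"
    and "Measurable.pred M (\<lambda>\<omega>. first_entry W S \<omega> = enat (Suc k))"
  unfolding enat_less_first_entry first_entry_eq_Suc by measurable

lemma mean_first_entry:
  assumes [measurable]: "\<And>k. W k \<in> borel_measurable M" "S \<in> sets borel"
  shows "mean_time M (first_entry W S) = (\<Sum>n. ennreal (prob {\<omega> \<in> space M. \<forall>k\<in>{1..n}. W k \<omega> \<notin> S}))"
proof -
  have [measurable]: "Measurable.pred M (\<lambda>\<omega>. enat n < first_entry W S \<omega>)" for n
    by (rule first_entry_pred) (rule assms)+
  have "mean_time M (first_entry W S) = (\<integral>\<^sup>+\<omega>. (\<Sum>n. if enat n < first_entry W S \<omega> then 1 else 0) \<partial>M)"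
    unfolding mean_time_def by (simp only: ennreal_of_enat_eq_suminf)
  also have "\<dots> = (\<Sum>n. \<integral>\<^sup>+\<omega>. (if enat n < first_entry W S \<omega> then 1 else 0) \<partial>M)"
    by (intro nn_integral_suminf) measurable
  also have "\<dots> = (\<Sum>n. ennreal (prob {\<omega> \<in> space M. \<forall>k\<in>{1..n}. W k \<omega> \<notin> S}))"
  proof (intro suminf_cong)
    fix n
    have "(\<integral>\<^sup>+\<omega>. (if enat n < first_entry W S \<omega> then 1 else 0) \<partial>M) = (\<integral>\<^sup>+\<omega>. indicator {\<omega> \<in> space M. enat n < first_entry W S \<omega>} \<omega> \<partial>M)"
      by (intro nn_integral_cong) (simp add: indicator_def)
    also have "\<dots> = emeasure M {\<omega> \<in> space M. enat n < first_entry W S \<omega>}"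
      by (intro nn_integral_indicator) measurable
    finally show "(\<integral>\<^sup>+\<omega>. (if enat n < first_entry W S \<omega> then 1 else 0) \<partial>M) = ennreal (prob {\<omega> \<in> space M. \<forall>k\<in>{1..n}. W k \<omega> \<notin> S})"
      by (simp only: emeasure_eq_measure enat_less_first_entry)
  qed
  finally show ?thesis .
qed

text \<open>Decomposition according to the entry time, where index \<open>k\<close> stands for entry
  at \<open>k + 1\<close>. On infinite entry times the default value 0 contributes
  \<open>f 0\<close>, so either this vanishes or the event is null. The sign of \<open>f\<close> is
  prescribed on \<open>S\<close> only, which admits \<open>uminus\<close> for negative
  heights.\<close>

lemma expectation_at_first_entry:
  fixes f :: "real \<Rightarrow> real"
  assumes W [measurable]: "\<And>k. W k \<in> borel_measurable M" "S \<in> sets borel" and f [measurable]: "f \<in> borel_measurable borel"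
    and f0: "\<And>x. x \<in> S \<Longrightarrow> 0 \<le> f x"
    and inf: "AE \<omega> in M. first_entry W S \<omega> = \<infinity> \<longrightarrow> f 0 = 0"
    and c: "\<And>k. (\<integral>\<^sup>+\<omega>. ennreal (if (\<forall>j\<in>{1..k}. W j \<omega> \<notin> S) \<and> W (Suc k) \<omega> \<in> S then f (W (Suc k) \<omega>) else 0) \<partial>M) = ennreal (c k)"
    and s: "(\<Sum>k. ennreal (c k)) = ennreal s" "0 \<le> s"
  shows "(\<integral>\<omega>. f (value_at W (first_entry W S) \<omega>) \<partial>M) = s"
proof -
  let ?T = "first_entry W S" and ?V = "value_at W (first_entry W S)"
  define g where "g k \<omega> = (if (\<forall>j\<in>{1..k}. W j \<omega> \<notin> S) \<and> W (Suc k) \<omega> \<in> S then f (W (Suc k) \<omega>) else 0)" for k \<omega>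
  have gT: "g k \<omega> = (if ?T \<omega> = enat (Suc k) then f (W (Suc k) \<omega>) else 0)" for k \<omega>
    unfolding g_def first_entry_eq_Suc ..
  have g0: "0 \<le> g k \<omega>" for k \<omega> using f0 by (auto simp: g_def)
  have pt: "ennreal (f (?V \<omega>)) = (\<Sum>k. ennreal (g k \<omega>))" "0 \<le> f (?V \<omega>)" if inf: "?T \<omega> = \<infinity> \<longrightarrow> f 0 = 0" for \<omega>
  proof -
    have "ennreal (f (?V \<omega>)) = (\<Sum>k. ennreal (g k \<omega>)) \<and> 0 \<le> f (?V \<omega>)"
    proof (cases "?T \<omega>")
      case (enat n)
      then obtain k where n: "n = Suc k" using first_entry_neq_0[of W S \<omega>] by (cases n) auto
      have "(\<Sum>i. ennreal (g i \<omega>)) = (\<Sum>i\<in>{k}. ennreal (g i \<omega>))"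
        by (rule suminf_finite) (auto simp: gT enat n)
      moreover have "?V \<omega> = W (Suc k) \<omega>" by (simp add: value_at_def enat n)
      moreover have "W (Suc k) \<omega> \<in> S" using enat n first_entry_eq_Suc[of W S \<omega> k] by simp
      ultimately show ?thesis using f0 by (simp add: gT enat n)
    next
      case infinity
      then have "(\<Sum>i. ennreal (g i \<omega>)) = 0" by (simp add: gT)
      then show ?thesis using inf infinity by (simp add: value_at_def)
    qed
    then show "ennreal (f (?V \<omega>)) = (\<Sum>k. ennreal (g k \<omega>))" "0 \<le> f (?V \<omega>)" by auto
  qed
  \<comment> \<open>The stopped value is a pointwise limit of its restrictions to entry times at
    most \<open>n\<close>, which are finite sums of measurable functions; on infinite entry times
    all of them are 0, like the default.\<close>
  have Vm: "?V \<in> borel_measurable M"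
  proof -
    have "(\<lambda>n. if enat n < ?T \<omega> then 0 else ?V \<omega>) \<longlonglongrightarrow> ?V \<omega>" for \<omega>
    proof (cases "?T \<omega>")
      case (enat n)
      then show ?thesis by (intro tendsto_eventually eventually_sequentiallyI[of n]) auto
    qed (simp add: value_at_def)
    moreover have "(\<lambda>\<omega>. if enat n < ?T \<omega> then 0 else ?V \<omega>) \<in> borel_measurable M" for n
    proof -
      have [measurable]: "Measurable.pred M (\<lambda>\<omega>. ?T \<omega> = enat (Suc k))" for k by (rule first_entry_pred) (rule W)+
      have eq: "(if enat n < ?T \<omega> then 0 else ?V \<omega>) = (\<Sum>k<n. if ?T \<omega> = enat (Suc k) then W (Suc k) \<omega> else 0)" for \<omega>
      proof (cases "?T \<omega>")
        case (enat i)
        then obtain k where i: "i = Suc k" using first_entry_neq_0[of W S \<omega>] by (cases i) auto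
        have "(\<Sum>l<n. if ?T \<omega> = enat (Suc l) then W (Suc l) \<omega> else 0) = (\<Sum>l<n. if l = k then W (Suc k) \<omega> else 0)"
          by (intro sum.cong) (auto simp: enat i)
        also have "\<dots> = (if k < n then W (Suc k) \<omega> else 0)" by simp
        finally show ?thesis by (simp add: enat i value_at_def)
      qed simp
      show ?thesis unfolding eq by measurable
    qed
    ultimately show ?thesis
      by (rule borel_measurable_LIMSEQ_real[where u="\<lambda>n \<omega>. if enat n < ?T \<omega> then 0 else ?V \<omega>"])
  qed
  have AE1: "AE \<omega> in M. 0 \<le> f (?V \<omega>)" using inf by eventually_elim (rule pt(2))
  have "(\<integral>\<omega>. f (?V \<omega>) \<partial>M) = enn2real (\<integral>\<^sup>+\<omega>. ennreal (f (?V \<omega>)) \<partial>M)"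
    by (rule integral_eq_nn_integral[OF measurable_compose[OF Vm f] AE1])
  also have "(\<integral>\<^sup>+\<omega>. ennreal (f (?V \<omega>)) \<partial>M) = (\<integral>\<^sup>+\<omega>. (\<Sum>k. ennreal (g k \<omega>)) \<partial>M)"
    by (rule nn_integral_cong_AE) (use inf in eventually_elim, rule pt(1))
  also have "\<dots> = (\<Sum>k. \<integral>\<^sup>+\<omega>. ennreal (g k \<omega>) \<partial>M)" unfolding g_def by (intro nn_integral_suminf) measurable
  also have "\<dots> = ennreal s" unfolding g_def by (simp only: c s)
  finally show ?thesis using s by simp
qed

end

section \<open>Thinning of paths by the active epochs\<close>

definition active :: "(nat \<Rightarrow> bool) \<Rightarrow> nat \<Rightarrow> nat" where
  "active a n = card {i. i < n \<and> a i}"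

lemma active_0 [simp]: "active a 0 = 0"
  by (simp add: active_def)

lemma active_Suc: "active a (Suc n) = (if a n then Suc (active a n) else active a n)"
proof -
  have "{i. i < Suc n \<and> a i} = (if a n then insert n {i. i < n \<and> a i} else {i. i < n \<and> a i})"
    by (auto simp: less_Suc_eq)
  then show ?thesis by (simp add: active_def)
qed

text \<open>The counter starts at 0 and rises by at most one, so it skips no value; quantifying over
  epochs is therefore quantifying over all prefixes of the sampled path.\<close>

lemma active_image: "active a ` {..n} = {..active a n}"
proof (induction n)
  case (Suc n)
  show ?case by (simp only: atMost_Suc image_insert Suc active_Suc) (auto simp: le_Suc_eq)
qed simp

text \<open>All indices from \<open>n\<close> on are kept, so that the enumeration is total and injective even when
  only finitely many indices are active.\<close>
definition select :: "(nat \<Rightarrow> bool) \<Rightarrow> nat \<Rightarrow> nat \<Rightarrow> nat" where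
  "select a n = enumerate {i. a i \<or> n \<le> i}"

lemma infinite_select: "infinite {i. a i \<or> n \<le> (i::nat)}"
  using infinite_super[OF _ infinite_Ici[of n]] by (metis (mono_tags, lifting) atLeast_iff mem_Collect_eq subsetI)

lemma inj_select: "inj (select a n)"
  unfolding select_def by (rule inj_enumerate) (rule infinite_select)

lemma select_active:
  assumes "k < n" "a k"
  shows "select a n (active a k) = k"
proof -
  let ?S = "{i. a i \<or> n \<le> i}"
  obtain i where i: "enumerate ?S i = k" using enumerate_Ex[OF infinite_select, of k a n] assms by auto
  have "{j. j < k \<and> a j} = enumerate ?S ` {..<i}"
  proof (intro set_eqI iffI)
    fix j assume j: "j \<in> {j. j < k \<and> a j}"
    then obtain l where l: "enumerate ?S l = j" using enumerate_Ex[OF infinite_select, of j a n] by auto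
    then have "l < i" using j i enumerate_mono_iff[OF infinite_select[of a n], of l i] by simp
    then show "j \<in> enumerate ?S ` {..<i}" using l by auto
  next
    fix j assume "j \<in> enumerate ?S ` {..<i}"
    then obtain l where l: "l < i" "j = enumerate ?S l" by auto
    then have "j < k" using i enumerate_mono[OF l(1) infinite_select[of a n]] by simp
    moreover have "j \<in> ?S" using l enumerate_in_set[OF infinite_select] by simp
    ultimately show "j \<in> {j. j < k \<and> a j}" using assms by auto
  qed
  then have "active a k = i"
    unfolding active_def using inj_enumerate[OF infinite_select[of a n]] by (simp add: card_image inj_on_subset)
  then show ?thesis using i by (simp add: select_def)
qed

definition thin :: "(nat \<Rightarrow> bool) \<Rightarrow> (nat \<Rightarrow> real) \<Rightarrow> nat \<Rightarrow> real" where
  "thin a y i = (if a i then y i else 0)"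

lemma walk_thin: "k \<le> n \<Longrightarrow> walk (thin a y) k = walk (\<lambda>i. y (select a n i)) (active a k)"
  by (induction k) (auto simp: walk_Suc thin_def active_Suc select_active)

lemma cus_nonneg: "0 \<le> cus y k"
  by (cases k) auto

lemma cus_thin: "k \<le> n \<Longrightarrow> cus (thin a y) k = cus (\<lambda>i. y (select a n i)) (active a k)"
proof (induction k)
  case (Suc k)
  then show ?case by (auto simp: thin_def active_Suc select_active max_absorb2 cus_nonneg)
qed simp

lemma cus_thin_below:
  "(\<forall>k\<le>n. cus (thin a y) k < h) \<longleftrightarrow> (\<forall>m\<le>active a n. cus (\<lambda>i. y (select a n i)) m < h)"
proof -
  have "(\<forall>k\<le>n. cus (thin a y) k < h) \<longleftrightarrow> (\<forall>k\<in>{..n}. cus (\<lambda>i. y (select a n i)) (active a k) < h)"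
    by (auto simp: cus_thin)
  also have "\<dots> \<longleftrightarrow> (\<forall>m\<in>active a ` {..n}. cus (\<lambda>i. y (select a n i)) m < h)" by blast
  finally show ?thesis by (auto simp: active_image)
qed

lemma walk_thin_nonneg:
  assumes "m \<le> n"
  shows "(\<forall>k\<le>m. 0 \<le> walk (thin a y) k) \<longleftrightarrow> (\<forall>i\<le>active a m. 0 \<le> walk (\<lambda>i. y (select a n i)) i)"
proof -
  have eq: "walk (thin a y) k = walk (\<lambda>i. y (select a n i)) (active a k)" if "k \<le> m" for k
    using that assms by (intro walk_thin) simp
  have "(\<forall>k\<le>m. 0 \<le> walk (thin a y) k) \<longleftrightarrow> (\<forall>k\<in>{..m}. 0 \<le> walk (\<lambda>i. y (select a n i)) (active a k))"
    by (auto simp: eq)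
  also have "\<dots> \<longleftrightarrow> (\<forall>i\<in>active a ` {..m}. 0 \<le> walk (\<lambda>i. y (select a n i)) i)" by blast
  finally show ?thesis by (auto simp: active_image)
qed

lemma all_le_iff_Icc: "P (0::nat) \<Longrightarrow> (\<forall>k\<le>n. P k) \<longleftrightarrow> (\<forall>k\<in>{1..n}. P k)"
  by (metis One_nat_def Suc_leI atLeastAtMost_iff bot_nat_0.not_eq_extremum)

text \<open>\<open>Y\<close> is indexed from 0, so its entry \<open>i\<close> belongs to epoch
  \<open>Suc i\<close> of the chain. \<open>joint\<close> is the independence of chain and samples,
  in the form of a product law.\<close>

locale thinned_cusum = two_state_chain M \<xi> \<alpha> \<beta> + law: cusum_law \<mu>
  for M :: "'a measure" and \<xi> :: "nat \<Rightarrow> 'a \<Rightarrow> nat" and \<alpha> \<beta> :: real and \<mu> :: "real measure" +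
  fixes Y :: "'a \<Rightarrow> nat \<Rightarrow> real"
  assumes Y_measurable: "Y \<in> measurable M (PiM UNIV (\<lambda>_. borel))"
    and joint: "distr M (PiM UNIV (\<lambda>_. borel) \<Otimes>\<^sub>M PiM UNIV (\<lambda>_. borel)) (\<lambda>\<omega>. ((\<lambda>k. real (\<xi> k \<omega>)), Y \<omega>)) =
      distr M (PiM UNIV (\<lambda>_. borel)) (\<lambda>\<omega> k. real (\<xi> k \<omega>)) \<Otimes>\<^sub>M law.Q"
    and Y_distr: "distr M (PiM UNIV (\<lambda>_. borel)) Y = law.Q"
begin

abbreviation Pb :: "(nat \<Rightarrow> real) measure" where "Pb \<equiv> PiM UNIV (\<lambda>_. borel)"

lemma R_measurable: "(\<lambda>\<omega> k. real (\<xi> k \<omega>)) \<in> measurable M Pb"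
  by (rule measurable_PiM_single') auto

text \<open>Independence lets the chain be frozen while the samples are integrated out.\<close>

lemma nn_joint:
  assumes F: "F \<in> borel_measurable (Pb \<Otimes>\<^sub>M Pb)"
  shows "(\<integral>\<^sup>+\<omega>. F ((\<lambda>k. real (\<xi> k \<omega>)), Y \<omega>) \<partial>M) = (\<integral>\<^sup>+\<omega>. (\<integral>\<^sup>+y. F ((\<lambda>k. real (\<xi> k \<omega>)), y) \<partial>law.Q) \<partial>M)"
proof -
  let ?R = "\<lambda>\<omega> k. real (\<xi> k \<omega>)"
  have s: "sets (Pb \<Otimes>\<^sub>M law.Q) = sets (Pb \<Otimes>\<^sub>M Pb)" "sets (distr M Pb ?R \<Otimes>\<^sub>M law.Q) = sets (Pb \<Otimes>\<^sub>M Pb)"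
    by (auto intro!: sets_pair_measure_cong law.sets_Q)
  have F1: "F \<in> borel_measurable (Pb \<Otimes>\<^sub>M law.Q)" "F \<in> borel_measurable (distr M Pb ?R \<Otimes>\<^sub>M law.Q)"
    using F by (simp_all only: measurable_cong_sets[OF s(1) refl] measurable_cong_sets[OF s(2) refl])
  have "(\<integral>\<^sup>+\<omega>. F (?R \<omega>, Y \<omega>) \<partial>M) = (\<integral>\<^sup>+w. F w \<partial>distr M (Pb \<Otimes>\<^sub>M Pb) (\<lambda>\<omega>. (?R \<omega>, Y \<omega>)))"
    by (rule nn_integral_distr[symmetric, OF measurable_Pair[OF R_measurable Y_measurable]]) (use F in simp)
  also have "\<dots> = (\<integral>\<^sup>+w. F w \<partial>(distr M Pb ?R \<Otimes>\<^sub>M law.Q))" by (simp only: joint)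
  also have "\<dots> = (\<integral>\<^sup>+x. (\<integral>\<^sup>+y. F (x, y) \<partial>law.Q) \<partial>distr M Pb ?R)"
    by (rule law.seq.P.nn_integral_fst[symmetric]) (rule F1)
  also have "\<dots> = (\<integral>\<^sup>+\<omega>. (\<integral>\<^sup>+y. F (?R \<omega>, y) \<partial>law.Q) \<partial>M)"
    by (rule nn_integral_distr[OF R_measurable]) (use law.seq.P.borel_measurable_nn_integral_fst[OF F1(1)] in simp)
  finally show ?thesis .
qed

definition act :: "'a \<Rightarrow> nat \<Rightarrow> bool" where "act \<omega> i \<longleftrightarrow> \<xi> (Suc i) \<omega> = 1"

lemma active_act: "\<omega> \<in> space M \<Longrightarrow> active (act \<omega>) n = cnt n \<omega>"
proof (induction n)
  case (Suc n)
  then show ?case using xi_range[of \<omega> "Suc n"] by (auto simp: active_Suc cnt_Suc act_def)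
qed (simp add: cnt_def)

lemma thin_act: "\<omega> \<in> space M \<Longrightarrow> thin (act \<omega>) y = (\<lambda>i. real (\<xi> (Suc i) \<omega>) * y i)"
  using xi_range by (force simp: thin_def act_def)

lemma mix_measurable: "(\<lambda>w i. fst w (Suc i) * snd w i) \<in> measurable (Pb \<Otimes>\<^sub>M Pb) Pb"
  by (rule measurable_PiM_single') auto

lemma expectation_cnt:
  assumes "\<And>m. 0 \<le> f m"
  shows "(\<integral>\<^sup>+\<omega>. ennreal (f (cnt n \<omega>)) \<partial>M) = ennreal (\<Sum>m\<le>n. f m * D n m)"
proof -
  have "(\<integral>\<^sup>+\<omega>. ennreal (f (cnt n \<omega>)) \<partial>M) = (\<integral>\<^sup>+\<omega>. (\<Sum>m\<le>n. ennreal (f m) * indicator {\<omega> \<in> space M. cnt n \<omega> = m} \<omega>) \<partial>M)"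
  proof (intro nn_integral_cong)
    fix \<omega> assume \<omega>: "\<omega> \<in> space M"
    have "(\<Sum>m\<le>n. ennreal (f m) * indicator {\<omega> \<in> space M. cnt n \<omega> = m} \<omega>) = (\<Sum>m\<le>n. if m = cnt n \<omega> then ennreal (f (cnt n \<omega>)) else 0)"
      using \<omega> by (intro sum.cong) (auto simp: indicator_def)
    then show "ennreal (f (cnt n \<omega>)) = (\<Sum>m\<le>n. ennreal (f m) * indicator {\<omega> \<in> space M. cnt n \<omega> = m} \<omega>)"
      using cnt_le[OF \<omega>, of n] by simp
  qed
  also have "\<dots> = (\<Sum>m\<le>n. ennreal (f m) * emeasure M {\<omega> \<in> space M. cnt n \<omega> = m})"
    by (subst nn_integral_sum) (auto simp: nn_integral_cmult_indicator)
  also have "\<dots> = (\<Sum>m\<le>n. ennreal (f m * D n m))"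
    by (intro sum.cong refl) (simp add: D_eq emeasure_eq_measure ennreal_mult' assms)
  also have "\<dots> = ennreal (\<Sum>m\<le>n. f m * D n m)"
    by (intro sum_ennreal mult_nonneg_nonneg assms D_nonneg)
  finally show ?thesis .
qed

text \<open>Epoch \<open>n + 1\<close> is active with count \<open>m\<close> before it exactly when
  it is activation number \<open>m + 1\<close>; hence the shift in both arguments of
  \<open>A\<close>.\<close>

lemma expectation_cnt_active:
  assumes "\<And>m. 0 \<le> f m"
  shows "(\<integral>\<^sup>+\<omega>. (if act \<omega> n then ennreal (f (cnt n \<omega>)) else 0) \<partial>M) = ennreal (\<Sum>m\<le>n. f m * A (Suc n) (Suc m))"
proof -
  have A: "A (Suc n) (Suc m) = prob {\<omega> \<in> space M. cnt n \<omega> = m \<and> act \<omega> n}" for m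
    unfolding A_def by (intro arg_cong[where f=prob]) (auto simp: cnt_Suc act_def)
  have "(\<integral>\<^sup>+\<omega>. (if act \<omega> n then ennreal (f (cnt n \<omega>)) else 0) \<partial>M) = (\<integral>\<^sup>+\<omega>. (\<Sum>m\<le>n. ennreal (f m) * indicator {\<omega> \<in> space M. cnt n \<omega> = m \<and> act \<omega> n} \<omega>) \<partial>M)"
  proof (intro nn_integral_cong)
    fix \<omega> assume \<omega>: "\<omega> \<in> space M"
    have "(\<Sum>m\<le>n. ennreal (f m) * indicator {\<omega> \<in> space M. cnt n \<omega> = m \<and> act \<omega> n} \<omega>) = (\<Sum>m\<le>n. if m = cnt n \<omega> then (if act \<omega> n then ennreal (f (cnt n \<omega>)) else 0) else 0)"
      using \<omega> by (intro sum.cong) (auto simp: indicator_def)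
    then show "(if act \<omega> n then ennreal (f (cnt n \<omega>)) else 0) = (\<Sum>m\<le>n. ennreal (f m) * indicator {\<omega> \<in> space M. cnt n \<omega> = m \<and> act \<omega> n} \<omega>)"
      using cnt_le[OF \<omega>, of n] by simp
  qed
  also have "\<dots> = (\<Sum>m\<le>n. ennreal (f m) * emeasure M {\<omega> \<in> space M. cnt n \<omega> = m \<and> act \<omega> n})"
    by (subst nn_integral_sum) (auto simp: nn_integral_cmult_indicator act_def)
  also have "\<dots> = (\<Sum>m\<le>n. ennreal (f m * A (Suc n) (Suc m)))"
    by (intro sum.cong refl) (simp add: A emeasure_eq_measure ennreal_mult' assms)
  also have "\<dots> = ennreal (\<Sum>m\<le>n. f m * A (Suc n) (Suc m))"
    by (intro sum_ennreal mult_nonneg_nonneg assms A_nonneg)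
  finally show ?thesis .
qed

end

lemma suminf_ennreal_swap:
  fixes f :: "nat \<Rightarrow> nat \<Rightarrow> ennreal"
  shows "(\<Sum>k. \<Sum>m. f k m) = (\<Sum>m. \<Sum>k. f k m)"
proof -
  have "(\<Sum>m. \<Sum>k. f k m) = (\<integral>\<^sup>+m. (\<Sum>k. f k m) \<partial>count_space UNIV)"
    by (rule nn_integral_count_space_nat[symmetric])
  also have "\<dots> = (\<Sum>k. \<integral>\<^sup>+m. f k m \<partial>count_space UNIV)" by (rule nn_integral_suminf) simp
  finally show ?thesis by (simp only: nn_integral_count_space_nat)
qed

text \<open>Tonelli: summing over the epochs first, every value of the count receives the same total
  weight \<open>q\<close>.\<close>

lemma suminf_ennreal_mixture:
  fixes w :: "nat \<Rightarrow> real" and D :: "nat \<Rightarrow> nat \<Rightarrow> real"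
  assumes w: "\<And>m. 0 \<le> w m" "w sums s" and D: "\<And>k m. 0 \<le> D k m" "\<And>k m. k < m \<Longrightarrow> D k m = 0" "\<And>m. (\<lambda>k. D k m) sums q"
  shows "(\<Sum>k. ennreal (\<Sum>m\<le>k. w m * D k m)) = ennreal (s * q)"
proof -
  have "0 \<le> D 0 0" by (rule D)
  have q: "0 \<le> q" using sums_le[OF D(1) sums_zero D(3)[of 0]] by simp
  have s: "0 \<le> s" using sums_le[OF w(1) sums_zero w(2)] by simp
  have 1: "ennreal (\<Sum>m\<le>k. w m * D k m) = (\<Sum>m. ennreal (w m * D k m))" for k
  proof -
    have "(\<Sum>m. ennreal (w m * D k m)) = (\<Sum>m\<le>k. ennreal (w m * D k m))"
      by (rule suminf_finite) (auto simp: D(2) not_le)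
    then show ?thesis by (simp add: sum_ennreal w(1) D(1))
  qed
  have 2: "(\<Sum>k. ennreal (w m * D k m)) = ennreal (w m * q)" for m
    by (rule suminf_ennreal_eq) (auto simp: w(1) D(1) intro!: sums_mult D(3))
  have "(\<Sum>k. ennreal (\<Sum>m\<le>k. w m * D k m)) = (\<Sum>m. \<Sum>k. ennreal (w m * D k m))"
    unfolding 1 by (rule suminf_ennreal_swap)
  also have "\<dots> = ennreal (s * q)" unfolding 2
    by (rule suminf_ennreal_eq) (auto simp: w(1) q intro!: sums_mult2 w(2))
  finally show ?thesis .
qed

context iid_steps
begin

lemma nn_integral_reindex:
  assumes "inj j" and F: "F \<in> borel_measurable Q"
  shows "(\<integral>\<^sup>+y. F (\<lambda>i. y (j i)) \<partial>Q) = (\<integral>\<^sup>+y. F y \<partial>Q)"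
proof -
  have "distr Q Q (\<lambda>y. \<lambda>n\<in>UNIV. y (j n)) = Q"
    using distr_PiM_reindex[of UNIV "\<lambda>_. \<mu>" j UNIV] assms prob_space_axioms by auto
  then have "distr Q Q (\<lambda>y i. y (j i)) = Q" unfolding restrict_UNIV .
  then have "(\<integral>\<^sup>+y. F y \<partial>Q) = (\<integral>\<^sup>+y. F y \<partial>distr Q Q (\<lambda>y i. y (j i)))" by simp
  also have "\<dots> = (\<integral>\<^sup>+y. F (\<lambda>i. y (j i)) \<partial>Q)"
    by (rule nn_integral_distr[OF reindex_measurable]) (use F in simp)
  finally show ?thesis by simp
qed

end

context thinned_cusum
begin

lemma walk_Pb [measurable]: "(\<lambda>y. walk y n) \<in> borel_measurable Pb"
  unfolding walk_def by measurable

lemma cus_Pb [measurable]: "(\<lambda>y. cus y n) \<in> borel_measurable Pb"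
  by (induction n) auto

lemma nn_Y:
  assumes F: "F \<in> borel_measurable Pb"
  shows "(\<integral>\<^sup>+\<omega>. F (Y \<omega>) \<partial>M) = (\<integral>\<^sup>+y. F y \<partial>law.Q)"
  using nn_integral_distr[OF Y_measurable, of F] F unfolding Y_distr by simp

definition step :: "'a \<Rightarrow> nat \<Rightarrow> real" where "step \<omega> i = real (\<xi> (Suc i) \<omega>) * Y \<omega> i"

lemma step_measurable [measurable]: "step \<in> measurable M Pb"
proof -
  have "(\<lambda>\<omega>. ((\<lambda>k. real (\<xi> k \<omega>)), Y \<omega>)) \<in> measurable M (Pb \<Otimes>\<^sub>M Pb)"
    by (rule measurable_Pair[OF R_measurable Y_measurable])
  from measurable_compose[OF this mix_measurable] show ?thesis
    by (simp add: step_def[abs_def])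
qed

lemma nn_step:
  assumes F: "F \<in> borel_measurable Pb"
  shows "(\<integral>\<^sup>+\<omega>. F (step \<omega>) \<partial>M) = (\<integral>\<^sup>+\<omega>. (\<integral>\<^sup>+y. F (thin (act \<omega>) y) \<partial>law.Q) \<partial>M)"
proof -
  have "(\<integral>\<^sup>+\<omega>. F (step \<omega>) \<partial>M) = (\<integral>\<^sup>+\<omega>. (\<integral>\<^sup>+y. F (\<lambda>i. real (\<xi> (Suc i) \<omega>) * y i) \<partial>law.Q) \<partial>M)"
    using nn_joint[OF measurable_compose[OF mix_measurable F]] by (simp add: step_def[abs_def])
  also have "\<dots> = (\<integral>\<^sup>+\<omega>. (\<integral>\<^sup>+y. F (thin (act \<omega>) y) \<partial>law.Q) \<partial>M)"
    by (intro nn_integral_cong) (simp add: thin_act)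
  finally show ?thesis .
qed

text \<open>For a frozen chain the statistic runs through the ordinary statistic of the selected
  samples. Selection along distinct indices keeps them i.i.d., so the chain matters through the
  count alone.\<close>

lemma survival:
  "prob {\<omega> \<in> space M. \<forall>k\<le>n. cus (step \<omega>) k < h} = (\<Sum>m\<le>n. law.v h m * D n m)"
proof -
  let ?F = "\<lambda>y. ennreal (if \<forall>k\<le>n. cus y k < h then 1 else 0)"
  have F: "?F \<in> borel_measurable Pb" by measurable
  have inner: "(\<integral>\<^sup>+y. ?F (thin (act \<omega>) y) \<partial>law.Q) = ennreal (law.v h (cnt n \<omega>))" if "\<omega> \<in> space M" for \<omega>
  proof -
    let ?G = "\<lambda>y. ennreal (if \<forall>m\<le>cnt n \<omega>. cus y m < h then 1 else 0)"
    have "(\<integral>\<^sup>+y. ?F (thin (act \<omega>) y) \<partial>law.Q) = (\<integral>\<^sup>+y. ?G (\<lambda>i. y (select (act \<omega>) n i)) \<partial>law.Q)"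
      unfolding cus_thin_below active_act[OF that] ..
    also have "\<dots> = (\<integral>\<^sup>+y. ?G y \<partial>law.Q)"
      by (rule law.nn_integral_reindex[OF inj_select]) measurable
    also have "\<dots> = ennreal (law.v h (cnt n \<omega>))" unfolding law.v_def
      by (intro nn_integral_eq_integral law.integrable_if_Q[where B=1]) auto
    finally show ?thesis .
  qed
  have m: "{\<omega> \<in> space M. \<forall>k\<le>n. cus (step \<omega>) k < h} \<in> events"
  proof -
    have [measurable]: "(\<lambda>\<omega>. cus (step \<omega>) k) \<in> borel_measurable M" for k
      by (rule measurable_compose[OF step_measurable cus_Pb])
    show ?thesis by measurable
  qed
  have "emeasure M {\<omega> \<in> space M. \<forall>k\<le>n. cus (step \<omega>) k < h} = (\<integral>\<^sup>+\<omega>. indicator {\<omega> \<in> space M. \<forall>k\<le>n. cus (step \<omega>) k < h} \<omega> \<partial>M)"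
    using m by simp
  also have "\<dots> = (\<integral>\<^sup>+\<omega>. ?F (step \<omega>) \<partial>M)"
    by (intro nn_integral_cong) (simp add: indicator_def)
  also have "\<dots> = (\<integral>\<^sup>+\<omega>. (\<integral>\<^sup>+y. ?F (thin (act \<omega>) y) \<partial>law.Q) \<partial>M)" by (rule nn_step[OF F])
  also have "\<dots> = (\<integral>\<^sup>+\<omega>. ennreal (law.v h (cnt n \<omega>)) \<partial>M)" by (intro nn_integral_cong inner)
  also have "\<dots> = ennreal (\<Sum>m\<le>n. law.v h m * D n m)" by (rule expectation_cnt) (rule law.v_bounds)
  finally show ?thesis
    by (simp add: emeasure_eq_measure sum_nonneg law.v_bounds D_nonneg)
qed

lemma survival_limit:
  assumes X: "filterlim X at_top sequentially" and x: "0 < x"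
  shows "(\<lambda>j. prob {\<omega> \<in> space M. \<forall>k\<le>nat \<lfloor>x / exp (- X j)\<rfloor>. cus (step \<omega>) k < X j}) \<longlonglongrightarrow> exp (- law.lam * (stat1 * x))"
  unfolding survival
proof (rule thinned_limit[where v="\<lambda>j. law.v (X j)" and a="\<lambda>j. exp (- X j)"])
  show "(\<lambda>n. exp (- X n)) \<longlonglongrightarrow> 0"
    using X by (intro filterlim_compose[OF exp_at_bot]) (simp add: filterlim_uminus_at_bot)
qed (use D_nonneg D_total D_concentration stat1_pos law.v_bounds law.v_antimono law.v_exponential[OF X] x in auto)

lemma survival_sum:
  assumes "0 < h" "0 < law.p h"
  shows "(\<Sum>n. ennreal (prob {\<omega> \<in> space M. \<forall>k\<le>n. cus (step \<omega>) k < h})) = ennreal ((\<Sum>m. law.v h m) * (1 / stat1))"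
  unfolding survival
  by (rule suminf_ennreal_mixture)
    (use law.v_bounds summable_sums[OF law.v_sum(1)[OF assms]] D_nonneg D_sums AB_zero in \<open>auto simp: D_def\<close>)

text \<open>A first strict descent occurs at an active epoch and is then one of the sampled walk. As
  that walk almost surely never returns to 0, strict and weak descents agree, and the increments
  \<open>e\<close> of the ordinary ladder height appear.\<close>

lemma ladder_part:
  assumes noret: "AE y in law.Q. \<forall>n\<ge>1. walk y n \<noteq> 0"
  shows "(\<integral>\<^sup>+\<omega>. ennreal (if (\<forall>j\<in>{1..k}. walk (step \<omega>) j \<notin> {..<0}) \<and> walk (step \<omega>) (Suc k) \<in> {..<0} then - walk (step \<omega>) (Suc k) else 0) \<partial>M)
    = ennreal (\<Sum>m\<le>k. - law.e m * A (Suc k) (Suc m))"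
proof -
  let ?F = "\<lambda>y. ennreal (if (\<forall>j\<in>{1..k}. walk y j \<notin> {..<0}) \<and> walk y (Suc k) \<in> {..<0} then - walk y (Suc k) else 0)"
  have F: "?F \<in> borel_measurable Pb" by measurable
  have inner: "(\<integral>\<^sup>+y. ?F (thin (act \<omega>) y) \<partial>law.Q) = (if act \<omega> k then ennreal (- law.e (cnt k \<omega>)) else 0)" if \<omega>: "\<omega> \<in> space M" for \<omega>
  proof (cases "act \<omega> k")
    case False
    \<comment> \<open>An idle epoch leaves the walk in place, so it cannot be the first descent; for
      \<open>k = 0\<close> the walk is still at 0.\<close>
    have "?F (thin (act \<omega>) y) = 0" for y
    proof -
      have "walk (thin (act \<omega>) y) (Suc k) = walk (thin (act \<omega>) y) k" using False by (simp add: walk_Suc thin_def)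
      then show ?thesis by (cases k) auto
    qed
    then show ?thesis using False by simp
  next
    case True
    let ?m = "cnt k \<omega>"
    let ?G = "\<lambda>y. ennreal (if (\<forall>i\<le>?m. 0 \<le> walk y i) \<and> walk y (Suc ?m) < 0 then - walk y (Suc ?m) else 0)"
    have eq: "?F (thin (act \<omega>) y) = ?G (\<lambda>i. y (select (act \<omega>) (Suc k) i))" for y
    proof -
      have "walk (thin (act \<omega>) y) (Suc k) = walk (\<lambda>i. y (select (act \<omega>) (Suc k) i)) (Suc ?m)"
        using walk_thin[of "Suc k" "Suc k" "act \<omega>" y] True active_act[OF \<omega>] by (simp add: active_Suc)
      moreover have "(\<forall>j\<in>{1..k}. walk (thin (act \<omega>) y) j \<notin> {..<0}) \<longleftrightarrow> (\<forall>i\<le>?m. 0 \<le> walk (\<lambda>i. y (select (act \<omega>) (Suc k) i)) i)"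
      proof -
        have "(\<forall>j\<in>{1..k}. walk (thin (act \<omega>) y) j \<notin> {..<0}) \<longleftrightarrow> (\<forall>j\<le>k. 0 \<le> walk (thin (act \<omega>) y) j)"
          by (subst all_le_iff_Icc) (auto simp: not_less)
        then show ?thesis using walk_thin_nonneg[of k "Suc k" "act \<omega>" y] active_act[OF \<omega>] by simp
      qed
      ultimately show ?thesis by simp
    qed
    have "(\<integral>\<^sup>+y. ?F (thin (act \<omega>) y) \<partial>law.Q) = (\<integral>\<^sup>+y. ?G (\<lambda>i. y (select (act \<omega>) (Suc k) i)) \<partial>law.Q)"
      by (simp only: eq)
    also have "\<dots> = (\<integral>\<^sup>+y. ?G y \<partial>law.Q)"
      by (rule law.nn_integral_reindex[OF inj_select]) measurable
    also have "\<dots> = (\<integral>\<^sup>+y. ennreal (- (if law.hit ?m y then walk y (Suc ?m) else 0)) \<partial>law.Q)"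
    proof (rule nn_integral_cong_AE)
      show "AE y in law.Q. ?G y = ennreal (- (if law.hit ?m y then walk y (Suc ?m) else 0))"
        using noret
      proof eventually_elim
        fix y assume n: "\<forall>n\<ge>1. walk y n \<noteq> 0"
        have "(\<forall>i\<le>?m. 0 \<le> walk y i) \<longleftrightarrow> pos_upto ?m y"
          unfolding pos_upto_def using n by (subst all_le_iff_Icc) (auto simp: less_le)
        moreover have "walk y (Suc ?m) \<noteq> 0" using n by simp
        ultimately show "?G y = ennreal (- (if law.hit ?m y then walk y (Suc ?m) else 0))"
          by (auto simp: law.hit_def)
      qed
    qed
    also have "\<dots> = ennreal (- law.e ?m)"
    proof -
      have i: "integrable law.Q (\<lambda>y. if law.hit ?m y then walk y (Suc ?m) else 0)"
        by (rule law.integrable_if_walk) (rule law.hit_measurable)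
      have "(\<integral>\<^sup>+y. ennreal (- (if law.hit ?m y then walk y (Suc ?m) else 0)) \<partial>law.Q) = ennreal (\<integral>y. - (if law.hit ?m y then walk y (Suc ?m) else 0) \<partial>law.Q)"
        by (rule nn_integral_eq_integral[OF integrable_minus[OF i]]) (auto simp: law.hit_def)
      then show ?thesis by (simp add: law.e_def)
    qed
    finally show ?thesis using True by simp
  qed
  have "(\<integral>\<^sup>+\<omega>. ?F (step \<omega>) \<partial>M) = (\<integral>\<^sup>+\<omega>. (\<integral>\<^sup>+y. ?F (thin (act \<omega>) y) \<partial>law.Q) \<partial>M)" by (rule nn_step[OF F])
  also have "\<dots> = (\<integral>\<^sup>+\<omega>. (if act \<omega> k then ennreal (- law.e (cnt k \<omega>)) else 0) \<partial>M)" by (intro nn_integral_cong inner)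
  also have "\<dots> = ennreal (\<Sum>m\<le>k. - law.e m * A (Suc k) (Suc m))"
    by (rule expectation_cnt_active) (use law.e_nonpos in simp)
  finally show ?thesis .
qed

text \<open>Each activation number is attained at exactly one epoch almost surely, so every
  \<open>e m\<close> gets total weight 1: idle epochs delay the descent but do not change its
  height. With \<open>uminus\<close> the default value 0 contributes nothing.\<close>

lemma ladder_mean:
  assumes noret: "AE y in law.Q. \<forall>n\<ge>1. walk y n \<noteq> 0"
  shows "(\<integral>\<omega>. value_at (\<lambda>n \<omega>. walk (step \<omega>) n) (first_entry (\<lambda>n \<omega>. walk (step \<omega>) n) {..<0}) \<omega> \<partial>M) =
    (\<integral>z. z \<partial>\<mu>) * (\<Sum>k. law.t k)"
proof -
  let ?W = "\<lambda>n \<omega>. walk (step \<omega>) n"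
  let ?s = "- ((\<integral>z. z \<partial>\<mu>) * (\<Sum>k. law.t k))"
  have e: "(\<lambda>m. - law.e m) sums ?s" using law.wald by (rule sums_minus)
  have A1: "(\<lambda>k. A (Suc k) (Suc m)) sums 1" for m
  proof -
    have "(\<lambda>k. A k (Suc m)) sums (1 + A 0 (Suc m))" using AB_sums(1)[of "Suc m"] by (simp add: A_0)
    then show ?thesis by (rule iffD2[OF sums_Suc_iff])
  qed
  have "(\<integral>\<omega>. - (value_at ?W (first_entry ?W {..<0}) \<omega>) \<partial>M) = ?s"
  proof (rule expectation_at_first_entry[where f=uminus])
    show "?W k \<in> borel_measurable M" for k by (rule measurable_compose[OF step_measurable walk_Pb])
    show "(\<integral>\<^sup>+\<omega>. ennreal (if (\<forall>j\<in>{1..k}. walk (step \<omega>) j \<notin> {..<0}) \<and> walk (step \<omega>) (Suc k) \<in> {..<0} then - walk (step \<omega>) (Suc k) else 0) \<partial>M)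
      = ennreal (\<Sum>m\<le>k. - law.e m * A (Suc k) (Suc m))" for k
      by (rule ladder_part[OF noret])
    have "(\<Sum>k. ennreal (\<Sum>m\<le>k. - law.e m * A (Suc k) (Suc m))) = ennreal (?s * 1)"
    proof (rule suminf_ennreal_mixture[OF _ e _ _ A1])
      show "0 \<le> - law.e m" for m using law.e_nonpos by simp
      show "0 \<le> A (Suc k) (Suc m)" for k m by (rule A_nonneg)
      show "A (Suc k) (Suc m) = 0" if "k < m" for k m using AB_zero[of "Suc k" "Suc m"] that by simp
    qed
    then show "(\<Sum>k. ennreal (\<Sum>m\<le>k. - law.e m * A (Suc k) (Suc m))) = ennreal ?s" by simp
    show "0 \<le> ?s" using sums_le[OF _ sums_zero e] law.e_nonpos by simp
  qed auto
  then show ?thesis by simp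
qed

lemma ordinary_survival:
  "prob {\<omega> \<in> space M. \<forall>k\<in>{1..n}. walk (Y \<omega>) k \<notin> {..0}} = law.t n"
proof -
  have [measurable]: "(\<lambda>\<omega>. walk (Y \<omega>) k) \<in> borel_measurable M" for k
    by (rule measurable_compose[OF Y_measurable walk_Pb])
  have m: "{\<omega> \<in> space M. \<forall>k\<in>{1..n}. walk (Y \<omega>) k \<notin> {..0}} \<in> events" by measurable
  have pu: "(\<forall>k\<in>{1..n}. walk y k \<notin> {..0}) \<longleftrightarrow> pos_upto n y" for y by (auto simp: pos_upto_def not_le)
  have "emeasure M {\<omega> \<in> space M. \<forall>k\<in>{1..n}. walk (Y \<omega>) k \<notin> {..0}} = (\<integral>\<^sup>+\<omega>. indicator {\<omega> \<in> space M. \<forall>k\<in>{1..n}. walk (Y \<omega>) k \<notin> {..0}} \<omega> \<partial>M)"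
    using m by simp
  also have "\<dots> = (\<integral>\<^sup>+\<omega>. ennreal (if \<forall>k\<in>{1..n}. walk (Y \<omega>) k \<notin> {..0} then 1 else 0) \<partial>M)"
    by (intro nn_integral_cong) (simp add: indicator_def)
  also have "\<dots> = (\<integral>\<^sup>+y. ennreal (if \<forall>k\<in>{1..n}. walk y k \<notin> {..0} then 1 else 0) \<partial>law.Q)"
    by (rule nn_Y) measurable
  also have "\<dots> = ennreal (law.t n)" unfolding pu law.t_def
    by (intro nn_integral_eq_integral law.integrable_if_Q[where B=1]) auto
  finally show ?thesis by (simp add: emeasure_eq_measure law.t_nonneg)
qed

lemma ordinary_mean:
  "mean_time M (first_entry (\<lambda>n \<omega>. walk (Y \<omega>) n) {..0}) = ennreal (\<Sum>k. law.t k)"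
proof -
  have "mean_time M (first_entry (\<lambda>n \<omega>. walk (Y \<omega>) n) {..0}) = (\<Sum>n. ennreal (law.t n))"
    unfolding ordinary_survival[symmetric]
    by (rule mean_first_entry) (auto intro: measurable_compose[OF Y_measurable walk_Pb])
  also have "\<dots> = ennreal (\<Sum>k. law.t k)"
    by (rule suminf_ennreal_eq) (auto simp: law.t_nonneg intro!: summable_sums law.t_summable)
  finally show ?thesis .
qed

lemma ordinary_exp:
  "(\<integral>\<omega>. exp (value_at (\<lambda>n \<omega>. walk (Y \<omega>) n) (first_entry (\<lambda>n \<omega>. walk (Y \<omega>) n) {..0}) \<omega>) \<partial>M) = law.eta"
proof (rule expectation_at_first_entry)
  let ?W = "\<lambda>n \<omega>. walk (Y \<omega>) n"
  show W [measurable]: "?W k \<in> borel_measurable M" for k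
    by (rule measurable_compose[OF Y_measurable walk_Pb])
  have m: "{\<omega> \<in> space M. \<forall>k. walk (Y \<omega>) (Suc k) \<notin> {..0}} \<in> events" by measurable
  have "prob {\<omega> \<in> space M. \<forall>k. walk (Y \<omega>) (Suc k) \<notin> {..0}} \<le> law.t n" for n
    unfolding ordinary_survival[symmetric]
  proof (rule finite_measure_mono)
    show "{\<omega> \<in> space M. \<forall>k. walk (Y \<omega>) (Suc k) \<notin> {..0}} \<subseteq> {\<omega> \<in> space M. \<forall>k\<in>{1..n}. walk (Y \<omega>) k \<notin> {..0}}"
    proof safe
      fix \<omega> k assume "\<forall>k. walk (Y \<omega>) (Suc k) \<notin> {..0}" "k \<in> {1..n}" "walk (Y \<omega>) k \<le> 0"
      then show False by (cases k) auto
    qed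
  qed measurable
  then have "prob {\<omega> \<in> space M. \<forall>k. walk (Y \<omega>) (Suc k) \<notin> {..0}} \<le> 0"
    by (intro LIMSEQ_le_const[OF law.t_tendsto_0]) auto
  then have "prob {\<omega> \<in> space M. \<forall>k. walk (Y \<omega>) (Suc k) \<notin> {..0}} = 0" by (simp add: measure_le_0_iff)
  then have "AE \<omega> in M. \<not> (\<forall>k. walk (Y \<omega>) (Suc k) \<notin> {..0})"
    using m by (subst (asm) prob_Collect_eq_0) auto
  \<comment> \<open>Since \<open>exp 0\<close> is not 0, the default value would count here; the
    ladder epoch must be almost surely finite, which holds because its tail \<open>t\<close> tends
    to 0.\<close>
  then show "AE \<omega> in M. first_entry ?W {..0} \<omega> = \<infinity> \<longrightarrow> exp 0 = (0::real)"
  proof eventually_elim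
    fix \<omega> assume n: "\<not> (\<forall>k. walk (Y \<omega>) (Suc k) \<notin> {..0})"
    have "first_entry ?W {..0} \<omega> \<noteq> \<infinity>"
    proof
      assume inf: "first_entry ?W {..0} \<omega> = \<infinity>"
      have "walk (Y \<omega>) (Suc k) \<notin> {..0}" for k
        using enat_less_first_entry[of "Suc k" ?W "{..0}" \<omega>] inf by simp
      then show False using n by blast
    qed
    then show "first_entry ?W {..0} \<omega> = \<infinity> \<longrightarrow> exp 0 = (0::real)" by simp
  qed
  show "(\<integral>\<^sup>+\<omega>. ennreal (if (\<forall>j\<in>{1..k}. walk (Y \<omega>) j \<notin> {..0}) \<and> walk (Y \<omega>) (Suc k) \<in> {..0} then exp (walk (Y \<omega>) (Suc k)) else 0) \<partial>M) = ennreal (law.eta_n k)" for k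
  proof -
    have hit: "((\<forall>j\<in>{1..k}. walk y j \<notin> {..0}) \<and> walk y (Suc k) \<in> {..0}) \<longleftrightarrow> law.hit k y" for y
      by (auto simp: law.hit_def pos_upto_def not_le)
    have "(\<integral>\<^sup>+\<omega>. ennreal (if (\<forall>j\<in>{1..k}. walk (Y \<omega>) j \<notin> {..0}) \<and> walk (Y \<omega>) (Suc k) \<in> {..0} then exp (walk (Y \<omega>) (Suc k)) else 0) \<partial>M) =
      (\<integral>\<^sup>+y. ennreal (if (\<forall>j\<in>{1..k}. walk y j \<notin> {..0}) \<and> walk y (Suc k) \<in> {..0} then exp (walk y (Suc k)) else 0) \<partial>law.Q)"
      by (rule nn_Y) measurable
    also have "\<dots> = ennreal (law.eta_n k)" unfolding hit law.eta_n_def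
      by (intro nn_integral_eq_integral law.integrable_if_Q[where B=1]) (auto simp: law.hit_def)
    finally show ?thesis .
  qed
  show "(\<Sum>k. ennreal (law.eta_n k)) = ennreal law.eta" unfolding law.eta_def
    by (rule suminf_ennreal_eq) (auto simp: law.eta_n_bounds intro!: summable_sums law.eta_summable)
  show "0 \<le> law.eta" unfolding law.eta_def by (intro suminf_nonneg law.eta_summable law.eta_n_bounds)
qed auto

end

section \<open>From densities to the step law, and the final assembly\<close>

lemma cusum_law_llr:
  fixes f0 f1 :: "real \<Rightarrow> real"
  defines "\<mu> \<equiv> distr (density lborel (\<lambda>x. ennreal (f0 x))) borel (llr f0 f1)"
  assumes f0: "prob_density f0" and f1: "prob_density f1"
    and fin1: "finite_llr_integral f0 f1 f1" and fin0: "finite_llr_integral f0 f1 f0"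
    and KL: "0 < (LINT x|lborel. llr f0 f1 x * f1 x)"
    and nonarith: "\<nexists>d. AE z in \<mu>. \<exists>m::int. z = d * of_int m"
    and pos: "0 < measure \<mu> {0<..}" and neg: "0 < measure \<mu> {..<0}"
  shows "cusum_law \<mu>"
    and "(\<integral>z. z \<partial>\<mu>) = (LINT x|lborel. llr f0 f1 x * f0 x)"
    and "(\<integral>z. z * exp z \<partial>\<mu>) = (LINT x|lborel. llr f0 f1 x * f1 x)"
proof -
  let ?d = "density lborel (\<lambda>x. ennreal (f0 x))"
  have [measurable]: "f0 \<in> borel_measurable borel" "f1 \<in> borel_measurable borel"
    using f0 f1 by (auto simp: prob_density_def)
  have f0n: "0 \<le> f0 x" and f1n: "0 \<le> f1 x" for x using f0 f1 by (auto simp: prob_density_def)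
  have L [measurable]: "llr f0 f1 \<in> borel_measurable borel"
    unfolding llr_def[abs_def] by measurable
  have Ld: "llr f0 f1 \<in> measurable ?d borel" by measurable
  have A0: "AE x in lborel. 0 < f0 x \<longrightarrow> 0 < f1 x"
    using fin0 by (auto simp: finite_llr_integral_def AE_density elim!: eventually_mono)
  have A1: "AE x in lborel. 0 < f1 x \<longrightarrow> 0 < f0 x"
    using fin1 by (auto simp: finite_llr_integral_def AE_density elim!: eventually_mono)
  \<comment> \<open>With \<open>ln 0 = 0\<close> and division by 0 equal to 0 this could fail where
    exactly one density vanishes. The finiteness conditions exclude such points almost everywhere,
    and where both vanish the equation reads \<open>0 = 0\<close>.\<close>
  have ex: "AE x in lborel. f0 x * exp (llr f0 f1 x) = f1 x"
    using A0 A1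
  proof eventually_elim
    fix x assume a: "0 < f0 x \<longrightarrow> 0 < f1 x" "0 < f1 x \<longrightarrow> 0 < f0 x"
    show "f0 x * exp (llr f0 f1 x) = f1 x"
    proof (cases "0 < f0 x")
      case True
      then show ?thesis using a(1) by (simp add: llr_def)
    next
      case False
      then have "f0 x = 0" using f0n[of x] by simp
      moreover have "f1 x = 0" using False a(2) f1n[of x] by force
      ultimately show ?thesis by simp
    qed
  qed
  have ex2: "AE x in lborel. f0 x * (llr f0 f1 x * exp (llr f0 f1 x)) = llr f0 f1 x * f1 x"
    using ex by eventually_elim (simp add: algebra_simps)
  have tr: "(\<integral>z. g z \<partial>\<mu>) = (\<integral>x. f0 x * g (llr f0 f1 x) \<partial>lborel)"
    "integrable \<mu> g \<longleftrightarrow> integrable lborel (\<lambda>x. f0 x * g (llr f0 f1 x))"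
    if g: "g \<in> borel_measurable borel" for g :: "real \<Rightarrow> real"
  proof -
    have gL: "(\<lambda>x. g (llr f0 f1 x)) \<in> borel_measurable lborel"
      using measurable_compose[OF L g] by simp
    show "(\<integral>z. g z \<partial>\<mu>) = (\<integral>x. f0 x * g (llr f0 f1 x) \<partial>lborel)"
      unfolding \<mu>_def using gL f0n by (subst integral_distr[OF Ld g], subst integral_density) auto
    show "integrable \<mu> g \<longleftrightarrow> integrable lborel (\<lambda>x. f0 x * g (llr f0 f1 x))"
      unfolding \<mu>_def using gL f0n by (subst integrable_distr_eq[OF Ld g], subst integrable_density) auto
  qed
  have f1d: "integrable lborel f1" "(\<integral>x. f1 x \<partial>lborel) = 1"
  proof -
    interpret P1: prob_space "density lborel (\<lambda>x. ennreal (f1 x))" using f1 by (simp add: prob_density_def)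
    have e: "(\<integral>\<^sup>+x. ennreal (f1 x) \<partial>lborel) = 1"
      using P1.emeasure_space_1 by (simp add: emeasure_density)
    show i: "integrable lborel f1" using e f1n by (intro integrableI_nonneg) auto
    show "(\<integral>x. f1 x \<partial>lborel) = 1" using e f1n by (subst integral_eq_nn_integral) auto
  qed
  have m: "(\<lambda>z::real. exp z) \<in> borel_measurable borel" "(\<lambda>z::real. z) \<in> borel_measurable borel"
    "(\<lambda>z::real. z * exp z) \<in> borel_measurable borel" by measurable
  have m': "(\<lambda>x. f0 x * exp (llr f0 f1 x)) \<in> borel_measurable lborel"
    "(\<lambda>x. f0 x * (llr f0 f1 x * exp (llr f0 f1 x))) \<in> borel_measurable lborel"
    "f1 \<in> borel_measurable lborel" "(\<lambda>x. llr f0 f1 x * f1 x) \<in> borel_measurable lborel" by measurable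
  show z: "(\<integral>z. z \<partial>\<mu>) = (LINT x|lborel. llr f0 f1 x * f0 x)"
    unfolding tr(1)[OF m(2)] by (simp only: mult.commute)
  show ze: "(\<integral>z. z * exp z \<partial>\<mu>) = (LINT x|lborel. llr f0 f1 x * f1 x)"
    unfolding tr(1)[OF m(3)] by (rule integral_cong_AE[OF m'(2,4) ex2])
  interpret D: prob_space ?d using f0 by (simp add: prob_density_def)
  interpret mu: prob_space \<mu> unfolding \<mu>_def by (rule D.prob_space_distr[OF Ld])
  show "cusum_law \<mu>"
  proof
    show "sets \<mu> = sets borel" by (simp add: \<mu>_def)
    show "integrable \<mu> (\<lambda>z. exp z)"
      unfolding tr(2)[OF m(1)] integrable_cong_AE[OF m'(1,3) ex] by (rule f1d)
    show "(\<integral>z. exp z \<partial>\<mu>) = 1"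
      unfolding tr(1)[OF m(1)] integral_cong_AE[OF m'(1,3) ex] by (rule f1d)
    show "integrable \<mu> (\<lambda>z. z)"
      unfolding tr(2)[OF m(2)] using fin0 by (simp add: finite_llr_integral_def mult.commute)
    show "integrable \<mu> (\<lambda>z. z * exp z)"
      unfolding tr(2)[OF m(3)] integrable_cong_AE[OF m'(2,4) ex2] using fin1 by (simp add: finite_llr_integral_def)
    show "0 < (\<integral>z. z * exp z \<partial>\<mu>)" unfolding ze by (rule KL)
  qed (fact nonarith pos neg)+
qed

text \<open>State 0 is absorbing when \<open>\<alpha>\<close> is 1, and likewise state 1 when
  \<open>\<beta>\<close> is 1; irreducibility thus yields the strict bounds
  \<open>\<alpha> < 1\<close> and \<open>\<beta> < 1\<close>.\<close>

lemma two_state_n_step_0: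
  "n_step {0, 1} (two_state_matrix 1 \<beta>) n 0 1 = 0"
  by (induction n) (simp_all add: two_state_matrix_def)

lemma two_state_n_step_1:
  "n_step {0, 1} (two_state_matrix \<alpha> 1) n 1 0 = 0"
  by (induction n) (simp_all add: two_state_matrix_def)

lemma cusum_eq_cus: "cusum Y k \<omega> = cus (\<lambda>i. Y (Suc i) \<omega>) k"
  by (induction k) simp_all

lemma partial_sums_eq_walk: "partial_sums Y n \<omega> = walk (\<lambda>i. Y (Suc i) \<omega>) n"
  unfolding partial_sums_def walk_def
  by (induction n) simp_all

lemma (in prob_space) indep_vars_inj_reindex:
  assumes f: "inj f" and X: "indep_vars N X (f ` I)"
  shows "indep_vars (\<lambda>i. N (f i)) (\<lambda>i. X (f i)) I"
proof -
  have "indep_sets (\<lambda>i. F (f i)) I" if F: "indep_sets F (f ` I)" for F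
    unfolding indep_sets_def
  proof (intro conjI ballI allI impI)
    show "F (f i) \<subseteq> events" if "i \<in> I" for i using F that by (auto simp: indep_sets_def)
    fix J A assume J: "J \<subseteq> I" "J \<noteq> {}" "finite J" and A: "A \<in> Pi J (\<lambda>i. F (f i))"
    have "prob (\<Inter>j\<in>f ` J. A (inv f j)) = (\<Prod>j\<in>f ` J. prob (A (inv f j)))"
      by (rule indep_setsD[OF F]) (use J A f in \<open>auto simp: Pi_def\<close>)
    then show "prob (\<Inter>j\<in>J. A j) = (\<Prod>j\<in>J. prob (A j))"
      using f by (simp add: prod.reindex inj_on_subset[OF f])
  qed
  from this[of "\<lambda>i. {X i -` A \<inter> space M | A. A \<in> sets (N i)}"] X show ?thesis
    unfolding indep_vars_def2 by auto
qed

theorem theorem3: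
  fixes M :: "'a measure"
    and f0 f1 :: "real \<Rightarrow> real"
    and X Z S St W :: "nat \<Rightarrow> 'a \<Rightarrow> real"
    and \<xi> :: "nat \<Rightarrow> 'a \<Rightarrow> nat"
    and \<tau> :: "real \<Rightarrow> 'a \<Rightarrow> enat"
    and K1 T_minus :: "'a \<Rightarrow> enat"
    and \<alpha> \<beta> I_KL I_0 c_inf \<beta>_MRW :: real
    and stat :: "nat \<Rightarrow> real"
  assumes M: "prob_space M"
    and f0: "prob_density f0"
    and f1: "prob_density f1"
    and ac: "absolutely_continuous (density lborel (\<lambda>x. ennreal (f0 x)))
                                   (density lborel (\<lambda>x. ennreal (f1 x)))"
    and X_density: "\<And>k. 1 \<le> k \<Longrightarrow> distributed M lborel (X k) (\<lambda>x. ennreal (f0 x))"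
    and X_indep: "prob_space.indep_vars M (\<lambda>_. borel) X {1..}"
    and Z_eq: "\<And>k \<omega>. Z k \<omega> = llr f0 f1 (X k \<omega>)"
    and chain: "markov_chain M {0, 1} (two_state_matrix \<alpha> \<beta>) \<xi>"
    and irreducible: "irreducible_matrix {0, 1} (two_state_matrix \<alpha> \<beta>)"
    and aperiodic: "aperiodic_matrix {0, 1} (two_state_matrix \<alpha> \<beta>)"
    and \<alpha>_pos: "0 < \<alpha>"
    and \<beta>_pos: "0 < \<beta>"
    and \<xi>_start: "AE \<omega> in M. \<xi> 0 \<omega> = 1"
    and \<xi>_X_indep: "prob_space.indep_var M
           (\<Pi>\<^sub>M k\<in>UNIV. borel) (\<lambda>\<omega> k. real (\<xi> k \<omega>))
           (\<Pi>\<^sub>M k\<in>{1..}. borel) (\<lambda>\<omega>. \<lambda>k\<in>{1..}. X k \<omega>)"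
    and stationary: "stationary_distribution {0, 1} (two_state_matrix \<alpha> \<beta>) stat"
    and Z_non_arithmetic: "non_arithmetic M (Z 1)"
    and Z_pos: "0 < \<P>(\<omega> in M. 0 < Z 1 \<omega>)"
    and Z_neg: "0 < \<P>(\<omega> in M. Z 1 \<omega> < 0)"
    and I_KL_eq: "I_KL = (LINT x|lborel. llr f0 f1 x * f1 x)"
    and I_KL_finite: "finite_llr_integral f0 f1 f1"
    and I_KL_pos: "0 < I_KL"
    and I_0_eq: "I_0 = - (LINT x|lborel. llr f0 f1 x * f0 x)"
    and I_0_finite: "finite_llr_integral f0 f1 f0"
    and I_0_pos: "0 < I_0"
    and S_eq: "S = partial_sums Z"
    and no_return: "AE \<omega> in M. \<forall>n\<ge>1. S n \<omega> \<noteq> 0"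
    and St_eq: "St = partial_sums (\<lambda>k \<omega>. real (\<xi> k \<omega>) * Z k \<omega>)"
    and W_eq: "W = cusum (\<lambda>k \<omega>. real (\<xi> k \<omega>) * Z k \<omega>)"
    and \<tau>_eq: "\<And>h. \<tau> h = first_entry W {h..}"
    and K1_eq: "K1 = first_entry St {..<0}"
    and T_minus_eq: "T_minus = first_entry S {..0}"
    and c_inf_eq: "c_inf = (1 - (LINT \<omega>|M. exp (value_at S T_minus \<omega>)))\<^sup>2 /
                           (I_KL * enn2real (mean_time M T_minus))"
    and \<beta>_MRW_eq: "\<beta>_MRW = - (stat 1 * I_0 * c_inf) / (LINT \<omega>|M. value_at St K1 \<omega>)"
  shows "(\<forall>x>0. ((\<lambda>h. \<P>(\<omega> in M. ereal (exp (- h)) * ereal_of_enat (\<tau> h \<omega>) > ereal x))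
                   \<longlongrightarrow> exp (- \<beta>_MRW * x)) at_top) \<and>
         (\<exists>\<epsilon> :: real \<Rightarrow> real. (\<epsilon> \<longlongrightarrow> 0) at_top \<and>
            (\<forall>\<^sub>F h in at_top. mean_time M (\<tau> h) = ennreal (exp h / \<beta>_MRW * (1 + \<epsilon> h))))"
proof -
  interpret M: prob_space M by (rule M)
  define \<mu> where "\<mu> = distr (density lborel (\<lambda>x. ennreal (f0 x))) borel (llr f0 f1)"
  define Y where "Y = (\<lambda>\<omega> i. Z (Suc i) \<omega>)"
  have f0m [measurable]: "f0 \<in> borel_measurable borel" and f1m [measurable]: "f1 \<in> borel_measurable borel"
    using f0 f1 by (auto simp: prob_density_def)
  have L [measurable]: "llr f0 f1 \<in> borel_measurable borel"
    unfolding llr_def[abs_def] by measurable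
  have Xm: "X k \<in> borel_measurable M" if "1 \<le> k" for k
    using distributed_measurable[OF X_density[OF that]] by simp
  have Zm: "Z (Suc k) \<in> borel_measurable M" for k
    using measurable_compose[OF Xm L, of "Suc k"] by (simp add: Z_eq[abs_def])
  have Zd: "distr M borel (Z (Suc k)) = \<mu>" for k
  proof -
    have "distr M borel (X (Suc k)) = density lborel (\<lambda>x. ennreal (f0 x))"
      using distributed_distr_eq_density[OF X_density[of "Suc k"]]
      by (simp add: distr_cong[OF refl sets_lborel[symmetric] refl])
    moreover have "distr (distr M borel (X (Suc k))) borel (llr f0 f1) = distr M borel (Z (Suc k))"
      using Xm[of "Suc k"] by (subst distr_distr) (auto simp: comp_def Z_eq[abs_def])
    ultimately show ?thesis by (simp add: \<mu>_def)
  qed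
  have mu_prob: "measure \<mu> B = \<P>(\<omega> in M. Z 1 \<omega> \<in> B)" if "B \<in> sets borel" for B
    unfolding Zd[of 0, symmetric] using Zm[of 0] that
    by (subst measure_distr) (auto simp: vimage_def Int_def conj_commute)
  have AEmu: "(AE z in \<mu>. P z) \<longleftrightarrow> (AE \<omega> in M. P (Z 1 \<omega>))" if "{z. P z} \<in> sets borel" for P
    unfolding Zd[of 0, symmetric] using Zm[of 0] that by (subst AE_distr_iff) auto
  have nonarith: "\<nexists>d. AE z in \<mu>. \<exists>m::int. z = d * of_int m"
  proof -
    have "{z. \<exists>m::int. z = d * of_int m} \<in> sets borel" for d :: real
    proof -
      have "{z. \<exists>m::int. z = d * of_int m} = range (\<lambda>m::int. d * of_int m)" by auto
      then have "countable {z. \<exists>m::int. z = d * of_int m}" by simp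
      then show ?thesis by (rule sets.countable[rotated]) auto
    qed
    from AEmu[OF this] show ?thesis using Z_non_arithmetic by (simp add: non_arithmetic_def)
  qed
  have pos: "0 < measure \<mu> {0<..}" and neg: "0 < measure \<mu> {..<0}"
    using Z_pos Z_neg mu_prob[of "{0<..}"] mu_prob[of "{..<0}"] by auto
  note llr_law = cusum_law_llr[OF f0 f1 I_KL_finite I_0_finite, folded I_KL_eq \<mu>_def, OF I_KL_pos nonarith pos neg]
  interpret law: cusum_law \<mu> by (rule llr_law(1))
  have mean: "(\<integral>z. z \<partial>\<mu>) = - I_0" using llr_law(2) I_0_eq by simp
  have KL: "law.I_KL = I_KL" using llr_law(3) I_KL_eq by simp
  have Ym: "Y \<in> measurable M (PiM UNIV (\<lambda>_. borel))"
    unfolding Y_def by (rule measurable_PiM_single') (auto intro: Zm)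
  have Z_indep: "M.indep_vars (\<lambda>_. borel) (\<lambda>k. Z (Suc k)) UNIV"
  proof -
    have "M.indep_vars (\<lambda>_. borel) X (range Suc)" by (rule M.indep_vars_subset[OF X_indep]) auto
    then have "M.indep_vars (\<lambda>_. borel) (\<lambda>k. X (Suc k)) UNIV"
      using M.indep_vars_inj_reindex[OF inj_Suc, where N="\<lambda>_. borel" and X=X and I=UNIV] by simp
    then have "M.indep_vars (\<lambda>_. borel) (\<lambda>k \<omega>. llr f0 f1 (X (Suc k) \<omega>)) UNIV"
      by (rule M.indep_vars_compose2) (rule L)
    then show ?thesis by (simp add: Z_eq[abs_def])
  qed
  have Yd: "distr M (PiM UNIV (\<lambda>_. borel)) Y = law.Q"
    using iffD1[OF M.indep_vars_iff_distr_eq_PiM[of UNIV "\<lambda>k. Z (Suc k)" "\<lambda>_. borel"], OF _ Zm Z_indep]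
    unfolding restrict_UNIV Zd Y_def by simp
  have joint: "distr M (PiM UNIV (\<lambda>_. borel) \<Otimes>\<^sub>M PiM UNIV (\<lambda>_. borel)) (\<lambda>\<omega>. ((\<lambda>k. real (\<xi> k \<omega>)), Y \<omega>)) =
      distr M (PiM UNIV (\<lambda>_. borel)) (\<lambda>\<omega> k. real (\<xi> k \<omega>)) \<Otimes>\<^sub>M law.Q"
  proof -
    have g: "(\<lambda>x i. llr f0 f1 (x (Suc i))) \<in> measurable (PiM {1..} (\<lambda>_. borel)) (PiM UNIV (\<lambda>_. borel))"
    proof (rule measurable_PiM_single')
      show "(\<lambda>x. llr f0 f1 (x (Suc i))) \<in> borel_measurable (PiM {1..} (\<lambda>_. borel))" for i
        by (rule measurable_compose[OF measurable_component_singleton[of "Suc i" "{1..}" "\<lambda>_. borel"] L]) simp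
    qed auto
    have "M.indep_var (PiM UNIV (\<lambda>_. borel)) (id \<circ> (\<lambda>\<omega> k. real (\<xi> k \<omega>))) (PiM UNIV (\<lambda>_. borel))
       ((\<lambda>x i. llr f0 f1 (x (Suc i))) \<circ> (\<lambda>\<omega>. \<lambda>k\<in>{1..}. X k \<omega>))"
      by (rule M.indep_var_compose[OF \<xi>_X_indep _ g]) simp
    moreover have "(\<lambda>x i. llr f0 f1 (x (Suc i))) \<circ> (\<lambda>\<omega>. \<lambda>k\<in>{1..}. X k \<omega>) = Y"
      by (simp add: fun_eq_iff Y_def Z_eq)
    ultimately have "M.indep_var (PiM UNIV (\<lambda>_. borel)) (\<lambda>\<omega> k. real (\<xi> k \<omega>)) (PiM UNIV (\<lambda>_. borel)) Y"
      by (simp add: comp_def)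
    then have "distr M (PiM UNIV (\<lambda>_. borel)) (\<lambda>\<omega> k. real (\<xi> k \<omega>)) \<Otimes>\<^sub>M distr M (PiM UNIV (\<lambda>_. borel)) Y =
        distr M (PiM UNIV (\<lambda>_. borel) \<Otimes>\<^sub>M PiM UNIV (\<lambda>_. borel)) (\<lambda>\<omega>. ((\<lambda>k. real (\<xi> k \<omega>)), Y \<omega>))"
      unfolding M.indep_var_distribution_eq by blast
    then show ?thesis unfolding Yd by (rule sym)
  qed
  have stoch: "stochastic_matrix {0, 1} (two_state_matrix \<alpha> \<beta>)" using chain by (simp add: markov_chain_def)
  have "\<alpha> \<noteq> 1" using irreducible two_state_n_step_0[of \<beta>] by (auto simp: irreducible_matrix_def)
  moreover have "\<beta> \<noteq> 1" using irreducible two_state_n_step_1[of \<alpha>] by (auto simp: irreducible_matrix_def)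
  moreover have "\<alpha> \<le> 1" "\<beta> \<le> 1" using stoch by (auto simp: stochastic_matrix_def two_state_matrix_def)
  ultimately have lt1: "\<alpha> < 1" "\<beta> < 1" by auto
  interpret T: thinned_cusum M \<xi> \<alpha> \<beta> \<mu> Y
    by unfold_locales (fact chain \<xi>_start \<alpha>_pos \<beta>_pos lt1 Ym joint Yd)+
  have stat1: "stat 1 = T.stat1"
  proof -
    have s: "stat 0 + stat 1 = 1" "stat 0 * \<alpha> + stat 1 * (1 - \<beta>) = stat 0"
      using stationary by (auto simp: stationary_distribution_def two_state_matrix_def)
    have s0: "stat 0 = 1 - stat 1" using s(1) by simp
    have "(1 - stat 1) * \<alpha> + stat 1 * (1 - \<beta>) = 1 - stat 1" using s(2) unfolding s0 .
    then have "stat 1 * ((1 - \<alpha>) + (1 - \<beta>)) = 1 - \<alpha>" by (simp add: algebra_simps)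
    then show ?thesis using lt1 by (simp add: T.stat1_def eq_divide_eq)
  qed
  have S_walk: "S = (\<lambda>n \<omega>. walk (Y \<omega>) n)"
    by (simp add: S_eq fun_eq_iff partial_sums_eq_walk Y_def)
  have T_step: "T.step \<omega> = (\<lambda>i. real (\<xi> (Suc i) \<omega>) * Z (Suc i) \<omega>)" for \<omega>
    unfolding T.step_def unfolding Y_def ..
  have St_walk: "St = (\<lambda>n \<omega>. walk (T.step \<omega>) n)"
    by (simp add: St_eq fun_eq_iff partial_sums_eq_walk T_step)
  have W_cus: "W = (\<lambda>n \<omega>. cus (T.step \<omega>) n)"
    by (simp add: W_eq fun_eq_iff cusum_eq_cus T_step)
  have noret: "AE y in law.Q. \<forall>n\<ge>1. walk y n \<noteq> 0"
  proof -
    have "AE \<omega> in M. \<forall>n\<ge>1. walk (Y \<omega>) n \<noteq> 0" using no_return by (simp add: S_walk)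
    moreover have "{y \<in> space (PiM UNIV (\<lambda>_. borel)). \<forall>n\<ge>1. walk y n \<noteq> 0} \<in> sets (PiM UNIV (\<lambda>_. borel))"
      by measurable
    ultimately show ?thesis unfolding Yd[symmetric] by (subst AE_distr_iff[OF Ym])
  qed
  have c_inf: "c_inf = (1 - law.eta)\<^sup>2 / (I_KL * (\<Sum>k. law.t k))"
    unfolding c_inf_eq T_minus_eq S_walk T.ordinary_exp T.ordinary_mean
    using law.t_sum_pos by simp
  have \<beta>: "\<beta>_MRW = law.lam * T.stat1"
  proof -
    have r: "law.r_inf = 1 / (\<Sum>k. law.t k)"
      using law.r_inf_eq law.t_sum_pos by (simp add: eq_divide_eq)
    have "\<beta>_MRW = - (T.stat1 * I_0 * c_inf) / (- I_0 * (\<Sum>k. law.t k))"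
      unfolding \<beta>_MRW_eq K1_eq St_walk T.ladder_mean[OF noret] mean stat1 ..
    also have "\<dots> = T.stat1 * c_inf / (\<Sum>k. law.t k)" using I_0_pos by simp
    also have "\<dots> = law.lam * T.stat1" unfolding c_inf law.lam_def r KL by (simp add: ac_simps)
    finally show ?thesis .
  qed
  have \<beta>pos: "0 < \<beta>_MRW" unfolding \<beta> by (intro mult_pos_pos law.lam_pos T.stat1_pos)
  have Wm: "W k \<in> borel_measurable M" for k
    unfolding W_cus by (rule measurable_compose[OF T.step_measurable T.cus_Pb])
  \<comment> \<open>Positivity of \<open>h\<close> makes the condition at index 0 automatic, where
    the statistic is 0.\<close>
  have below: "(\<forall>k\<in>{1..n}. W k \<omega> \<notin> {h..}) \<longleftrightarrow> (\<forall>k\<le>n. cus (T.step \<omega>) k < h)" if "0 < h" for n h \<omega>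
    unfolding W_cus using that by (subst all_le_iff_Icc) (auto simp: not_le)
  have event: "ereal x < ereal (exp (- h)) * ereal_of_enat (\<tau> h \<omega>) \<longleftrightarrow> (\<forall>k\<le>nat \<lfloor>x / exp (- h)\<rfloor>. cus (T.step \<omega>) k < h)"
    if h: "0 < h" and x: "0 < x" for h x \<omega>
  proof -
    have "ereal x < ereal (exp (- h)) * ereal_of_enat T \<longleftrightarrow> enat (nat \<lfloor>x / exp (- h)\<rfloor>) < T" for T
    proof (cases T)
      case (enat m)
      have "x < exp (- h) * real m \<longleftrightarrow> x / exp (- h) < real m" by (simp add: pos_divide_less_eq mult.commute)
      \<comment> \<open>A strict comparison with an integer on the right is unchanged by taking the
        floor, so the real threshold becomes the index of a survival probability.\<close>
      also have "\<dots> \<longleftrightarrow> nat \<lfloor>x / exp (- h)\<rfloor> < m" using x by (simp add: floor_less_iff nat_less_iff)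
      finally show ?thesis by (simp add: enat)
    qed simp
    then have "ereal x < ereal (exp (- h)) * ereal_of_enat (\<tau> h \<omega>) \<longleftrightarrow> enat (nat \<lfloor>x / exp (- h)\<rfloor>) < first_entry W {h..} \<omega>"
      unfolding \<tau>_eq by blast
    then show ?thesis by (simp only: enat_less_first_entry below[OF h])
  qed
  have part1: "((\<lambda>h. \<P>(\<omega> in M. ereal (exp (- h)) * ereal_of_enat (\<tau> h \<omega>) > ereal x)) \<longlongrightarrow> exp (- \<beta>_MRW * x)) at_top"
    if x: "0 < x" for x
  proof (rule tendsto_at_topI_sequentially)
    fix H :: "nat \<Rightarrow> real" assume H: "filterlim H at_top sequentially"
    have "\<forall>\<^sub>F j in sequentially. 0 < H j" using H by (auto simp: filterlim_at_top_dense)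
    then have "\<forall>\<^sub>F j in sequentially. \<P>(\<omega> in M. \<forall>k\<le>nat \<lfloor>x / exp (- H j)\<rfloor>. cus (T.step \<omega>) k < H j) =
      \<P>(\<omega> in M. ereal (exp (- H j)) * ereal_of_enat (\<tau> (H j) \<omega>) > ereal x)"
      by eventually_elim (simp only: event[OF _ x])
    from Lim_transform_eventually[OF T.survival_limit[OF H x] this]
    show "(\<lambda>j. \<P>(\<omega> in M. ereal (exp (- H j)) * ereal_of_enat (\<tau> (H j) \<omega>) > ereal x)) \<longlonglongrightarrow> exp (- \<beta>_MRW * x)"
      by (simp add: \<beta> mult.assoc)
  qed
  \<comment> \<open>For large \<open>h\<close> the mean is exactly the sum of \<open>law.v h\<close>
    divided by \<open>T.stat1\<close>, so \<open>eps\<close> is the exact relative error, and only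
    its limit remains to be found.\<close>
  define eps where "eps h = \<beta>_MRW * (exp (- h) * (\<Sum>m. law.v h m)) / T.stat1 - 1" for h
  have "(eps \<longlongrightarrow> \<beta>_MRW * (1 / law.lam) / T.stat1 - 1) at_top"
    unfolding eps_def using T.stat1_pos by (intro tendsto_intros law.v_mean) auto
  moreover have "\<beta>_MRW * (1 / law.lam) / T.stat1 - 1 = 0"
    using law.lam_pos T.stat1_pos by (simp add: \<beta>)
  ultimately have eps: "(eps \<longlongrightarrow> 0) at_top" by (simp only:)
  have "\<forall>\<^sub>F h in at_top. mean_time M (\<tau> h) = ennreal (exp h / \<beta>_MRW * (1 + eps h))"
    using law.p_eventually_pos_at_top
  proof eventually_elim
    fix h assume h: "0 < h \<and> 0 < law.p h"
    then have h0: "0 < h" by simp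
    have "mean_time M (\<tau> h) = (\<Sum>n. ennreal (\<P>(\<omega> in M. \<forall>k\<in>{1..n}. W k \<omega> \<notin> {h..})))"
      unfolding \<tau>_eq by (rule M.mean_first_entry) (auto intro: Wm)
    also have "\<dots> = (\<Sum>n. ennreal (\<P>(\<omega> in M. \<forall>k\<le>n. cus (T.step \<omega>) k < h)))"
      unfolding below[OF h0] ..
    also have "\<dots> = ennreal ((\<Sum>m. law.v h m) * (1 / T.stat1))" using h by (intro T.survival_sum) auto
    also have "(\<Sum>m. law.v h m) * (1 / T.stat1) = exp h / \<beta>_MRW * (1 + eps h)"
      using \<beta>pos by (simp add: eps_def exp_minus)
    finally show "mean_time M (\<tau> h) = ennreal (exp h / \<beta>_MRW * (1 + eps h))" .
  qed
  then show ?thesis using part1 eps by blast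
qed

end
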